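(* Let $(B_t,t\ge 0)$ be a real-valued Brownian motion in some filtration $(\mathcal{F}_t,t\ge 0)$, let $(X_t,t\ge 0)$ be a real-valued $(\mathcal{F}_t)$-adapted continuous process, and consider the stochastic integral $I_t=\int_0^t X_s\,\mathrm{d}B_s$, $t\ge 0$. Fix $\eta>0$ and assume that the sample paths of $(X_t,t\ge0)$ are Hölder-continuous with exponent $\eta$ almost surely. Suppose also that $(\tau_\ell,\ell\ge 0)$ is a stable subordinator of index $\alpha\in(0,1)$ which is independent of $\mathcal{F}_\infty$. Then the right-continuous filtration $(\hat{\mathcal{I}}_\ell,\ell\ge 0)$ generated by the subordinate stochastic integral $(\hat I_\ell=I_{\tau_\ell},\ell\ge 0)$ contains the right-continuous filtration generated by $(|X_{\tau_\ell}|,\ell\ge 0)$.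
   Context: A stable subordinator of index $\alpha\in(0,1)$ is a right-continuous increasing process $(\tau_\ell,\ell\ge0)$ with $\tau_0=0$ and stationary independent increments, such that $\mathbb{E}(e^{-q\tau_\ell})=\exp(-c\,\ell\, q^\alpha)$ for all $q,\ell\ge 0$, for some constant $c>0$. $\mathcal{F}_\infty=\sigma\left(\bigcup_{t\ge 0}\mathcal{F}_t\right)$. "Brownian motion in $(\mathcal{F}_t)$" means that the Brownian motion $B$ is $(\mathcal{F}_t)$-adapted and $B_{t+s}-B_t$ is independent of $\mathcal{F}_t$ for all $s,t\ge 0$. The stochastic integral is the Itô integral. The right-continuous filtration generated by a process $(Z_\ell,\ell\ge 0)$ is the smallest right-continuous filtration to which $Z$ is adapted, i.e. its $\sigma$-field at index $\ell$ is $\bigcap_{\varepsilon>0}\sigma(Z_\lambda:\ 0\le\lambda\le \ell+\varepsilon)$. One filtration contains another if, for every index $\ell\ge 0$, the $\sigma$-field at index $\ell$ of the former contains that of the latter.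
   Formalization: The containment of filtrations is proved after adjoining null events to the filtration generated by the subordinate integral; without this it is false, since the integral is defined only almost surely and X may be changed on a null event. *)

theory Defs
  imports "HOL-Probability.Probability"
begin

text \<open>
  Processes are curried functions \<open>Z t \<omega>\<close> with a real time parameter; only times
  \<open>t \<ge> 0\<close> are ever constrained or used.
\<close>

definition filtration_on :: "'a measure \<Rightarrow> (real \<Rightarrow> 'a measure) \<Rightarrow> bool" where
  "filtration_on M F \<longleftrightarrow>
     (\<forall>t\<ge>0. subalgebra M (F t)) \<and>
     (\<forall>s t. 0 \<le> s \<longrightarrow> s \<le> t \<longrightarrow> sets (F s) \<subseteq> sets (F t))"

definition filtration_limit :: "'a measure \<Rightarrow> (real \<Rightarrow> 'a measure) \<Rightarrow> 'a set set" where
  "filtration_limit M F = sigma_sets (space M) (\<Union>t\<in>{0..}. sets (F t))"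

definition adapted :: "(real \<Rightarrow> 'a measure) \<Rightarrow> (real \<Rightarrow> 'a \<Rightarrow> real) \<Rightarrow> bool" where
  "adapted F Z \<longleftrightarrow> (\<forall>t\<ge>0. Z t \<in> borel_measurable (F t))"

definition generated_sigma ::
  "'a measure \<Rightarrow> (real \<Rightarrow> 'a \<Rightarrow> real) \<Rightarrow> real set \<Rightarrow> 'a set set" where
  "generated_sigma M Z J =
     sigma_sets (space M) (\<Union>t\<in>J. {Z t -` A \<inter> space M | A. A \<in> sets borel})"

definition right_cont_filtration ::
  "'a measure \<Rightarrow> (real \<Rightarrow> 'a \<Rightarrow> real) \<Rightarrow> real \<Rightarrow> 'a set set" where
  "right_cont_filtration M Z l = (\<Inter>\<epsilon>\<in>{0<..}. generated_sigma M Z {0..l + \<epsilon>})"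

text \<open>
  Stochastic integrals are determined only up to null events, so \<open>\<sigma>\<close>-fields are compared
  after adjoining the null events of the underlying probability space. For a decreasing sequence
  of \<open>\<sigma>\<close>-fields this operation commutes with intersection, hence it is immaterial
  whether it is applied before or after making a filtration right-continuous.
\<close>

definition augmented :: "'a measure \<Rightarrow> 'a set set \<Rightarrow> 'a set set" where
  "augmented M \<A> = sigma_sets (space M) (\<A> \<union> null_sets M)"

definition independent_increments :: "'a measure \<Rightarrow> (real \<Rightarrow> 'a \<Rightarrow> real) \<Rightarrow> bool" where
  "independent_increments M Z \<longleftrightarrow>
     (\<forall>(n::nat) (t::nat \<Rightarrow> real). 0 \<le> t 0 \<longrightarrow> (\<forall>i<n. t i \<le> t (Suc i)) \<longrightarrow>
        prob_space.indep_vars M (\<lambda>_. borel) (\<lambda>i \<omega>. Z (t (Suc i)) \<omega> - Z (t i) \<omega>) {..<n})"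

definition stationary_increments :: "'a measure \<Rightarrow> (real \<Rightarrow> 'a \<Rightarrow> real) \<Rightarrow> bool" where
  "stationary_increments M Z \<longleftrightarrow>
     (\<forall>s\<ge>0. \<forall>t\<ge>0.
        distr M borel (\<lambda>\<omega>. Z (t + s) \<omega> - Z t \<omega>) = distr M borel (\<lambda>\<omega>. Z s \<omega> - Z 0 \<omega>))"

definition brownian_motion :: "'a measure \<Rightarrow> (real \<Rightarrow> 'a \<Rightarrow> real) \<Rightarrow> bool" where
  "brownian_motion M B \<longleftrightarrow>
     (\<forall>t\<ge>0. B t \<in> borel_measurable M) \<and>
     (AE \<omega> in M. B 0 \<omega> = 0) \<and>
     (AE \<omega> in M. continuous_on {0..} (\<lambda>t. B t \<omega>)) \<and>
     independent_increments M B \<and>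
     (\<forall>t\<ge>0. \<forall>s>0. distributed M lborel (\<lambda>\<omega>. B (t + s) \<omega> - B t \<omega>) (normal_density 0 (sqrt s)))"

definition brownian_motion_in ::
  "'a measure \<Rightarrow> (real \<Rightarrow> 'a measure) \<Rightarrow> (real \<Rightarrow> 'a \<Rightarrow> real) \<Rightarrow> bool" where
  "brownian_motion_in M F B \<longleftrightarrow>
     brownian_motion M B \<and> adapted F B \<and>
     (\<forall>t\<ge>0. \<forall>s\<ge>0. prob_space.indep_set M (sets (F t))
        {(\<lambda>\<omega>. B (t + s) \<omega> - B t \<omega>) -` A \<inter> space M | A. A \<in> sets borel})"

definition converges_in_prob ::
  "'a measure \<Rightarrow> (nat \<Rightarrow> 'a \<Rightarrow> real) \<Rightarrow> ('a \<Rightarrow> real) \<Rightarrow> bool" where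
  "converges_in_prob M Y Z \<longleftrightarrow>
     (\<forall>n. Y n \<in> borel_measurable M) \<and> Z \<in> borel_measurable M \<and>
     (\<forall>\<epsilon>>0. (\<lambda>n. measure M {\<omega> \<in> space M. \<bar>Y n \<omega> - Z \<omega>\<bar> > \<epsilon>}) \<longlonglongrightarrow> 0)"

text \<open>
  The triple \<open>k, t, \<xi>\<close> encodes the simple process
  \<open>\<Sum>i<k. \<xi> i * 1 {t i <.. t (Suc i)}\<close>.
\<close>

definition simple_process ::
  "(real \<Rightarrow> 'a measure) \<Rightarrow> nat \<Rightarrow> (nat \<Rightarrow> real) \<Rightarrow> (nat \<Rightarrow> 'a \<Rightarrow> real) \<Rightarrow> bool" where
  "simple_process F k t \<xi> \<longleftrightarrow>
     0 \<le> t 0 \<and> (\<forall>i<k. t i \<le> t (Suc i)) \<and>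
     (\<forall>i<k. \<xi> i \<in> borel_measurable (F (t i)) \<and>
        (\<exists>C. \<forall>\<omega>\<in>space (F (t i)). \<bar>\<xi> i \<omega>\<bar> \<le> C))"

definition simple_value ::
  "nat \<Rightarrow> (nat \<Rightarrow> real) \<Rightarrow> (nat \<Rightarrow> 'a \<Rightarrow> real) \<Rightarrow> real \<Rightarrow> 'a \<Rightarrow> real" where
  "simple_value k t \<xi> s \<omega> = (\<Sum>i<k. \<xi> i \<omega> * indicator {t i<..t (Suc i)} s)"

definition simple_integral_wrt ::
  "(real \<Rightarrow> 'a \<Rightarrow> real) \<Rightarrow> nat \<Rightarrow> (nat \<Rightarrow> real) \<Rightarrow> (nat \<Rightarrow> 'a \<Rightarrow> real) \<Rightarrow> real \<Rightarrow> 'a \<Rightarrow> real" where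
  "simple_integral_wrt B k t \<xi> u \<omega> =
     (\<Sum>i<k. \<xi> i \<omega> * (B (min (t (Suc i)) u) \<omega> - B (min (t i) u) \<omega>))"

text \<open>
  \<open>I\<close> is a version with continuous paths of the Ito integral process of \<open>X\<close> against
  \<open>B\<close>: the integral is first defined for simple processes, and then extended by continuity
  from the topology of convergence in probability of \<open>\<integral>\<^sub>0\<^sup>T (H s - X s)\<^sup>2 ds\<close>
  (for all \<open>T\<close>) to that of convergence in probability. These conditions
  determine \<open>I\<close> up to indistinguishability. The integrand \<open>X\<close> is meant to have continuous
  paths, so that the time integral below is always that of an integrable function.
\<close>

definition ito_integral_process ::
  "'a measure \<Rightarrow> (real \<Rightarrow> 'a measure) \<Rightarrow> (real \<Rightarrow> 'a \<Rightarrow> real) \<Rightarrow> (real \<Rightarrow> 'a \<Rightarrow> real) \<Rightarrow>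
   (real \<Rightarrow> 'a \<Rightarrow> real) \<Rightarrow> bool" where
  "ito_integral_process M F B X I \<longleftrightarrow>
     (\<forall>\<omega>\<in>space M. continuous_on {0..} (\<lambda>u. I u \<omega>)) \<and>
     (\<exists>(k :: nat \<Rightarrow> nat) (t :: nat \<Rightarrow> nat \<Rightarrow> real) (\<xi> :: nat \<Rightarrow> nat \<Rightarrow> 'a \<Rightarrow> real).
        (\<forall>n. simple_process F (k n) (t n) (\<xi> n)) \<and>
        (\<forall>T\<ge>0. converges_in_prob M
           (\<lambda>n \<omega>. LINT s:{0..T}|lborel. (simple_value (k n) (t n) (\<xi> n) s \<omega> - X s \<omega>)\<^sup>2)
           (\<lambda>_. 0)) \<and>
        (\<forall>u\<ge>0. converges_in_prob M
           (\<lambda>n. simple_integral_wrt B (k n) (t n) (\<xi> n) u) (I u)))"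

definition stable_subordinator ::
  "'a measure \<Rightarrow> real \<Rightarrow> (real \<Rightarrow> 'a \<Rightarrow> real) \<Rightarrow> bool" where
  "stable_subordinator M \<alpha> \<tau> \<longleftrightarrow>
     (\<forall>l\<ge>0. \<tau> l \<in> borel_measurable M) \<and>
     (\<forall>\<omega>\<in>space M. \<tau> 0 \<omega> = 0 \<and> mono_on {0..} (\<lambda>l. \<tau> l \<omega>) \<and>
        (\<forall>l\<ge>0. continuous (at_right l) (\<lambda>l. \<tau> l \<omega>))) \<and>
     independent_increments M \<tau> \<and> stationary_increments M \<tau> \<and>
     (\<exists>c>0. \<forall>q\<ge>0. \<forall>l\<ge>0.
        integral\<^sup>L M (\<lambda>\<omega>. exp (- q * \<tau> l \<omega>)) = exp (- c * l * q powr \<alpha>))"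

text \<open>
  As usual for paths indexed by the half-line, the Hoelder constant may depend on the compact
  time interval (this is weaker than asking for one constant on the whole half-line).
\<close>

definition holder_path :: "real \<Rightarrow> (real \<Rightarrow> real) \<Rightarrow> bool" where
  "holder_path \<eta> f \<longleftrightarrow>
     (\<forall>T\<ge>0. \<exists>C. \<forall>s\<in>{0..T}. \<forall>t\<in>{0..T}. \<bar>f t - f s\<bar> \<le> C * \<bar>t - s\<bar> powr \<eta>)"

end

theory Submission
  imports Defs
begin

text \<open>
  Fix \<open>l\<close> and cut a short interval to the right of \<open>l\<close> into \<open>K\<close> pieces of length \<open>h\<close>. Over one
  piece the subordinate integral \<open>I (\<tau> l)\<close> moves by about \<open>X (\<tau> l)\<close> times the increment of the subordinate
  Brownian motion \<open>B (\<tau> l)\<close>, because \<open>X\<close> is continuous and \<open>\<tau>\<close> is right-continuous. The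
  subordinate Brownian motion is a symmetric stable process of index \<open>2 \<alpha>\<close>: its increments over the
  pieces, divided by \<open>s = h powr (1 / (2 \<alpha>))\<close>, are independent and have a common law with
  characteristic function \<open>exp (- c (x\<^sup>2 / 2) powr \<alpha>)\<close> at \<open>x\<close>. By the law of large numbers, the average of
  the cosines of the increments of \<open>I (\<tau> l)\<close> divided by \<open>s\<close> converges to this function
  evaluated at \<open>x = X (\<tau> l)\<close>, if \<open>K\<close> tends to infinity and \<open>K h\<close> to \<open>0\<close>. The
  limit determines \<open>\<bar>X (\<tau> l)\<bar>\<close>, and it is a function, up to a null event, of the subordinate integral
  immediately after \<open>l\<close>.

  Cosines are used because they are bounded, so that no moments of the heavy-tailed increments are
  required, and because they average out explicitly, first over the Brownian motion and then over
  the subordinator. The two averages are kept separate. By independence the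
  subordinator and the rest of the randomness may be given separate outcomes, as in
  \<open>decouple_subalgebras\<close>. For a frozen path of the subordinator only deterministic times occur, and
  \<open>brownian_cos_average_L1_le\<close> averages the Brownian motion out at a rate that does not
  depend on these times. For frozen \<open>X\<close> the average over the subordinator
  is \<open>subordinator_exp_average_L1_le\<close>. Both rest on orthogonality of bounded centred
  terms.

  The local approximation of the integral is \<open>ito_integral_local_error\<close>. Its proof goes back to
  the definition of the Ito integral as a limit of simple integrals, for which a tail bound
  follows from the isometry by stopping the integrand when it has used up its energy.

  The estimates meet in \<open>subordinated_average_L1_le\<close>, from which \<open>abs_subordinated_measurable\<close>
  derives that \<open>\<bar>X (\<tau> l)\<bar>\<close> is measurable up to null events for the subordinate integral on
  \<open>[0, l + \<delta>]\<close>, for every \<open>\<delta> > 0\<close>. That augmentation commutes with decreasing intersections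
  (\<open>augmented_INT\<close>) turns this into the inclusion of right-continuous filtrations.
\<close>

section \<open>Adjoining null events\<close>

lemma augmented_subset_sets:
  assumes "\<A> \<subseteq> sets M" shows "augmented M \<A> \<subseteq> sets M"
  unfolding augmented_def using assms by (intro sets.sigma_sets_subset) auto

lemma sigma_algebra_augmented:
  assumes "\<A> \<subseteq> sets M" shows "sigma_algebra (space M) (augmented M \<A>)"
  unfolding augmented_def using assms sets.sets_into_space
  by (intro sigma_algebra_sigma_sets) (auto simp: null_sets_def dest!: sets.sets_into_space)

text \<open>
  The events that agree almost surely with a member of \<open>\<A>\<close> form a \<open>\<sigma>\<close>-field containing
  both generators of the augmentation. This reduces every question about an augmented
  \<open>\<sigma>\<close>-field to one about \<open>\<A>\<close>.
\<close>

lemma augmented_AE_eq: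
  assumes \<A>: "sigma_algebra (space M) \<A>" "\<A> \<subseteq> sets M" and "A \<in> augmented M \<A>"
  shows "\<exists>A'\<in>\<A>. AE x in M. x \<in> A \<longleftrightarrow> x \<in> A'"
proof -
  interpret \<A>: sigma_algebra "space M" \<A> by fact
  have "A \<in> sigma_sets (space M) (\<A> \<union> null_sets M)"
    using assms(3) by (simp add: augmented_def)
  then show ?thesis
  proof induction
    case (Basic a)
    then show ?case
    proof
      assume "a \<in> null_sets M"
      then have "AE x in M. x \<in> a \<longleftrightarrow> x \<in> {}" using AE_not_in by auto
      then show ?thesis by blast
    qed auto
  next
    case Empty
    show ?case by auto
  next
    case (Compl a)
    then obtain a' where "a' \<in> \<A>" "AE x in M. x \<in> a \<longleftrightarrow> x \<in> a'" by blast
    then show ?case by (intro bexI[of _ "space M - a'"]) auto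
  next
    case (Union a)
    then have "\<forall>i. \<exists>a'. a' \<in> \<A> \<and> (AE x in M. x \<in> a i \<longleftrightarrow> x \<in> a')" by blast
    then obtain a' where a': "\<And>i. a' i \<in> \<A>" "\<And>i. AE x in M. x \<in> a i \<longleftrightarrow> x \<in> a' i" by metis
    have "AE x in M. \<forall>i. x \<in> a i \<longleftrightarrow> x \<in> a' i" using a'(2) by (simp add: AE_all_countable)
    then have "AE x in M. x \<in> (\<Union>i. a i) \<longleftrightarrow> x \<in> (\<Union>i. a' i)" by eventually_elim auto
    with a'(1) show ?case by (intro bexI[of _ "\<Union>i. a' i"]) auto
  qed
qed

lemma augmentedI:
  assumes "\<A> \<subseteq> sets M" "A \<in> sets M" "A' \<in> \<A>" "AE x in M. x \<in> A \<longleftrightarrow> x \<in> A'"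
  shows "A \<in> augmented M \<A>"
proof -
  interpret aug: sigma_algebra "space M" "augmented M \<A>"
    by (rule sigma_algebra_augmented) fact
  have "A' \<in> sets M" using assms by auto
  have 1: "A - A' \<in> null_sets M" "A' - A \<in> null_sets M"
    using assms \<open>A' \<in> sets M\<close> by (auto simp: AE_iff_null_sets elim!: eventually_mono)
  have "A' \<in> augmented M \<A>" "A - A' \<in> augmented M \<A>" "A' - A \<in> augmented M \<A>"
    using assms(3) 1 by (auto simp: augmented_def)
  then have "(A' - (A' - A)) \<union> (A - A') \<in> augmented M \<A>" by auto
  also have "(A' - (A' - A)) \<union> (A - A') = A" by auto
  finally show ?thesis .
qed

text \<open>
  Augmentation commutes with decreasing intersections: given representatives
  \<open>a n \<in> \<A> n\<close> of \<open>A\<close> modulo null events, the tail event \<open>limsup a n\<close> lies in every \<open>\<A> n\<close> and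
  still represents \<open>A\<close>. This is what permits passing to the right limit of a filtration after
  its members have been compared up to null events.
\<close>

lemma augmented_INT:
  assumes \<A>: "\<And>n::nat. sigma_algebra (space M) (\<A> n)" "\<And>n. \<A> n \<subseteq> sets M"
    and dec: "\<And>m n. m \<le> n \<Longrightarrow> \<A> n \<subseteq> \<A> m"
    and A: "\<And>n. A \<in> augmented M (\<A> n)"
  shows "A \<in> augmented M (\<Inter>n. \<A> n)"
proof -
  have "\<forall>n. \<exists>a. a \<in> \<A> n \<and> (AE x in M. x \<in> A \<longleftrightarrow> x \<in> a)"
    using augmented_AE_eq[OF \<A> A] by blast
  then obtain a where a: "\<And>n. a n \<in> \<A> n" "\<And>n. AE x in M. x \<in> A \<longleftrightarrow> x \<in> a n" by metis
  define L where "L = (\<Inter>m. \<Union>n. a (n + m))"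
  have "L \<in> \<A> j" for j
  proof -
    interpret sigma_algebra "space M" "\<A> j" by (rule \<A>)
    \<comment> \<open>the upper limit is unchanged when the first \<open>j\<close> terms are dropped\<close>
    have "L = (\<Inter>m. \<Union>n. a (n + (m + j)))"
    proof (intro set_eqI iffI)
      fix x assume "x \<in> (\<Inter>m. \<Union>n. a (n + (m + j)))"
      then have "\<And>m. \<exists>n. x \<in> a (n + (m + j))" by auto
      then show "x \<in> L" unfolding L_def
        by (auto, metis add.commute add.assoc)
    qed (auto simp: L_def)
    also have "(\<Inter>m. \<Union>n. a (n + (m + j))) \<in> \<A> j"
    proof -
      have "a (n + (m + j)) \<in> \<A> j" for n m
        using a(1)[of "n + (m + j)"] dec[of j "n + (m + j)"] by auto
      then show ?thesis by (intro countable_INT countable_UN) auto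
    qed
    finally show ?thesis .
  qed
  moreover have "AE x in M. x \<in> A \<longleftrightarrow> x \<in> L"
  proof -
    have "AE x in M. \<forall>n. x \<in> A \<longleftrightarrow> x \<in> a n" using a(2) by (simp add: AE_all_countable)
    then show ?thesis by eventually_elim (auto simp: L_def)
  qed
  moreover have "A \<in> sets M" using A[of 0] augmented_subset_sets[OF \<A>(2)] by auto
  moreover have "(\<Inter>n. \<A> n) \<subseteq> sets M" using \<A>(2) by auto
  ultimately show ?thesis by (intro augmentedI[of _ _ _ L]) auto
qed

lemma (in prob_space) indep_set_augmented:
  assumes "sigma_algebra (space M) \<B>" and ind: "indep_set \<A> \<B>"
  shows "indep_set \<A> (augmented M \<B>)"
proof (rule indep_setI)
  have \<B>: "\<B> \<subseteq> events" by (rule indep_setD_ev2[OF ind])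
  show "augmented M \<B> \<subseteq> events" by (rule augmented_subset_sets[OF \<B>])
  show \<A>: "\<A> \<subseteq> events" by (rule indep_setD_ev1[OF ind])
  fix a b assume ab: "a \<in> \<A>" "b \<in> augmented M \<B>"
  obtain b' where b': "b' \<in> \<B>" "AE x in M. x \<in> b \<longleftrightarrow> x \<in> b'"
    using augmented_AE_eq[OF assms(1) \<B> ab(2)] by blast
  have [measurable]: "a \<in> events" "b \<in> events" "b' \<in> events"
    using ab b' \<A> \<B> augmented_subset_sets[OF \<B>] by auto
  have "prob b = prob b'" "prob (a \<inter> b) = prob (a \<inter> b')"
    using b'(2) by (auto intro!: finite_measure_eq_AE)
  then show "prob (a \<inter> b) = prob a * prob b" using indep_setD[OF ind ab(1) b'(1)] by simp
qed

text \<open>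
  An almost sure limit of \<open>\<A>\<close>-measurable variables need not be \<open>\<A>\<close>-measurable, only measurable
  for the augmentation. Both the Ito integral at a fixed time and the limit from which \<open>\<bar>X\<bar>\<close> is
  recovered are of this kind.
\<close>

lemma measurable_augmentedI:
  fixes f g :: "'a \<Rightarrow> real"
  assumes \<A>: "sigma_algebra (space M) \<A>" "\<A> \<subseteq> sets M"
    and f: "f \<in> borel_measurable M" and g: "g \<in> borel_measurable (sigma (space M) \<A>)"
    and eq: "AE x in M. f x = g x"
  shows "f \<in> borel_measurable (sigma (space M) (augmented M \<A>))"
proof (rule measurableI)
  interpret aug: sigma_algebra "space M" "augmented M \<A>"
    by (rule sigma_algebra_augmented) fact
  interpret \<A>: sigma_algebra "space M" \<A> by fact
  have sp: "space (sigma (space M) (augmented M \<A>)) = space M"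
    and st: "sets (sigma (space M) (augmented M \<A>)) = augmented M \<A>"
    using aug.space_closed by (auto simp: aug.sets_measure_of_eq)
  fix S :: "real set" assume [measurable]: "S \<in> sets borel"
  have "f -` S \<inter> space M \<in> augmented M \<A>"
  proof (rule augmentedI[OF \<A>(2)])
    show "f -` S \<inter> space M \<in> sets M" using f by measurable
    show "g -` S \<inter> space M \<in> \<A>"
      using measurable_sets[OF g, of S] \<A>.space_closed by (simp add: \<A>.sets_measure_of_eq)
    show "AE x in M. (x \<in> f -` S \<inter> space M) = (x \<in> g -` S \<inter> space M)"
      using eq by eventually_elim auto
  qed
  then show "f -` S \<inter> space (sigma (space M) (augmented M \<A>)) \<in> sets (sigma (space M) (augmented M \<A>))"
    by (simp only: sp st)
qed auto

section \<open>Decoupling, and averages of orthogonal variables\<close>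

text \<open>
  The joint law of two independent random elements is a product measure, so one of them may be
  frozen while integrating over the other. Elements with values in two different measurable
  spaces are allowed, in particular the identity map into a sub-\<open>\<sigma>\<close>-field, which stands for all
  the information in that \<open>\<sigma>\<close>-field at once.
\<close>

lemma (in prob_space) integral_decouple:
  fixes f :: "'b \<times> 'c \<Rightarrow> real"
  assumes X: "X \<in> measurable M S" and Y: "Y \<in> measurable M T"
    and ind: "indep_set {X -` A \<inter> space M | A. A \<in> sets S} {Y -` A \<inter> space M | A. A \<in> sets T}"
    and f: "f \<in> borel_measurable (S \<Otimes>\<^sub>M T)"
    and C: "\<And>x y. x \<in> space S \<Longrightarrow> y \<in> space T \<Longrightarrow> \<bar>f (x, y)\<bar> \<le> C"
  shows "(\<integral>\<omega>. f (X \<omega>, Y \<omega>) \<partial>M) = (\<integral>\<omega>1. (\<integral>\<omega>2. f (X \<omega>1, Y \<omega>2) \<partial>M) \<partial>M)"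
proof -
  interpret S: prob_space "distr M S X" by (rule prob_space_distr) fact
  interpret T: prob_space "distr M T Y" by (rule prob_space_distr) fact
  interpret ST: pair_prob_space "distr M S X" "distr M T Y" ..
  have eq: "distr M S X \<Otimes>\<^sub>M distr M T Y = distr M (S \<Otimes>\<^sub>M T) (\<lambda>\<omega>. (X \<omega>, Y \<omega>))"
  proof (rule pair_measure_eqI)
    fix A B assume AB: "A \<in> sets (distr M S X)" "B \<in> sets (distr M T Y)"
    have *: "(\<lambda>\<omega>. (X \<omega>, Y \<omega>)) -` (A \<times> B) \<inter> space M = (X -` A \<inter> space M) \<inter> (Y -` B \<inter> space M)"
      by auto
    have "prob ((X -` A \<inter> space M) \<inter> (Y -` B \<inter> space M)) = prob (X -` A \<inter> space M) * prob (Y -` B \<inter> space M)"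
      using AB by (intro indep_setD[OF ind]) auto
    then show "emeasure (distr M S X) A * emeasure (distr M T Y) B =
        emeasure (distr M (S \<Otimes>\<^sub>M T) (\<lambda>\<omega>. (X \<omega>, Y \<omega>))) (A \<times> B)"
      using AB X Y by (simp add: emeasure_distr * emeasure_eq_measure ennreal_mult)
  qed (simp_all add: S.sigma_finite_measure_axioms T.sigma_finite_measure_axioms cong: sets_pair_measure_cong)
  have f': "f \<in> borel_measurable (distr M S X \<Otimes>\<^sub>M distr M T Y)"
    using f by (simp cong: measurable_cong_sets)
  have f2: "(\<lambda>y. f (x, y)) \<in> borel_measurable T" if "x \<in> space S" for x
    using f that by measurable
  have int: "integrable (distr M S X \<Otimes>\<^sub>M distr M T Y) f"
    using f' C by (intro ST.integrable_const_bound[of _ C]) (auto simp: space_pair_measure intro!: AE_I2)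
  have "(\<integral>\<omega>. f (X \<omega>, Y \<omega>) \<partial>M) = (\<integral>z. f z \<partial>distr M (S \<Otimes>\<^sub>M T) (\<lambda>\<omega>. (X \<omega>, Y \<omega>)))"
    using X Y f by (subst integral_distr) auto
  also have "\<dots> = (\<integral>x. (\<integral>y. f (x, y) \<partial>distr M T Y) \<partial>distr M S X)"
    unfolding eq[symmetric] by (rule ST.integral_fst'[OF int, symmetric])
  also have "\<dots> = (\<integral>\<omega>1. (\<integral>y. f (X \<omega>1, y) \<partial>distr M T Y) \<partial>M)"
  proof (rule integral_distr[OF X])
    have "case_prod (\<lambda>x y. f (x, y)) \<in> borel_measurable (distr M S X \<Otimes>\<^sub>M distr M T Y)"
      using f' by (simp add: case_prod_eta)
    from T.borel_measurable_lebesgue_integral[OF this]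
    show "(\<lambda>x. \<integral>y. f (x, y) \<partial>distr M T Y) \<in> borel_measurable S" by simp
  qed
  also have "\<dots> = (\<integral>\<omega>1. (\<integral>\<omega>2. f (X \<omega>1, Y \<omega>2) \<partial>M) \<partial>M)"
    using X Y f2 by (intro Bochner_Integration.integral_cong refl)
      (auto simp: integral_distr dest: measurable_space)
  finally show ?thesis .
qed

lemma subalgebra_vimage_id:
  assumes "subalgebra M S"
  shows "{(\<lambda>\<omega>. \<omega>) -` A \<inter> space M | A. A \<in> sets S} = sets S"
proof -
  have eq: "A \<inter> space M = A" if "A \<in> sets S" for A
    using sets.sets_into_space[OF that] assms by (auto simp: subalgebra_def)
  show ?thesis
  proof (intro equalityI subsetI)
    fix A assume "A \<in> {(\<lambda>\<omega>. \<omega>) -` A \<inter> space M | A. A \<in> sets S}"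
    then obtain A' where "A' \<in> sets S" "A = A' \<inter> space M" by auto
    then show "A \<in> sets S" using eq by simp
  next
    fix A assume "A \<in> sets S"
    then show "A \<in> {(\<lambda>\<omega>. \<omega>) -` A \<inter> space M | A. A \<in> sets S}"
      using eq by (intro CollectI exI[of _ A]) simp
  qed
qed

lemma subalgebra_measurable_id: "subalgebra M S \<Longrightarrow> (\<lambda>\<omega>. \<omega>) \<in> measurable M S"
  using sets.sets_into_space by (fastforce simp: subalgebra_def measurable_def Int_absorb2)

text \<open>
  A weak law of large numbers with an explicit rate: for orthogonal variables the
  second moment of the sum is at most \<open>4 K\<close>, and the \<open>L\<^sup>1\<close> norm is at most the \<open>L\<^sup>2\<close> norm.
  The rate depends on nothing but the bound \<open>2\<close>, which makes it uniform in any
  frozen parameters.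
\<close>

lemma (in prob_space) L1_average_orthogonal_le:
  fixes Z :: "nat \<Rightarrow> 'a \<Rightarrow> real"
  assumes K: "K > 0" and [measurable]: "\<And>k. k < K \<Longrightarrow> Z k \<in> borel_measurable M"
    and bd: "\<And>k \<omega>. \<bar>Z k \<omega>\<bar> \<le> 2"
    and orth: "\<And>j k. j < k \<Longrightarrow> k < K \<Longrightarrow> expectation (\<lambda>\<omega>. Z j \<omega> * Z k \<omega>) = 0"
  shows "expectation (\<lambda>\<omega>. \<bar>(\<Sum>k<K. Z k \<omega>) / K\<bar>) \<le> 2 / sqrt K"
proof -
  define S where "S \<omega> = (\<Sum>k<K. Z k \<omega>) / K" for \<omega>
  have S[measurable]: "S \<in> borel_measurable M" unfolding S_def[abs_def] by measurable
  have Sb: "\<bar>S \<omega>\<bar> \<le> 2" for \<omega>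
  proof -
    have "\<bar>\<Sum>k<K. Z k \<omega>\<bar> \<le> (\<Sum>k<K. 2)" by (intro order_trans[OF sum_abs] sum_mono bd)
    then show ?thesis using K by (simp add: S_def field_simps)
  qed
  have iS: "integrable M (\<lambda>\<omega>. \<bar>S \<omega>\<bar>)" "integrable M (\<lambda>\<omega>. \<bar>S \<omega>\<bar>\<^sup>2)"
    using Sb power_mono[OF Sb abs_ge_zero, of _ 2]
    by (intro integrable_const_bound[of _ 2] integrable_const_bound[of _ 4]; simp)+
  have bd2: "\<bar>Z j \<omega> * Z k \<omega>\<bar> \<le> 4" for j k \<omega>
    using mult_mono[OF bd[of j \<omega>] bd[of k \<omega>]] by (simp add: abs_mult)
  have iZ: "integrable M (\<lambda>\<omega>. Z j \<omega> * Z k \<omega>)" if "j < K" "k < K" for j k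
    using that bd2 by (intro integrable_const_bound[of _ 4]) auto
  have E: "expectation (\<lambda>\<omega>. Z j \<omega> * Z k \<omega>) \<le> (if j = k then 4 else 0)" if "j < K" "k < K" for j k
  proof -
    consider "j = k" | "j < k" | "k < j" by linarith
    then show ?thesis
    proof cases
      case 1
      have "expectation (\<lambda>\<omega>. Z j \<omega> * Z k \<omega>) \<le> expectation (\<lambda>\<omega>. 4)"
        using iZ[OF that] bd2 by (intro integral_mono) (auto intro: order_trans[OF abs_ge_self])
      then show ?thesis using 1 by (simp add: prob_space)
    next
      case 3
      then show ?thesis using orth[of k j] that by (simp add: mult.commute)
    qed (use orth[of j k] that in auto)
  qed
  have "expectation (\<lambda>\<omega>. \<bar>S \<omega>\<bar>\<^sup>2) = expectation (\<lambda>\<omega>. (\<Sum>j<K. \<Sum>k<K. Z j \<omega> * Z k \<omega>) / K\<^sup>2)"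
    by (intro Bochner_Integration.integral_cong)
      (auto simp: S_def power2_eq_square sum_product)
  also have "\<dots> = (\<Sum>j<K. expectation (\<lambda>\<omega>. \<Sum>k<K. Z j \<omega> * Z k \<omega>)) / K\<^sup>2"
    by (subst integral_divide_zero, subst Bochner_Integration.integral_sum)
      (auto intro!: iZ Bochner_Integration.integrable_sum)
  also have "\<dots> = (\<Sum>j<K. \<Sum>k<K. expectation (\<lambda>\<omega>. Z j \<omega> * Z k \<omega>)) / K\<^sup>2"
    by (intro arg_cong2[where f="(/)"] sum.cong refl Bochner_Integration.integral_sum) (auto intro: iZ)
  also have "\<dots> \<le> (\<Sum>j<K. \<Sum>k<K. if j = k then 4 else 0) / K\<^sup>2"
    using E by (intro divide_right_mono sum_mono) auto
  also have "\<dots> = 4 / K" using K by (simp add: sum.If_cases power2_eq_square)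
  finally have "expectation (\<lambda>\<omega>. \<bar>S \<omega>\<bar>\<^sup>2) \<le> 4 / K" .
  moreover have "(expectation (\<lambda>\<omega>. \<bar>S \<omega>\<bar>))\<^sup>2 \<le> expectation (\<lambda>\<omega>. \<bar>S \<omega>\<bar>\<^sup>2)"
    using variance_positive[of "\<lambda>\<omega>. \<bar>S \<omega>\<bar>"] variance_eq[OF iS] by simp
  ultimately have "(expectation (\<lambda>\<omega>. \<bar>S \<omega>\<bar>))\<^sup>2 \<le> (2 / sqrt K)\<^sup>2"
    using K by (simp add: power_divide)
  then show ?thesis unfolding S_def[symmetric] by (rule power2_le_imp_le) auto
qed

text \<open>
  Paths are approximated by their values at multiples of \<open>1 / (n + 1)\<close>, chosen below the random
  time so that no time outside \<open>[0, \<infinity>)\<close> is ever used.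
\<close>

lemma measurable_continuous_process_at:
  fixes Z :: "real \<Rightarrow> 'b \<Rightarrow> real"
  assumes Z: "\<And>t. t \<ge> 0 \<Longrightarrow> Z t \<in> borel_measurable S"
    and cont: "\<And>\<omega>. \<omega> \<in> space S \<Longrightarrow> continuous_on {0..} (\<lambda>t. Z t \<omega>)"
    and f[measurable]: "f \<in> borel_measurable N" and pos: "\<And>x. x \<in> space N \<Longrightarrow> f x \<ge> 0"
    and g[measurable]: "g \<in> measurable N S"
  shows "(\<lambda>x. Z (f x) (g x)) \<in> borel_measurable N"
proof (rule borel_measurable_LIMSEQ_real)
  define d where "d n x = real (nat \<lfloor>(real n + 1) * f x\<rfloor>) / (real n + 1)" for n x
  fix x assume x: "x \<in> space N"
  have lim: "(\<lambda>n. d n x) \<longlonglongrightarrow> f x"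
  proof (rule tendsto_sandwich)
    show "eventually (\<lambda>n. f x - inverse (real (Suc n)) \<le> d n x) sequentially"
    proof (intro always_eventually allI)
      fix n
      have "(real n + 1) * f x \<le> real (nat \<lfloor>(real n + 1) * f x\<rfloor>) + 1"
        using pos[OF x] by linarith
      then have "f x \<le> (real (nat \<lfloor>(real n + 1) * f x\<rfloor>) + 1) / (real n + 1)"
        by (subst pos_le_divide_eq) (auto simp: mult.commute)
      then show "f x - inverse (real (Suc n)) \<le> d n x"
        by (simp add: d_def add_divide_distrib inverse_eq_divide add.commute)
    qed
    show "eventually (\<lambda>n. d n x \<le> f x) sequentially"
      using pos[OF x] by (auto simp: d_def field_simps of_nat_nat intro!: always_eventually)
    show "(\<lambda>n. f x - inverse (real (Suc n))) \<longlonglongrightarrow> f x"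
      using tendsto_diff[OF tendsto_const LIMSEQ_inverse_real_of_nat, of "f x"] by simp
  qed auto
  have "g x \<in> space S" using measurable_space[OF g x] .
  from cont[OF this] have "((\<lambda>t. Z t (g x)) \<longlongrightarrow> Z (f x) (g x)) (at (f x) within {0..})"
    using pos[OF x] by (auto simp: continuous_on_def)
  then show "(\<lambda>n. Z (d n x) (g x)) \<longlonglongrightarrow> Z (f x) (g x)"
    using continuous_on_tendsto_compose[OF cont[OF \<open>g x \<in> space S\<close>] lim] pos[OF x]
    by (auto simp: d_def)
next
  fix n
  show "(\<lambda>x. Z (real (nat \<lfloor>(real n + 1) * f x\<rfloor>) / (real n + 1)) (g x)) \<in> borel_measurable N"
  proof (rule measurable_compose_countable[where f="\<lambda>i x. Z (real i / (real n + 1)) (g x)"])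
    fix i :: nat
    show "(\<lambda>x. Z (real i / (real n + 1)) (g x)) \<in> borel_measurable N"
      by (rule measurable_compose[OF g Z]) auto
  qed measurable
qed

section \<open>Brownian increments and simple integrals\<close>

lemma filtration_onD:
  assumes "filtration_on M F" "0 \<le> s"
  shows "subalgebra M (F s)" "s \<le> t \<Longrightarrow> subalgebra (F t) (F s)"
proof -
  show "subalgebra M (F s)" using assms by (simp add: filtration_on_def)
  assume "s \<le> t"
  then have "subalgebra M (F s)" "subalgebra M (F t)" "sets (F s) \<subseteq> sets (F t)"
    using assms by (auto simp: filtration_on_def)
  then show "subalgebra (F t) (F s)" by (simp add: subalgebra_def)
qed

lemma measurable_filtration_mono:
  assumes "filtration_on M F" "0 \<le> s" "s \<le> t" "f \<in> borel_measurable (F s)"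
  shows "f \<in> borel_measurable (F t)"
  using filtration_onD(2)[OF assms(1-3)] assms(4) by (rule measurable_from_subalg)

lemma measurable_filtration_imp:
  assumes "filtration_on M F" "0 \<le> s" "f \<in> borel_measurable (F s)"
  shows "f \<in> borel_measurable M"
  using filtration_onD(1)[OF assms(1,2)] assms(3) by (rule measurable_from_subalg)

lemma brownian_incr_measurable:
  assumes "brownian_motion_in M F B" "0 \<le> a" "0 \<le> b"
  shows "(\<lambda>\<omega>. B b \<omega> - B a \<omega>) \<in> borel_measurable M"
  using assms by (intro borel_measurable_diff) (auto simp: brownian_motion_in_def brownian_motion_def)

lemma Int_stable_vimage: "Int_stable {X -` A \<inter> \<Omega> | A. A \<in> sets N}"
proof (rule Int_stableI)
  fix a b assume "a \<in> {X -` A \<inter> \<Omega> | A. A \<in> sets N}" "b \<in> {X -` A \<inter> \<Omega> | A. A \<in> sets N}"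
  then obtain A B where "A \<in> sets N" "B \<in> sets N" "a = X -` A \<inter> \<Omega>" "b = X -` B \<inter> \<Omega>" by blast
  then have "a \<inter> b = X -` (A \<inter> B) \<inter> \<Omega>" "A \<inter> B \<in> sets N" by auto
  then show "a \<inter> b \<in> {X -` A \<inter> \<Omega> | A. A \<in> sets N}" by blast
qed

context prob_space
begin

lemma brownian_incr_indep:
  assumes "brownian_motion_in M F B" "0 \<le> a" "a \<le> b"
  shows "indep_set (sets (F a)) {(\<lambda>\<omega>. B b \<omega> - B a \<omega>) -` A \<inter> space M | A. A \<in> sets borel}"
proof -
  have "\<forall>t\<ge>0. \<forall>s\<ge>0. indep_set (sets (F t)) {(\<lambda>\<omega>. B (t + s) \<omega> - B t \<omega>) -` A \<inter> space M | A. A \<in> sets borel}"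
    using assms(1) by (simp add: brownian_motion_in_def)
  from this[rule_format, of a "b - a"] show ?thesis using assms by simp
qed

lemma brownian_incr_distributed:
  assumes "brownian_motion_in M F B" "0 \<le> a" "a < b"
  shows "distributed M lborel (\<lambda>\<omega>. B b \<omega> - B a \<omega>) (normal_density 0 (sqrt (b - a)))"
proof -
  have "\<forall>t\<ge>0. \<forall>s>0. distributed M lborel (\<lambda>\<omega>. B (t + s) \<omega> - B t \<omega>) (normal_density 0 (sqrt s))"
    using assms(1) by (simp add: brownian_motion_in_def brownian_motion_def)
  from this[rule_format, of a "b - a"] show ?thesis using assms by simp
qed

lemma brownian_incr_moments:
  assumes B: "brownian_motion_in M F B" "0 \<le> a" "a \<le> b"
  shows "integrable M (\<lambda>\<omega>. B b \<omega> - B a \<omega>)" "expectation (\<lambda>\<omega>. B b \<omega> - B a \<omega>) = 0"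
    "integrable M (\<lambda>\<omega>. (B b \<omega> - B a \<omega>)\<^sup>2)" "expectation (\<lambda>\<omega>. (B b \<omega> - B a \<omega>)\<^sup>2) = b - a"
proof -
  note [measurable] = brownian_incr_measurable[OF B(1), of a b]
  have "integrable M (\<lambda>\<omega>. B b \<omega> - B a \<omega>) \<and> expectation (\<lambda>\<omega>. B b \<omega> - B a \<omega>) = 0 \<and>
    integrable M (\<lambda>\<omega>. (B b \<omega> - B a \<omega>)\<^sup>2) \<and> expectation (\<lambda>\<omega>. (B b \<omega> - B a \<omega>)\<^sup>2) = b - a"
  proof (cases "a = b")
    case False
    define s where "s = sqrt (b - a)"
    have s: "s > 0" "s\<^sup>2 = b - a" using False B by (auto simp: s_def)
    have D: "distributed M lborel (\<lambda>\<omega>. B b \<omega> - B a \<omega>) (normal_density 0 s)"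
      using brownian_incr_distributed[OF B(1,2), of b] False B by (simp add: s_def)
    have i1: "integrable M (\<lambda>\<omega>. B b \<omega> - B a \<omega>)"
      by (subst distributed_integrable[OF D, of "\<lambda>x. x", symmetric])
        (use integrable_normal_moment[of s 0 1] s in auto)
    have i2: "integrable M (\<lambda>\<omega>. (B b \<omega> - B a \<omega>)\<^sup>2)"
      by (subst distributed_integrable[OF D, of "\<lambda>x. x\<^sup>2", symmetric])
        (use integrable_normal_moment[of s 0 2] s in auto)
    have e: "expectation (\<lambda>\<omega>. B b \<omega> - B a \<omega>) = 0"
      by (rule normal_distributed_expectation[OF s(1) D])
    show ?thesis using i1 i2 e normal_distributed_variance[OF s(1) D] s(2) by simp
  qed auto
  then show "integrable M (\<lambda>\<omega>. B b \<omega> - B a \<omega>)" "expectation (\<lambda>\<omega>. B b \<omega> - B a \<omega>) = 0"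
    "integrable M (\<lambda>\<omega>. (B b \<omega> - B a \<omega>)\<^sup>2)" "expectation (\<lambda>\<omega>. (B b \<omega> - B a \<omega>)\<^sup>2) = b - a"
    by auto
qed

lemma brownian_incr_expectation_cos:
  assumes B: "brownian_motion_in M F B" "0 \<le> a" "a \<le> b"
  shows "expectation (\<lambda>\<omega>. cos (x * (B b \<omega> - B a \<omega>))) = exp (- x\<^sup>2 * (b - a) / 2)"
proof (cases "a = b")
  case False
  define s where "s = sqrt (b - a)"
  have s: "s > 0" "s\<^sup>2 = b - a" using False B by (auto simp: s_def)
  have D: "distributed M lborel (\<lambda>\<omega>. B b \<omega> - B a \<omega>) (normal_density 0 s)"
    using brownian_incr_distributed[OF B(1,2), of b] False B by (simp add: s_def)
  then have D': "distributed M lborel (\<lambda>\<omega>. (B b \<omega> - B a \<omega>) / s) std_normal_density"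
    using normal_standard_normal_convert[OF s(1), of "\<lambda>\<omega>. B b \<omega> - B a \<omega>" 0] by simp
  interpret N: real_distribution std_normal_distribution by (rule real_dist_normal_dist)
  have "expectation (\<lambda>\<omega>. cos (x * (B b \<omega> - B a \<omega>))) = expectation (\<lambda>\<omega>. cos ((x * s) * ((B b \<omega> - B a \<omega>) / s)))"
    using s by simp
  also have "\<dots> = (\<integral>y. std_normal_density y * cos ((x * s) * y) \<partial>lborel)"
    by (rule distributed_integral[OF D', symmetric]) auto
  also have "\<dots> = (\<integral>y. cos ((x * s) * y) \<partial>std_normal_distribution)"
    by (subst integral_density) auto
  also have "\<dots> = Re (char std_normal_distribution (x * s))"
  proof -
    have "integrable std_normal_distribution (\<lambda>y. iexp ((x * s) * y))"
      by (rule N.integrable_iexp) auto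
    then show ?thesis unfolding char_def
      by (subst integral_Re[symmetric]) (simp_all add: Re_exp cis_conv_exp)
  qed
  also have "\<dots> = exp (- x\<^sup>2 * (b - a) / 2)"
    by (simp add: char_std_normal_distribution power_mult_distrib s(2))
  finally show ?thesis .
qed (auto simp: prob_space)

text \<open>
  Since \<open>Y\<close> is known at time \<open>t 0\<close>, each cosine has conditional expectation
  \<open>exp (- Y\<^sup>2 (t (Suc k) - t k) / 2)\<close> given the past. The centred terms are therefore
  martingale differences, hence orthogonal, and they are bounded by \<open>2\<close>. The bound does not
  depend on the time points.
\<close>

lemma brownian_cos_average_L1_le:
  assumes F: "filtration_on M F" and B: "brownian_motion_in M F B"
    and t: "0 \<le> t 0" "\<And>k. t k \<le> t (Suc k)" and Y: "Y \<in> borel_measurable (F (t 0))" and K: "K > 0"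
  shows "expectation (\<lambda>\<omega>. \<bar>(\<Sum>k<K. cos (Y \<omega> * (B (t (Suc k)) \<omega> - B (t k) \<omega>))
            - exp (- (Y \<omega>)\<^sup>2 * (t (Suc k) - t k) / 2)) / K\<bar>) \<le> 2 / sqrt K"
proof -
  define Z where "Z k \<omega> = cos (Y \<omega> * (B (t (Suc k)) \<omega> - B (t k) \<omega>)) - exp (- (Y \<omega>)\<^sup>2 * (t (Suc k) - t k) / 2)" for k \<omega>
  have mono: "i \<le> j \<Longrightarrow> t i \<le> t j" for i j by (rule lift_Suc_mono_le[of t]) (rule t(2))
  have t0: "0 \<le> t k" for k using t(1) mono[of 0 k] by simp
  have YF: "Y \<in> borel_measurable (F (t k))" for k
    using measurable_filtration_mono[OF F t(1) mono[of 0 k] Y] by simp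
  have BF: "B (t j) \<in> borel_measurable (F (t k))" if "j \<le> k" for j k
  proof -
    have "B (t j) \<in> borel_measurable (F (t j))"
      using B t0[of j] by (simp add: brownian_motion_in_def adapted_def)
    then show ?thesis by (rule measurable_filtration_mono[OF F t0[of j] mono[OF that]])
  qed
  have ZF: "Z j \<in> borel_measurable (F (t k))" if "j < k" for j k
  proof -
    have [measurable]: "Y \<in> borel_measurable (F (t k))" "B (t (Suc j)) \<in> borel_measurable (F (t k))"
      "B (t j) \<in> borel_measurable (F (t k))"
      using YF[of k] BF[of "Suc j" k] BF[of j k] that by auto
    show ?thesis unfolding Z_def[abs_def] by measurable
  qed
  have ZM[measurable]: "Z k \<in> borel_measurable M" for k
    using ZF[of k "Suc k"] by (intro measurable_filtration_imp[OF F t0[of "Suc k"]]) simp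
  have bd: "\<bar>cos (y * d) - exp (- y\<^sup>2 * (t (Suc k) - t k) / 2)\<bar> \<le> 2" for y d k
  proof -
    have "exp (- y\<^sup>2 * (t (Suc k) - t k) / 2) \<le> 1" using t(2)[of k] by simp
    then show ?thesis using abs_cos_le_one[of "y * d"] exp_gt_zero[of "- y\<^sup>2 * (t (Suc k) - t k) / 2"]
      unfolding abs_le_iff by linarith
  qed
  have "expectation (\<lambda>\<omega>. \<bar>(\<Sum>k<K. Z k \<omega>) / K\<bar>) \<le> 2 / sqrt K"
  proof (rule L1_average_orthogonal_le[OF K])
    show "\<bar>Z k \<omega>\<bar> \<le> 2" for k \<omega> unfolding Z_def by (rule bd)
    fix j k assume "j < k" "k < K"
    define f where "f z = Z j (fst z) * (cos (Y (fst z) * snd z) - exp (- (Y (fst z))\<^sup>2 * (t (Suc k) - t k) / 2))"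
      for z :: "'a \<times> real"
    note sub = filtration_onD(1)[OF F t0[of k]]
    have [measurable]: "Z j \<in> borel_measurable (F (t k))" "Y \<in> borel_measurable (F (t k))"
      using ZF[OF \<open>j < k\<close>] YF by auto
    have "expectation (\<lambda>\<omega>. Z j \<omega> * Z k \<omega>) = (\<integral>\<omega>. f (\<omega>, B (t (Suc k)) \<omega> - B (t k) \<omega>) \<partial>M)"
      by (simp add: f_def Z_def)
    also have "\<dots> = (\<integral>\<omega>1. (\<integral>\<omega>2. f (\<omega>1, B (t (Suc k)) \<omega>2 - B (t k) \<omega>2) \<partial>M) \<partial>M)"
    proof (rule integral_decouple[where S="F (t k)" and T=borel and C=4])
      show "f \<in> borel_measurable (F (t k) \<Otimes>\<^sub>M borel)" unfolding f_def[abs_def] by measurable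
      show "(\<lambda>\<omega>. B (t (Suc k)) \<omega> - B (t k) \<omega>) \<in> borel_measurable M"
        by (rule brownian_incr_measurable[OF B t0 t0])
      show "\<bar>f (\<omega>, d)\<bar> \<le> 4" for \<omega> d
        unfolding f_def abs_mult
        using mult_mono[OF bd[of "Y \<omega>" "B (t (Suc j)) \<omega> - B (t j) \<omega>" j, folded Z_def] bd[of "Y \<omega>" d k]]
        by simp
      show "indep_set {(\<lambda>\<omega>. \<omega>) -` A \<inter> space M | A. A \<in> sets (F (t k))}
          {(\<lambda>\<omega>. B (t (Suc k)) \<omega> - B (t k) \<omega>) -` A \<inter> space M | A. A \<in> sets borel}"
        unfolding subalgebra_vimage_id[OF sub] by (rule brownian_incr_indep[OF B t0 t(2)])
    qed (rule subalgebra_measurable_id[OF sub])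
    also have "\<dots> = (\<integral>\<omega>1. 0 \<partial>M)"
    proof (intro Bochner_Integration.integral_cong refl)
      fix \<omega>1
      note [measurable] = brownian_incr_measurable[OF B t0[of k] t0[of "Suc k"]]
      have "integrable M (\<lambda>\<omega>2. cos (Y \<omega>1 * (B (t (Suc k)) \<omega>2 - B (t k) \<omega>2)))"
        by (rule integrable_const_bound[of _ 1]) auto
      then show "(\<integral>\<omega>2. f (\<omega>1, B (t (Suc k)) \<omega>2 - B (t k) \<omega>2) \<partial>M) = 0"
        using brownian_incr_expectation_cos[OF B t0[of k] t(2)[of k], of "Y \<omega>1"]
        by (simp add: f_def prob_space)
    qed
    finally show "expectation (\<lambda>\<omega>. Z j \<omega> * Z k \<omega>) = 0" by simp
  qed simp
  then show ?thesis by (simp add: Z_def)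
qed

text \<open>
  The Ito isometry for simple integrands. The cross terms vanish because an increment is centred
  and independent of everything known at its left end point.
\<close>

lemma simple_integral_second_moment:
  assumes F: "filtration_on M F" and B: "brownian_motion_in M F B"
    and p: "0 \<le> p 0" "\<And>i. p i \<le> p (Suc i)"
    and c: "\<And>i. i < n \<Longrightarrow> c i \<in> borel_measurable (F (p i))" and bd: "\<And>i \<omega>. \<bar>c i \<omega>\<bar> \<le> C i"
  shows "integrable M (\<lambda>\<omega>. (\<Sum>i<n. c i \<omega> * (B (p (Suc i)) \<omega> - B (p i) \<omega>))\<^sup>2) \<and>
    expectation (\<lambda>\<omega>. (\<Sum>i<n. c i \<omega> * (B (p (Suc i)) \<omega> - B (p i) \<omega>))\<^sup>2) =
    expectation (\<lambda>\<omega>. \<Sum>i<n. (c i \<omega>)\<^sup>2 * (p (Suc i) - p i))"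
  using c
proof (induction n)
  case (Suc n)
  have mono: "i \<le> j \<Longrightarrow> p i \<le> p j" for i j by (rule lift_Suc_mono_le[of p]) (rule p(2))
  have p0: "0 \<le> p k" for k using p(1) mono[of 0 k] by simp
  define S where "S \<omega> = (\<Sum>i<n. c i \<omega> * (B (p (Suc i)) \<omega> - B (p i) \<omega>))" for \<omega>
  define D where "D \<omega> = B (p (Suc n)) \<omega> - B (p n) \<omega>" for \<omega>
  have IH: "integrable M (\<lambda>\<omega>. (S \<omega>)\<^sup>2)"
    "expectation (\<lambda>\<omega>. (S \<omega>)\<^sup>2) = expectation (\<lambda>\<omega>. \<Sum>i<n. (c i \<omega>)\<^sup>2 * (p (Suc i) - p i))"
    using Suc by (auto simp: S_def)
  have D: "integrable M D" "expectation D = 0" "integrable M (\<lambda>\<omega>. (D \<omega>)\<^sup>2)"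
    "expectation (\<lambda>\<omega>. (D \<omega>)\<^sup>2) = p (Suc n) - p n"
    using brownian_incr_moments[OF B p0 p(2), of n] by (simp_all add: D_def[abs_def])
  have cF: "c i \<in> borel_measurable (F (p n))" if "i \<le> n" for i
    using that Suc.prems[of i] by (intro measurable_filtration_mono[OF F p0[of i] mono[OF that]]) simp
  have BF: "B (p j) \<in> borel_measurable (F (p n))" if "j \<le> n" for j
  proof -
    have "B (p j) \<in> borel_measurable (F (p j))"
      using B p0[of j] by (simp add: brownian_motion_in_def adapted_def)
    then show ?thesis by (rule measurable_filtration_mono[OF F p0[of j] mono[OF that]])
  qed
  have SF: "S \<in> borel_measurable (F (p n))"
    unfolding S_def[abs_def] using cF BF
    by (intro borel_measurable_sum borel_measurable_times borel_measurable_diff) auto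
  note sub = filtration_onD(1)[OF F p0[of n]]
  have cM: "c i \<in> borel_measurable M" if "i \<le> n" for i
    by (rule measurable_filtration_imp[OF F p0[of n] cF[OF that]])
  have SM: "S \<in> borel_measurable M" by (rule measurable_filtration_imp[OF F p0[of n] SF])
  note [measurable] = SM cM[of n, simplified]
  have [measurable]: "D \<in> borel_measurable M" using D by auto
  have ind: "indep_var borel Y borel D" if Y: "Y \<in> borel_measurable (F (p n))" for Y
  proof -
    have "indep_set {Y -` A \<inter> space M | A. A \<in> sets borel} {D -` A \<inter> space M | A. A \<in> sets borel}"
    proof (rule indep_setI)
      show "{Y -` A \<inter> space M | A. A \<in> sets borel} \<subseteq> events"
        using measurable_filtration_imp[OF F p0[of n] Y] by auto
      fix a b assume a: "a \<in> {Y -` A \<inter> space M | A. A \<in> sets borel}"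
        and b: "b \<in> {D -` A \<inter> space M | A. A \<in> sets borel}"
      have "a \<in> sets (F (p n))"
        using a measurable_sets[OF Y] sub by (auto simp: subalgebra_def)
      then show "prob (a \<inter> b) = prob a * prob b"
        using indep_setD[OF brownian_incr_indep[OF B p0 p(2)], of a n b] b by (simp add: D_def[abs_def])
    qed auto
    from indep_set_sigma_sets[OF this] show ?thesis
      using measurable_filtration_imp[OF F p0[of n] Y]
      by (simp add: indep_var_eq Int_stable_vimage)
  qed
  have iS: "integrable M S" by (rule square_integrable_imp_integrable[OF SM IH(1)])
  have iSc: "integrable M (\<lambda>\<omega>. 2 * S \<omega> * c n \<omega>)"
    by (rule Bochner_Integration.integrable_bound[OF integrable_mult_left[OF iS, of "2 * C n"]])
      (auto simp: abs_mult intro!: mult_mono order_trans[OF bd abs_ge_self] AE_I2 )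
  have E1: "integrable M (\<lambda>\<omega>. 2 * S \<omega> * c n \<omega> * D \<omega>)" "expectation (\<lambda>\<omega>. 2 * S \<omega> * c n \<omega> * D \<omega>) = 0"
  proof -
    have "indep_var borel (\<lambda>\<omega>. 2 * S \<omega> * c n \<omega>) borel D"
      using SF cF by (intro ind) auto
    from indep_var_integrable[OF this iSc D(1)] indep_var_lebesgue_integral[OF this iSc D(1)]
    show "integrable M (\<lambda>\<omega>. 2 * S \<omega> * c n \<omega> * D \<omega>)" "expectation (\<lambda>\<omega>. 2 * S \<omega> * c n \<omega> * D \<omega>) = 0"
      using D(2) by auto
  qed
  have ic: "integrable M (\<lambda>\<omega>. (c i \<omega>)\<^sup>2)" if "i \<le> n" for i
    using cM[OF that] power_mono[OF bd abs_ge_zero, of i _ 2]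
    by (intro integrable_const_bound[of _ "(C i)\<^sup>2"]) auto
  have E2: "integrable M (\<lambda>\<omega>. (c n \<omega>)\<^sup>2 * (D \<omega>)\<^sup>2)"
    "expectation (\<lambda>\<omega>. (c n \<omega>)\<^sup>2 * (D \<omega>)\<^sup>2) = expectation (\<lambda>\<omega>. (c n \<omega>)\<^sup>2 * (p (Suc n) - p n))"
  proof -
    have "indep_var borel ((\<lambda>x. x\<^sup>2) \<circ> c n) borel ((\<lambda>x. x\<^sup>2) \<circ> D)"
      by (rule indep_var_compose[OF ind]) (use cF in auto)
    then have *: "indep_var borel (\<lambda>\<omega>. (c n \<omega>)\<^sup>2) borel (\<lambda>\<omega>. (D \<omega>)\<^sup>2)" by (simp add: comp_def)
    from indep_var_integrable[OF * ic D(3)] indep_var_lebesgue_integral[OF * ic D(3)] D(4)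
    show "integrable M (\<lambda>\<omega>. (c n \<omega>)\<^sup>2 * (D \<omega>)\<^sup>2)"
      "expectation (\<lambda>\<omega>. (c n \<omega>)\<^sup>2 * (D \<omega>)\<^sup>2) = expectation (\<lambda>\<omega>. (c n \<omega>)\<^sup>2 * (p (Suc n) - p n))"
      by auto
  qed
  have eq: "(\<Sum>i<Suc n. c i \<omega> * (B (p (Suc i)) \<omega> - B (p i) \<omega>))\<^sup>2 =
      (S \<omega>)\<^sup>2 + 2 * S \<omega> * c n \<omega> * D \<omega> + (c n \<omega>)\<^sup>2 * (D \<omega>)\<^sup>2" for \<omega>
  proof -
    have "(\<Sum>i<Suc n. c i \<omega> * (B (p (Suc i)) \<omega> - B (p i) \<omega>)) = S \<omega> + c n \<omega> * D \<omega>"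
      by (simp add: S_def D_def)
    then show ?thesis by (simp add: power2_eq_square algebra_simps)
  qed
  have i3: "integrable M (\<lambda>\<omega>. \<Sum>i<n. (c i \<omega>)\<^sup>2 * (p (Suc i) - p i))"
    using ic by auto
  show ?case unfolding eq using IH E1 E2 i3 ic[of n] by simp
qed simp

text \<open>
  Lenglart's inequality: the integrand is stopped as soon as its accumulated energy
  exceeds \<open>\<delta>\<close>. The stopped integral has second moment at most \<open>\<delta>\<close>, and it differs from the
  original one only if the total energy is above \<open>\<delta>\<close>. The coefficients may be unbounded, such as
  a value of \<open>X\<close>; stopping bounds them, as the isometry requires.
\<close>

lemma simple_integral_tail_le:
  assumes F: "filtration_on M F" and B: "brownian_motion_in M F B"
    and p: "0 \<le> p 0" "\<And>i. p i \<le> p (Suc i)"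
    and c: "\<And>i. i < n \<Longrightarrow> c i \<in> borel_measurable (F (p i))"
    and \<epsilon>: "\<epsilon> > 0" and \<delta>: "\<delta> \<ge> 0"
  shows "prob {\<omega>\<in>space M. \<bar>\<Sum>i<n. c i \<omega> * (B (p (Suc i)) \<omega> - B (p i) \<omega>)\<bar> > \<epsilon>} \<le>
    prob {\<omega>\<in>space M. (\<Sum>i<n. (c i \<omega>)\<^sup>2 * (p (Suc i) - p i)) > \<delta>} + \<delta> / \<epsilon>\<^sup>2"
proof -
  have mono: "i \<le> j \<Longrightarrow> p i \<le> p j" for i j by (rule lift_Suc_mono_le[of p]) (rule p(2))
  have p0: "0 \<le> p k" for k using p(1) mono[of 0 k] by simp
  define q where "q i \<omega> = (\<Sum>j<i. (c j \<omega>)\<^sup>2 * (p (Suc j) - p j))" for i \<omega>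
  \<comment> \<open>on an interval of length \<open>0\<close> the energy does not control the coefficient, which is set to \<open>0\<close>\<close>
  define c' where "c' i \<omega> = (if p i < p (Suc i) \<and> q (Suc i) \<omega> \<le> \<delta> then c i \<omega> else 0)" for i \<omega>
  define S S' where "S \<omega> = (\<Sum>i<n. c i \<omega> * (B (p (Suc i)) \<omega> - B (p i) \<omega>))"
    and "S' \<omega> = (\<Sum>i<n. c' i \<omega> * (B (p (Suc i)) \<omega> - B (p i) \<omega>))" for \<omega>
  have qmono: "q i \<omega> \<le> q j \<omega>" if "i \<le> j" for i j \<omega>
    unfolding q_def using that p(2) by (intro sum_mono2) auto
  have cF: "c i \<in> borel_measurable (F (p j))" if "i \<le> j" "j < n" for i j
    using that c[of i] by (intro measurable_filtration_mono[OF F p0[of i] mono[OF that(1)]]) simp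
  have qF: "q (Suc i) \<in> borel_measurable (F (p i))" if "i < n" for i
    unfolding q_def[abs_def] using cF[OF _ that] by (intro borel_measurable_sum borel_measurable_times) auto
  have c'F: "c' i \<in> borel_measurable (F (p i))" if "i < n" for i
  proof -
    note [measurable] = qF[OF that] c[OF that]
    show ?thesis unfolding c'_def[abs_def] by measurable
  qed
  have q'le: "(\<Sum>i<k. (c' i \<omega>)\<^sup>2 * (p (Suc i) - p i)) \<le> min \<delta> (q k \<omega>)" for k \<omega>
  proof (induction k)
    case (Suc k)
    show ?case
    proof (cases "q (Suc k) \<omega> \<le> \<delta>")
      case True
      have "(c' k \<omega>)\<^sup>2 * (p (Suc k) - p k) \<le> (c k \<omega>)\<^sup>2 * (p (Suc k) - p k)"
        using p(2)[of k] by (intro mult_right_mono) (auto simp: c'_def)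
      then show ?thesis using Suc True by (simp add: q_def)
    next
      case False
      then have "c' k \<omega> = 0" by (simp add: c'_def)
      then show ?thesis using Suc qmono[of k "Suc k" \<omega>] by simp
    qed
  qed (use \<delta> in \<open>simp add: q_def\<close>)
  have bd: "\<bar>c' i \<omega>\<bar> \<le> sqrt (\<delta> / (p (Suc i) - p i))" for i \<omega>
  proof (cases "p i < p (Suc i) \<and> q (Suc i) \<omega> \<le> \<delta>")
    case True
    have "(c i \<omega>)\<^sup>2 * (p (Suc i) - p i) \<le> q (Suc i) \<omega>"
      unfolding q_def using p(2) by (intro member_le_sum) auto
    then have "(c' i \<omega>)\<^sup>2 \<le> \<delta> / (p (Suc i) - p i)"
      using True by (auto simp: c'_def pos_le_divide_eq)
    then show ?thesis by (rule real_le_rsqrt[of "\<bar>_\<bar>", simplified])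
  next
    case False
    then show ?thesis using \<delta> p(2)[of i] by (auto simp: c'_def)
  qed
  note M = simple_integral_second_moment[OF F B p c'F bd, of n, folded S'_def, simplified]
  have int: "integrable M (\<lambda>\<omega>. (S' \<omega>)\<^sup>2)" using M by simp
  have BM: "(\<lambda>\<omega>. B (p (Suc i)) \<omega> - B (p i) \<omega>) \<in> borel_measurable M" for i
    by (rule brownian_incr_measurable[OF B p0 p0])
  have cM: "c i \<in> borel_measurable M" "c' i \<in> borel_measurable M" if "i < n" for i
    using measurable_filtration_imp[OF F p0[of i]] c[OF that] c'F[OF that] by auto
  have [measurable]: "S \<in> borel_measurable M" "S' \<in> borel_measurable M" "q n \<in> borel_measurable M"
    unfolding S_def[abs_def] S'_def[abs_def] q_def[abs_def] using cM BM
    by (intro borel_measurable_sum borel_measurable_times; auto)+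
  have "expectation (\<lambda>\<omega>. (S' \<omega>)\<^sup>2) = expectation (\<lambda>\<omega>. \<Sum>i<n. (c' i \<omega>)\<^sup>2 * (p (Suc i) - p i))"
    using M by simp
  also have "\<dots> \<le> expectation (\<lambda>\<omega>. \<delta>)"
  proof (rule integral_mono')
    show "(\<Sum>i<n. (c' i \<omega>)\<^sup>2 * (p (Suc i) - p i)) \<le> \<delta>" for \<omega> using q'le[of \<omega> n] by simp
  qed (use \<delta> in auto)
  finally have E: "expectation (\<lambda>\<omega>. (S' \<omega>)\<^sup>2) \<le> \<delta>" by (simp add: prob_space)
  have "prob {\<omega>\<in>space M. (S' \<omega>)\<^sup>2 \<ge> \<epsilon>\<^sup>2} \<le> expectation (\<lambda>\<omega>. (S' \<omega>)\<^sup>2) / \<epsilon>\<^sup>2"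
    using \<epsilon> by (intro integral_Markov_inequality_measure[OF int, of "{}"]) auto
  also have "\<dots> \<le> \<delta> / \<epsilon>\<^sup>2" using E by (simp add: divide_right_mono)
  finally have 1: "prob {\<omega>\<in>space M. (S' \<omega>)\<^sup>2 \<ge> \<epsilon>\<^sup>2} \<le> \<delta> / \<epsilon>\<^sup>2" .
  have "prob {\<omega>\<in>space M. \<bar>S \<omega>\<bar> > \<epsilon>} \<le> prob ({\<omega>\<in>space M. q n \<omega> > \<delta>} \<union> {\<omega>\<in>space M. (S' \<omega>)\<^sup>2 \<ge> \<epsilon>\<^sup>2})"
  proof (rule finite_measure_mono)
    show "{\<omega>\<in>space M. \<bar>S \<omega>\<bar> > \<epsilon>} \<subseteq> {\<omega>\<in>space M. q n \<omega> > \<delta>} \<union> {\<omega>\<in>space M. (S' \<omega>)\<^sup>2 \<ge> \<epsilon>\<^sup>2}"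
    proof -
      have "\<epsilon>\<^sup>2 \<le> (S' \<omega>)\<^sup>2" if \<omega>: "\<bar>S \<omega>\<bar> > \<epsilon>" "\<not> \<delta> < q n \<omega>" for \<omega>
      proof -
      have "c' i \<omega> * (B (p (Suc i)) \<omega> - B (p i) \<omega>) = c i \<omega> * (B (p (Suc i)) \<omega> - B (p i) \<omega>)" if "i < n" for i
        using qmono[of "Suc i" n \<omega>] that \<omega>(2) p(2)[of i] by (auto simp: c'_def)
      then have "S' \<omega> = S \<omega>" unfolding S_def S'_def by (intro sum.cong) auto
      then show ?thesis using power_mono[of \<epsilon> "\<bar>S \<omega>\<bar>" 2] \<omega>(1) \<epsilon> by simp
      qed
      then show ?thesis by auto
    qed
  qed measurable
  also have "\<dots> \<le> prob {\<omega>\<in>space M. q n \<omega> > \<delta>} + prob {\<omega>\<in>space M. (S' \<omega>)\<^sup>2 \<ge> \<epsilon>\<^sup>2}"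
    by (rule measure_Un_le) measurable
  finally show ?thesis using 1 unfolding S_def q_def by simp
qed

end

section \<open>The stochastic integral over a short interval\<close>

lemma set_integrable_const_Ioc: "set_integrable lborel {a<..b::real} (\<lambda>s. c :: real)"
  by (rule set_integrable_subset[OF borel_integrable_atLeastAtMost'[of a b]]) auto

lemma sum_le_set_integral_partition:
  fixes p :: "nat \<Rightarrow> real" and f :: "real \<Rightarrow> real"
  assumes p: "\<And>i. p i \<le> p (Suc i)"
    and f: "set_integrable lborel {p 0<..p n} f"
    and d: "\<And>i s. i < n \<Longrightarrow> p i < s \<Longrightarrow> s \<le> p (Suc i) \<Longrightarrow> d i \<le> f s"
  shows "(\<Sum>i<n. d i * (p (Suc i) - p i)) \<le> (LINT s:{p 0<..p n}|lborel. f s)"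
  using f d
proof (induction n)
  case (Suc n)
  have "p 0 \<le> p n" by (rule lift_Suc_mono_le[of p]) (auto intro: p)
  then have eq: "{p 0<..p (Suc n)} = {p 0<..p n} \<union> {p n<..p (Suc n)}" using p[of n] by auto
  have i1: "set_integrable lborel {p 0<..p n} f" and i2: "set_integrable lborel {p n<..p (Suc n)} f"
    by (rule set_integrable_subset[OF Suc.prems(1)]; use eq in auto)+
  have "(LINT s:{p n<..p (Suc n)}|lborel. d n) \<le> (LINT s:{p n<..p (Suc n)}|lborel. f s)"
  proof (rule set_integral_mono[OF _ i2])
    show "set_integrable lborel {p n<..p (Suc n)} (\<lambda>s. d n)" by (rule set_integrable_const_Ioc)
  qed (use Suc.prems(2)[of n] in auto)
  then have "d n * (p (Suc n) - p n) \<le> (LINT s:{p n<..p (Suc n)}|lborel. f s)"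
    using p[of n] by (simp add: set_lebesgue_integral_def mult.commute)
  moreover have "(\<Sum>i<n. d i * (p (Suc i) - p i)) \<le> (LINT s:{p 0<..p n}|lborel. f s)"
    using Suc.prems(2) by (intro Suc.IH i1) auto
  moreover have "(LINT s:{p 0<..p (Suc n)}|lborel. f s) =
      (LINT s:{p 0<..p n}|lborel. f s) + (LINT s:{p n<..p (Suc n)}|lborel. f s)"
    unfolding eq by (rule set_integral_Un[OF _ i1 i2]) auto
  ultimately show ?case by simp
qed (simp add: set_lebesgue_integral_def)

text \<open>
  Restricting a simple integrand to \<open>(a, b]\<close> and subtracting a variable \<open>x\<close> gives another simple
  integrand. Its partition is \<open>a\<close>, the original points projected onto \<open>[a, b]\<close>, and \<open>b\<close>; the
  two additional intervals carry the coefficient \<open>- x\<close>, because the original integrand vanishes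
  there.
\<close>

definition clamp_points :: "nat \<Rightarrow> (nat \<Rightarrow> real) \<Rightarrow> real \<Rightarrow> real \<Rightarrow> nat \<Rightarrow> real" where
  "clamp_points k t a b i = (case i of 0 \<Rightarrow> a | Suc j \<Rightarrow> if j \<le> k then max a (min (t j) b) else b)"

text \<open>
  An interval beginning at a point \<open>t j \<ge> b\<close> becomes degenerate. Its coefficient is replaced by \<open>0\<close>
  because \<open>\<xi> j\<close> may fail to be known at time \<open>b\<close>.
\<close>

definition clamp_coeffs :: "nat \<Rightarrow> (nat \<Rightarrow> real) \<Rightarrow> real \<Rightarrow> (nat \<Rightarrow> 'a \<Rightarrow> real) \<Rightarrow> ('a \<Rightarrow> real) \<Rightarrow> nat \<Rightarrow> 'a \<Rightarrow> real" where
  "clamp_coeffs k t b \<xi> x i \<omega> =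
     (case i of 0 \<Rightarrow> - x \<omega> | Suc j \<Rightarrow> if j < k then if t j < b then \<xi> j \<omega> - x \<omega> else 0 else - x \<omega>)"

lemma partition_mono:
  fixes t :: "nat \<Rightarrow> real"
  assumes "\<forall>i<k. t i \<le> t (Suc i)" "i \<le> j" "j \<le> k" shows "t i \<le> t j"
  using assms(2,3)
proof (induction rule: dec_induct)
  case (step n)
  then have "t n \<le> t (Suc n)" using assms(1) by auto
  with step show ?case by auto
qed simp

lemma clamp_points_mono:
  assumes "\<forall>i<k. t i \<le> t (Suc i)" "a \<le> b"
  shows "clamp_points k t a b i \<le> clamp_points k t a b (Suc i)"
proof (cases i)
  case (Suc j)
  have "j < k \<Longrightarrow> t j \<le> t (Suc j)" using assms(1) by simp
  then show ?thesis using assms(2) Suc by (auto simp: clamp_points_def max_def min_def)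
qed (use assms in \<open>simp add: clamp_points_def\<close>)

lemma simple_value_between:
  assumes "\<forall>i<k. t i \<le> t (Suc i)" "j < k" "t j < s" "s \<le> t (Suc j)"
  shows "simple_value k t \<xi> s \<omega> = \<xi> j \<omega>"
proof -
  have "\<xi> i \<omega> * indicator {t i<..t (Suc i)} s = (if i = j then \<xi> j \<omega> else 0)" if "i < k" for i
  proof -
    consider "i = j" | "i < j" | "j < i" by linarith
    then show ?thesis
    proof cases
      case 2
      then show ?thesis using partition_mono[OF assms(1), of "Suc i" j] assms by (auto simp: indicator_def)
    next
      case 3
      then show ?thesis using partition_mono[OF assms(1), of "Suc j" i] assms that by (auto simp: indicator_def)
    qed (use assms in auto)
  qed
  then have "simple_value k t \<xi> s \<omega> = (\<Sum>i<k. if i = j then \<xi> j \<omega> else 0)"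
    unfolding simple_value_def by (intro sum.cong) auto
  then show ?thesis using assms(2) by simp
qed

lemma simple_value_outside:
  assumes "\<forall>i<k. t i \<le> t (Suc i)" "s \<le> t 0 \<or> t k < s"
  shows "simple_value k t \<xi> s \<omega> = 0"
  unfolding simple_value_def
proof (rule sum.neutral, safe)
  fix i assume "i < k"
  then show "\<xi> i \<omega> * indicator {t i<..t (Suc i)} s = 0"
    using partition_mono[OF assms(1), of 0 i] partition_mono[OF assms(1), of "Suc i" k] assms(2)
    by (auto simp: indicator_def)
qed

lemma clamp_coeffs_eq_simple_value:
  assumes t: "\<forall>i<k. t i \<le> t (Suc i)" and i: "i < Suc (Suc k)"
    and s: "clamp_points k t a b i < s" "s \<le> clamp_points k t a b (Suc i)" and ab: "a \<le> b"
  shows "clamp_coeffs k t b \<xi> x i \<omega> = simple_value k t \<xi> s \<omega> - x \<omega>"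
proof (cases i)
  case 0
  then have "s \<le> t 0" using s by (auto simp: clamp_points_def)
  then show ?thesis using simple_value_outside[OF t, of s \<xi> \<omega>] 0 by (simp add: clamp_coeffs_def)
next
  case (Suc j)
  show ?thesis
  proof (cases "j < k")
    case True
    have "t j < s" "s \<le> t (Suc j)" "t j < b"
      using s Suc True ab by (auto simp: clamp_points_def max_def min_def split: if_splits)
    then show ?thesis using simple_value_between[OF t True, of s \<xi> \<omega>] Suc True by (simp add: clamp_coeffs_def)
  next
    case False
    then have "j = k" using i Suc by simp
    then have "t k < s" using s Suc ab by (auto simp: clamp_points_def max_def min_def split: if_splits)
    then show ?thesis using simple_value_outside[OF t, of s \<xi> \<omega>] Suc False by (simp add: clamp_coeffs_def)
  qed
qed

lemma sum_clamp_coeffs: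
  assumes ab: "a \<le> b" and t: "\<forall>i<k. t i \<le> t (Suc i)"
  shows "(\<Sum>i<Suc (Suc k). clamp_coeffs k t b \<xi> x i \<omega> * (B (clamp_points k t a b (Suc i)) \<omega> - B (clamp_points k t a b i) \<omega>))
    = simple_integral_wrt B k t \<xi> b \<omega> - simple_integral_wrt B k t \<xi> a \<omega> - x \<omega> * (B b \<omega> - B a \<omega>)"
proof -
  define g where "g s = B (max a (min s b)) \<omega>" for s
  have g: "B (min s b) \<omega> - B (min s a) \<omega> = g s - B a \<omega>" for s
    using ab by (auto simp: g_def max_def min_def)
  have mid: "clamp_coeffs k t b \<xi> x (Suc i) \<omega> * (B (clamp_points k t a b (Suc (Suc i))) \<omega> - B (clamp_points k t a b (Suc i)) \<omega>)
    = \<xi> i \<omega> * (g (t (Suc i)) - g (t i)) - x \<omega> * (g (t (Suc i)) - g (t i))" if "i < k" for i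
  proof (cases "t i < b")
    case True
    then show ?thesis using that by (simp add: clamp_coeffs_def clamp_points_def g_def algebra_simps)
  next
    case False
    moreover have "t i \<le> t (Suc i)" using t that by simp
    ultimately have "min (t i) b = b" "min (t (Suc i)) b = b" by auto
    then have "g (t (Suc i)) = g (t i)" by (simp add: g_def)
    then show ?thesis using False by (simp add: clamp_coeffs_def that)
  qed
  have "(\<Sum>i<Suc (Suc k). clamp_coeffs k t b \<xi> x i \<omega> * (B (clamp_points k t a b (Suc i)) \<omega> - B (clamp_points k t a b i) \<omega>))
    = - x \<omega> * (g (t 0) - B a \<omega>) + (\<Sum>i<k. \<xi> i \<omega> * (g (t (Suc i)) - g (t i)) - x \<omega> * (g (t (Suc i)) - g (t i)))
      - x \<omega> * (B b \<omega> - g (t k))"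
    unfolding sum.lessThan_Suc_shift[of _ "Suc k"] sum.lessThan_Suc[of _ k]
    using mid by (simp add: clamp_coeffs_def[of _ _ _ _ _ 0] clamp_coeffs_def[of _ _ _ _ _ "Suc k"]
        clamp_points_def[of _ _ _ _ 0] clamp_points_def[of _ _ _ _ "Suc 0"]
        clamp_points_def[of _ _ _ _ "Suc k"] clamp_points_def[of _ _ _ _ "Suc (Suc k)"] g_def)
  also have "(\<Sum>i<k. \<xi> i \<omega> * (g (t (Suc i)) - g (t i)) - x \<omega> * (g (t (Suc i)) - g (t i)))
    = (\<Sum>i<k. \<xi> i \<omega> * (g (t (Suc i)) - g (t i))) - x \<omega> * (g (t k) - g (t 0))"
    by (subst sum_subtractf, subst sum_distrib_left[symmetric],
        subst sum_lessThan_telescope[of "\<lambda>i. g (t i)"]) simp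
  also have "(\<Sum>i<k. \<xi> i \<omega> * (g (t (Suc i)) - g (t i))) =
     simple_integral_wrt B k t \<xi> b \<omega> - simple_integral_wrt B k t \<xi> a \<omega>"
  proof -
    have "\<xi> i \<omega> * (g (t (Suc i)) - g (t i)) =
      \<xi> i \<omega> * (B (min (t (Suc i)) b) \<omega> - B (min (t i) b) \<omega>) - \<xi> i \<omega> * (B (min (t (Suc i)) a) \<omega> - B (min (t i) a) \<omega>)" for i
      unfolding right_diff_distrib[symmetric] using g[of "t i"] g[of "t (Suc i)"] by simp
    then show ?thesis by (simp add: simple_integral_wrt_def sum_subtractf)
  qed
  finally show ?thesis by (simp add: algebra_simps)
qed

lemma simple_value_measurable: "(\<lambda>s. simple_value k t \<xi> s \<omega>) \<in> borel_measurable borel"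
  unfolding simple_value_def by measurable

lemma simple_value_bounded: "\<bar>simple_value k t \<xi> s \<omega>\<bar> \<le> (\<Sum>i<k. \<bar>\<xi> i \<omega>\<bar>)"
  unfolding simple_value_def
  by (intro order_trans[OF sum_abs] sum_mono) (auto simp: indicator_def)

lemma set_integrable_simple_value_diff_square:
  assumes x: "continuous_on {0..b} x"
  shows "set_integrable lborel {0..b} (\<lambda>s. (simple_value k t \<xi> s \<omega> - x s)\<^sup>2)"
proof -
  have "bounded (x ` {0..b})" by (intro compact_imp_bounded compact_continuous_image x) auto
  then obtain C where "\<forall>y\<in>x ` {0..b}. norm y \<le> C" by (auto simp: bounded_iff)
  then have C: "\<And>s. s \<in> {0..b} \<Longrightarrow> \<bar>x s\<bar> \<le> C" by auto
  have *: "(\<lambda>s. indicator {0..b} s * x s) \<in> borel_measurable borel"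
    using borel_measurable_continuous_on_indicator[OF _ x] by simp
  note [measurable] = simple_value_measurable[of k t \<xi> \<omega>]
  have m: "(\<lambda>s. (simple_value k t \<xi> s \<omega> - indicator {0..b} s * x s)\<^sup>2) \<in> borel_measurable borel"
    by (intro borel_measurable_power borel_measurable_diff simple_value_measurable *)
  have eq: "indicator {0..b} s *\<^sub>R (simple_value k t \<xi> s \<omega> - x s)\<^sup>2 =
      indicator {0..b} s *\<^sub>R (simple_value k t \<xi> s \<omega> - indicator {0..b} s * x s)\<^sup>2" for s
    by (simp add: indicator_def)
  have "set_integrable lborel {0..b} (\<lambda>s. (simple_value k t \<xi> s \<omega> - indicator {0..b} s * x s)\<^sup>2)"
    unfolding set_integrable_def
  proof (rule integrableI_bounded_set_indicator[where B="((\<Sum>i<k. \<bar>\<xi> i \<omega>\<bar>) + C)\<^sup>2"])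
    show "AE s in lborel. s \<in> {0..b} \<longrightarrow> norm ((simple_value k t \<xi> s \<omega> - indicator {0..b} s * x s)\<^sup>2) \<le> ((\<Sum>i<k. \<bar>\<xi> i \<omega>\<bar>) + C)\<^sup>2"
    proof (intro AE_I2 impI)
      fix s assume s: "s \<in> {0..b}"
      have "\<bar>simple_value k t \<xi> s \<omega> - x s\<bar> \<le> (\<Sum>i<k. \<bar>\<xi> i \<omega>\<bar>) + C"
        using simple_value_bounded[of k t \<xi> s \<omega>] C[OF s] by linarith
      from power_mono[OF this, of 2] s
      show "norm ((simple_value k t \<xi> s \<omega> - indicator {0..b} s * x s)\<^sup>2) \<le> ((\<Sum>i<k. \<bar>\<xi> i \<omega>\<bar>) + C)\<^sup>2"
        by simp
    qed
  qed (use m in \<open>simp_all add: emeasure_lborel_Icc_eq\<close>)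
  then show ?thesis unfolding set_integrable_def eq .
qed

text \<open>
  The sum is the integral of \<open>(H - x)\<^sup>2\<close> over \<open>(a, b]\<close>, where \<open>H\<close> is the simple process, and
  \<open>(H - x)\<^sup>2 \<le> 2 (H - X)\<^sup>2 + 2 (X - x)\<^sup>2\<close>. The first part is small for a good approximation \<open>H\<close> of \<open>X\<close>,
  the second one if \<open>X\<close> stays close to \<open>x\<close>.
\<close>

lemma clamp_energy_le:
  assumes t: "\<forall>i<k. t i \<le> t (Suc i)" and ab: "0 \<le> a" "a \<le> b" and X: "continuous_on {0..} X"
    and \<eta>: "\<And>s. s \<in> {a..b} \<Longrightarrow> \<bar>X s - x \<omega>\<bar> \<le> \<eta>"
  shows "(\<Sum>i<Suc (Suc k). (clamp_coeffs k t b \<xi> x i \<omega>)\<^sup>2 * (clamp_points k t a b (Suc i) - clamp_points k t a b i))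
    \<le> 2 * (LINT s:{0..b}|lborel. (simple_value k t \<xi> s \<omega> - X s)\<^sup>2) + 2 * \<eta>\<^sup>2 * (b - a)"
proof -
  define f where "f s = (simple_value k t \<xi> s \<omega> - X s)\<^sup>2" for s
  have f: "set_integrable lborel {0..b} f" unfolding f_def
    by (rule set_integrable_simple_value_diff_square) (rule continuous_on_subset[OF X], auto)
  have fab: "set_integrable lborel {a<..b} f"
    by (rule set_integrable_subset[OF f]) (use ab in auto)
  have c: "set_integrable lborel {a<..b} (\<lambda>s. 2 * \<eta>\<^sup>2)" by (rule set_integrable_const_Ioc)
  have f2: "set_integrable lborel {a<..b} (\<lambda>s. 2 * f s)" using fab by simp
  have e: "clamp_points k t a b 0 = a" "clamp_points k t a b (Suc (Suc k)) = b"
    by (simp_all add: clamp_points_def)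
  note mono = clamp_points_mono[OF t ab(2)]
  have ge: "a \<le> clamp_points k t a b i" for i
    using lift_Suc_mono_le[of "clamp_points k t a b" 0 i] mono e by simp
  have le: "clamp_points k t a b i \<le> b" for i
    using ab by (auto simp: clamp_points_def split: nat.splits)
  have "(\<Sum>i<Suc (Suc k). (clamp_coeffs k t b \<xi> x i \<omega>)\<^sup>2 * (clamp_points k t a b (Suc i) - clamp_points k t a b i))
    \<le> (LINT s:{clamp_points k t a b 0<..clamp_points k t a b (Suc (Suc k))}|lborel. 2 * f s + 2 * \<eta>\<^sup>2)"
  proof (rule sum_le_set_integral_partition[where p="clamp_points k t a b", OF mono])
    show "set_integrable lborel {clamp_points k t a b 0<..clamp_points k t a b (Suc (Suc k))} (\<lambda>s. 2 * f s + 2 * \<eta>\<^sup>2)"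
      unfolding e by (rule set_integral_add(1)[OF f2 c])
    fix i s assume i: "i < Suc (Suc k)" and s: "clamp_points k t a b i < s" "s \<le> clamp_points k t a b (Suc i)"
    have "s \<in> {a..b}" using s ge[of i] le[of "Suc i"] by auto
    from \<eta>[OF this] have 1: "(X s - x \<omega>)\<^sup>2 \<le> \<eta>\<^sup>2" using power_mono[of "\<bar>X s - x \<omega>\<bar>" \<eta> 2] by simp
    have "(u + v)\<^sup>2 \<le> 2 * u\<^sup>2 + 2 * v\<^sup>2" for u v :: real
      using sum_squares_bound[of u v] by (simp add: power2_sum)
    from this[of "simple_value k t \<xi> s \<omega> - X s" "X s - x \<omega>"] 1
    show "(clamp_coeffs k t b \<xi> x i \<omega>)\<^sup>2 \<le> 2 * f s + 2 * \<eta>\<^sup>2"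
      unfolding clamp_coeffs_eq_simple_value[OF t i s ab(2)] by (simp add: f_def)
  qed
  also have "\<dots> = 2 * (LINT s:{a<..b}|lborel. f s) + 2 * \<eta>\<^sup>2 * (b - a)"
    unfolding e using ab by (subst set_integral_add(2)[OF f2 c]) (simp add: set_lebesgue_integral_def)
  also have "(LINT s:{a<..b}|lborel. f s) \<le> (LINT s:{0..b}|lborel. f s)"
    unfolding set_lebesgue_integral_def
    by (rule integral_mono[OF fab[unfolded set_integrable_def] f[unfolded set_integrable_def]])
      (use ab in \<open>auto simp: f_def indicator_def\<close>)
  finally show ?thesis by (simp add: f_def)
qed

lemma clamp_coeffs_measurable:
  assumes F: "filtration_on M F" and sp: "simple_process F k t \<xi>" and ab: "0 \<le> r" "r \<le> a" "a \<le> b"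
    and x: "x \<in> borel_measurable (F r)"
  shows "clamp_coeffs k t b \<xi> x i \<in> borel_measurable (F (clamp_points k t a b i))"
proof -
  have t: "\<forall>i<k. t i \<le> t (Suc i)" and t0: "0 \<le> t 0" using sp by (auto simp: simple_process_def)
  have ge: "a \<le> clamp_points k t a b i" for i
    using ab by (auto simp: clamp_points_def split: nat.splits)
  have xF: "x \<in> borel_measurable (F (clamp_points k t a b i))" for i
    using ab(2) ge[of i] by (intro measurable_filtration_mono[OF F ab(1) _ x]) auto
  show ?thesis
  proof (cases i)
    case 0
    then show ?thesis using xF[of i] by (simp add: clamp_coeffs_def[abs_def])
  next
    case (Suc j)
    show ?thesis
    proof (cases "j < k \<and> t j < b")
      case True
      have "0 \<le> t j" using partition_mono[OF t, of 0 j] t0 True by simp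
      moreover have "t j \<le> clamp_points k t a b i" using True Suc by (simp add: clamp_points_def)
      moreover have "\<xi> j \<in> borel_measurable (F (t j))" using sp True by (simp add: simple_process_def)
      ultimately have "\<xi> j \<in> borel_measurable (F (clamp_points k t a b i))"
        by (rule measurable_filtration_mono[OF F])
      then show ?thesis using xF[of i] Suc True by (simp add: clamp_coeffs_def[abs_def])
    next
      case False
      then show ?thesis using xF[of i] Suc by (cases "j < k") (auto simp: clamp_coeffs_def[abs_def])
    qed
  qed
qed

text \<open>
  Over a time interval where the integrand has barely moved since time \<open>r\<close>, the stochastic
  integral is nearly \<open>X r\<close> times the Brownian increment. For the simple integrals that define
  the Ito integral this is the tail inequality above, applied to the simple integrand minus \<open>X r\<close>;
  it survives the limit in probability.
\<close>

lemma (in prob_space) ito_integral_local_error: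
  assumes F: "filtration_on M F" and B: "brownian_motion_in M F B" and X: "adapted F X"
    and cont: "\<And>\<omega>. \<omega> \<in> space M \<Longrightarrow> continuous_on {0..} (\<lambda>t. X t \<omega>)"
    and I: "ito_integral_process M F B X I"
    and ab: "0 \<le> r" "r \<le> a" "a \<le> b" and E: "E \<in> events"
    and \<eta>: "\<And>\<omega> s. \<omega> \<in> space M - E \<Longrightarrow> s \<in> {a..b} \<Longrightarrow> \<bar>X s \<omega> - X r \<omega>\<bar> \<le> \<eta>"
    and \<epsilon>: "\<epsilon> > 0"
  shows "prob {\<omega>\<in>space M. \<bar>I b \<omega> - I a \<omega> - X r \<omega> * (B b \<omega> - B a \<omega>)\<bar> > \<epsilon>} \<le> prob E + 8 * \<eta>\<^sup>2 * (b - a) / \<epsilon>\<^sup>2"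
proof (rule field_le_epsilon)
  fix e :: real assume "e > 0"
  \<comment> \<open>the level allowed for \<open>Q n\<close>, the energy of the approximation error, chosen so that it costs \<open>e\<close> in the limit\<close>
  define \<kappa> where "\<kappa> = e * \<epsilon>\<^sup>2 / 8"
  have \<kappa>: "\<kappa> > 0" using \<open>e > 0\<close> \<epsilon> by (simp add: \<kappa>_def)
  obtain k t \<xi> where sp: "\<And>n. simple_process F (k n) (t n) (\<xi> n)"
    and L: "\<And>T. T \<ge> 0 \<Longrightarrow> converges_in_prob M
       (\<lambda>n \<omega>. LINT s:{0..T}|lborel. (simple_value (k n) (t n) (\<xi> n) s \<omega> - X s \<omega>)\<^sup>2) (\<lambda>_. 0)"
    and J: "\<And>u. u \<ge> 0 \<Longrightarrow> converges_in_prob M (\<lambda>n. simple_integral_wrt B (k n) (t n) (\<xi> n) u) (I u)"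
    using I unfolding ito_integral_process_def by blast
  define Q where "Q n \<omega> = (LINT s:{0..b}|lborel. (simple_value (k n) (t n) (\<xi> n) s \<omega> - X s \<omega>)\<^sup>2)" for n \<omega>
  define R where "R n \<omega> = simple_integral_wrt B (k n) (t n) (\<xi> n) b \<omega> - simple_integral_wrt B (k n) (t n) (\<xi> n) a \<omega>
    - X r \<omega> * (B b \<omega> - B a \<omega>)" for n \<omega>
  define err where "err n u = prob {\<omega>\<in>space M. \<bar>simple_integral_wrt B (k n) (t n) (\<xi> n) u \<omega> - I u \<omega>\<bar> > \<epsilon> / 4}" for n u
  have b0: "0 \<le> a" "0 \<le> b" using ab by auto
  have [measurable]: "simple_integral_wrt B (k n) (t n) (\<xi> n) a \<in> borel_measurable M"
     "simple_integral_wrt B (k n) (t n) (\<xi> n) b \<in> borel_measurable M"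
     "I a \<in> borel_measurable M" "I b \<in> borel_measurable M" "Q n \<in> borel_measurable M" for n
    using J[OF b0(1)] J[OF b0(2)] L[OF b0(2)] by (auto simp: converges_in_prob_def Q_def[abs_def])
  have XF: "X r \<in> borel_measurable (F r)" using X ab by (auto simp: adapted_def)
  have [measurable]: "X r \<in> borel_measurable M" by (rule measurable_filtration_imp[OF F ab(1) XF])
  note [measurable] = brownian_incr_measurable[OF B b0]
  have [measurable]: "R n \<in> borel_measurable M" for n unfolding R_def[abs_def] by measurable
  define \<delta> where "\<delta> = 2 * \<kappa> + 2 * \<eta>\<^sup>2 * (b - a)"
  have \<delta>: "\<delta> \<ge> 0" using \<kappa> ab by (simp add: \<delta>_def)
  have Rle: "prob {\<omega>\<in>space M. \<bar>R n \<omega>\<bar> > \<epsilon> / 2} \<le> prob E + prob {\<omega>\<in>space M. Q n \<omega> > \<kappa>} + 4 * \<delta> / \<epsilon>\<^sup>2" for n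
  proof -
    have tm: "\<forall>i<k n. t n i \<le> t n (Suc i)" using sp[of n] by (auto simp: simple_process_def)
    define p c where "p = clamp_points (k n) (t n) a b" and "c = clamp_coeffs (k n) (t n) b (\<xi> n) (X r)"
    have p: "0 \<le> p 0" "\<And>i. p i \<le> p (Suc i)"
      using clamp_points_mono[OF tm ab(3)] b0 by (auto simp: p_def clamp_points_def[of _ _ _ _ 0])
    have c: "c i \<in> borel_measurable (F (p i))" for i
      unfolding c_def p_def by (rule clamp_coeffs_measurable[OF F sp ab XF])
    have "\<epsilon> / 2 > 0" using \<epsilon> by simp
    from simple_integral_tail_le[OF F B p c this \<delta>, where n="Suc (Suc (k n))"]
    have "prob {\<omega>\<in>space M. \<bar>R n \<omega>\<bar> > \<epsilon> / 2} \<le>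
       prob {\<omega>\<in>space M. (\<Sum>i<Suc (Suc (k n)). (c i \<omega>)\<^sup>2 * (p (Suc i) - p i)) > \<delta>} + \<delta> / (\<epsilon> / 2)\<^sup>2"
      unfolding p_def c_def sum_clamp_coeffs[OF ab(3) tm] R_def .
    also have "prob {\<omega>\<in>space M. (\<Sum>i<Suc (Suc (k n)). (c i \<omega>)\<^sup>2 * (p (Suc i) - p i)) > \<delta>}
      \<le> prob (E \<union> {\<omega>\<in>space M. Q n \<omega> > \<kappa>})"
    proof (rule finite_measure_mono)
      have "Q n \<omega> > \<kappa>" if \<omega>: "\<omega> \<in> space M" "\<omega> \<notin> E"
        and gt: "(\<Sum>i<Suc (Suc (k n)). (c i \<omega>)\<^sup>2 * (p (Suc i) - p i)) > \<delta>" for \<omega>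
        using clamp_energy_le[OF tm b0(1) ab(3) cont[OF \<omega>(1)], of "X r" \<omega> \<eta> "\<xi> n"] \<eta>[of \<omega>] \<omega> gt
        by (simp only: c_def p_def Q_def \<delta>_def Diff_iff) fastforce
      then show "{\<omega>\<in>space M. (\<Sum>i<Suc (Suc (k n)). (c i \<omega>)\<^sup>2 * (p (Suc i) - p i)) > \<delta>}
          \<subseteq> E \<union> {\<omega>\<in>space M. Q n \<omega> > \<kappa>}"
        by blast
    qed (use E in measurable)
    also have "prob (E \<union> {\<omega>\<in>space M. Q n \<omega> > \<kappa>}) \<le> prob E + prob {\<omega>\<in>space M. Q n \<omega> > \<kappa>}"
      by (rule measure_Un_le[OF E]) measurable
    finally show ?thesis by (simp add: power_divide mult.commute)
  qed
  have main: "prob {\<omega>\<in>space M. \<bar>I b \<omega> - I a \<omega> - X r \<omega> * (B b \<omega> - B a \<omega>)\<bar> > \<epsilon>} \<le>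
    prob E + prob {\<omega>\<in>space M. Q n \<omega> > \<kappa>} + 4 * \<delta> / \<epsilon>\<^sup>2 + err n a + err n b" for n
  proof -
    have "prob {\<omega>\<in>space M. \<bar>I b \<omega> - I a \<omega> - X r \<omega> * (B b \<omega> - B a \<omega>)\<bar> > \<epsilon>} \<le>
      prob ({\<omega>\<in>space M. \<bar>R n \<omega>\<bar> > \<epsilon> / 2} \<union>
        ({\<omega>\<in>space M. \<bar>simple_integral_wrt B (k n) (t n) (\<xi> n) a \<omega> - I a \<omega>\<bar> > \<epsilon> / 4} \<union>
         {\<omega>\<in>space M. \<bar>simple_integral_wrt B (k n) (t n) (\<xi> n) b \<omega> - I b \<omega>\<bar> > \<epsilon> / 4}))" (is "_ \<le> prob (?A \<union> (?B \<union> ?C))")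
    proof (rule finite_measure_mono)
      show "{\<omega>\<in>space M. \<bar>I b \<omega> - I a \<omega> - X r \<omega> * (B b \<omega> - B a \<omega>)\<bar> > \<epsilon>} \<subseteq> ?A \<union> (?B \<union> ?C)"
      proof -
        have "\<bar>R n \<omega>\<bar> > \<epsilon> / 2 \<or> \<bar>simple_integral_wrt B (k n) (t n) (\<xi> n) a \<omega> - I a \<omega>\<bar> > \<epsilon> / 4 \<or>
            \<bar>simple_integral_wrt B (k n) (t n) (\<xi> n) b \<omega> - I b \<omega>\<bar> > \<epsilon> / 4"
          if "\<bar>I b \<omega> - I a \<omega> - X r \<omega> * (B b \<omega> - B a \<omega>)\<bar> > \<epsilon>" for \<omega>
          using that unfolding R_def by linarith
        then show ?thesis by blast
      qed
    qed measurable
    also have "\<dots> \<le> prob ?A + prob (?B \<union> ?C)" by (rule measure_Un_le) measurable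
    also have "prob (?B \<union> ?C) \<le> err n a + err n b" unfolding err_def by (rule measure_Un_le) measurable
    finally show ?thesis using Rle[of n] by linarith
  qed
  have "(\<lambda>n. prob E + prob {\<omega>\<in>space M. Q n \<omega> > \<kappa>} + 4 * \<delta> / \<epsilon>\<^sup>2 + err n a + err n b)
     \<longlonglongrightarrow> prob E + 0 + 4 * \<delta> / \<epsilon>\<^sup>2 + 0 + 0"
  proof (intro tendsto_add tendsto_const)
    have "(\<lambda>n. prob {\<omega>\<in>space M. \<bar>Q n \<omega> - 0\<bar> > \<kappa>}) \<longlonglongrightarrow> 0"
      using L[OF b0(2)] \<kappa> unfolding converges_in_prob_def Q_def by blast
    moreover have "Q n \<omega> \<ge> 0" for n \<omega>
      unfolding Q_def set_lebesgue_integral_def by (rule Bochner_Integration.integral_nonneg) auto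
    ultimately show "(\<lambda>n. prob {\<omega>\<in>space M. Q n \<omega> > \<kappa>}) \<longlonglongrightarrow> 0" by simp
    have "\<epsilon> / 4 > 0" using \<epsilon> by simp
    then show "(\<lambda>n. err n a) \<longlonglongrightarrow> 0" "(\<lambda>n. err n b) \<longlonglongrightarrow> 0"
      using J[OF b0(1)] J[OF b0(2)] unfolding converges_in_prob_def err_def by blast+
  qed
  then have "prob {\<omega>\<in>space M. \<bar>I b \<omega> - I a \<omega> - X r \<omega> * (B b \<omega> - B a \<omega>)\<bar> > \<epsilon>} \<le> prob E + 0 + 4 * \<delta> / \<epsilon>\<^sup>2 + 0 + 0"
    by (rule LIMSEQ_le_const) (use main in blast)
  also have "\<dots> = prob E + 8 * \<eta>\<^sup>2 * (b - a) / \<epsilon>\<^sup>2 + e"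
    using \<epsilon> by (simp add: \<delta>_def \<kappa>_def field_simps)
  finally show "prob {\<omega>\<in>space M. \<bar>I b \<omega> - I a \<omega> - X r \<omega> * (B b \<omega> - B a \<omega>)\<bar> > \<epsilon>} \<le> prob E + 8 * \<eta>\<^sup>2 * (b - a) / \<epsilon>\<^sup>2 + e" .
qed

section \<open>Generated \<open>\<sigma>\<close>-fields and limits in probability\<close>

lemma sigma_algebra_generated: "sigma_algebra (space M) (generated_sigma M Z J)"
  unfolding generated_sigma_def by (rule sigma_algebra_sigma_sets) auto

lemma generated_sigma_mono: "J \<subseteq> J' \<Longrightarrow> generated_sigma M Z J \<subseteq> generated_sigma M Z J'"
  unfolding generated_sigma_def by (intro sigma_sets_mono') auto

lemma generated_sigma_subset:
  assumes "\<And>t. t \<in> J \<Longrightarrow> Z t \<in> borel_measurable M"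
  shows "generated_sigma M Z J \<subseteq> sets M"
  unfolding generated_sigma_def
  by (rule sets.sigma_sets_subset) (use assms in \<open>auto intro: measurable_sets\<close>)

lemma (in sigma_algebra) space_sets_sigma:
  "space (sigma \<Omega> M) = \<Omega>" "sets (sigma \<Omega> M) = M"
  using space_closed by (auto simp: sets_measure_of_eq)

lemma measurable_generated_sigma:
  assumes "t \<in> J"
  shows "Z t \<in> borel_measurable (sigma (space M) (generated_sigma M Z J))"
proof (rule measurableI)
  interpret sigma_algebra "space M" "generated_sigma M Z J" by (rule sigma_algebra_generated)
  fix A :: "real set" assume "A \<in> sets borel"
  then have "Z t -` A \<inter> space M \<in> generated_sigma M Z J"
    unfolding generated_sigma_def using assms by (intro sigma_sets.Basic) auto
  then show "Z t -` A \<inter> space (sigma (space M) (generated_sigma M Z J))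
      \<in> sets (sigma (space M) (generated_sigma M Z J))"
    by (simp only: space_sets_sigma)
qed auto

lemma subalgebra_sigma:
  assumes "sigma_algebra (space M) \<A>" "\<A> \<subseteq> sets M"
  shows "subalgebra M (sigma (space M) \<A>)"
  using assms sigma_algebra.space_sets_sigma[OF assms(1)] by (simp add: subalgebra_def)

lemma (in prob_space) converges_in_prob_AE_subseq:
  assumes "converges_in_prob M Y Z"
  shows "\<exists>r. strict_mono r \<and> (AE \<omega> in M. (\<lambda>n. Y (r n) \<omega>) \<longlonglongrightarrow> Z \<omega>)"
proof -
  have [measurable]: "\<And>n. Y n \<in> borel_measurable M" "Z \<in> borel_measurable M"
    and P: "\<And>\<epsilon>. \<epsilon> > 0 \<Longrightarrow> (\<lambda>n. prob {\<omega>\<in>space M. \<bar>Y n \<omega> - Z \<omega>\<bar> > \<epsilon>}) \<longlonglongrightarrow> 0"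
    using assms by (auto simp: converges_in_prob_def)
  define u where "u n \<omega> = min 1 \<bar>Y n \<omega> - Z \<omega>\<bar>" for n \<omega>
  have [measurable]: "u n \<in> borel_measurable M" for n unfolding u_def[abs_def] by measurable
  have u: "0 \<le> u n \<omega>" "u n \<omega> \<le> 1" for n \<omega> by (auto simp: u_def)
  have int: "integrable M (u n)" for n using u by (intro integrable_const_bound[of _ 1]) auto
  have le: "expectation (u n) \<le> \<epsilon> + prob {\<omega>\<in>space M. \<bar>Y n \<omega> - Z \<omega>\<bar> > \<epsilon>}" if "\<epsilon> > 0" for \<epsilon> n
  proof -
    define A where "A = {\<omega>\<in>space M. \<bar>Y n \<omega> - Z \<omega>\<bar> > \<epsilon>}"
    have A: "A \<in> events" unfolding A_def by measurable
    have i: "integrable M (\<lambda>\<omega>. \<epsilon> + indicat_real A \<omega>)"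
      by (intro Bochner_Integration.integrable_add integrable_const integrable_real_indicator A) (simp add: emeasure_eq_measure)
    have "expectation (u n) \<le> expectation (\<lambda>\<omega>. \<epsilon> + indicat_real A \<omega>)"
    proof (rule integral_mono[OF int i])
      fix \<omega> assume "\<omega> \<in> space M"
      then show "u n \<omega> \<le> \<epsilon> + indicat_real A \<omega>"
        using that u(2)[of n \<omega>] by (cases "\<omega> \<in> A") (auto simp: A_def u_def)
    qed
    also have "\<dots> = \<epsilon> + prob A"
    proof -
      have "integrable M (indicat_real A)"
        by (intro integrable_real_indicator A) (simp add: emeasure_eq_measure)
      then show ?thesis using A sets.sets_into_space[OF A] by (simp add: prob_space Int_absorb2)
    qed
    finally show ?thesis unfolding A_def .
  qed
  have "(\<lambda>n. expectation (\<lambda>\<omega>. norm (u n \<omega>))) \<longlonglongrightarrow> 0"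
  proof (rule LIMSEQ_I)
    fix e :: real assume "e > 0"
    then have "\<exists>N. \<forall>n\<ge>N. norm (prob {\<omega>\<in>space M. \<bar>Y n \<omega> - Z \<omega>\<bar> > e / 2} - 0) < e / 2"
      using LIMSEQ_D[OF P[of "e / 2"], of "e / 2"] by simp
    then obtain N where N: "\<And>n. n \<ge> N \<Longrightarrow> prob {\<omega>\<in>space M. \<bar>Y n \<omega> - Z \<omega>\<bar> > e / 2} < e / 2" by auto
    show "\<exists>N. \<forall>n\<ge>N. norm (expectation (\<lambda>\<omega>. norm (u n \<omega>)) - 0) < e"
    proof (intro exI[of _ N] allI impI)
      fix n assume "n \<ge> N"
      have "0 \<le> expectation (u n)" using u by (intro Bochner_Integration.integral_nonneg) auto
      moreover have "expectation (u n) < e"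
        using le[of "e / 2" n] N[OF \<open>n \<ge> N\<close>] \<open>e > 0\<close> by linarith
      ultimately show "norm (expectation (\<lambda>\<omega>. norm (u n \<omega>)) - 0) < e" using u(1) by simp
    qed
  qed
  from tendsto_L1_AE_subseq[OF int this] obtain r where r: "strict_mono r"
    and ae: "AE \<omega> in M. (\<lambda>n. u (r n) \<omega>) \<longlonglongrightarrow> 0" by auto
  from ae have "AE \<omega> in M. (\<lambda>n. Y (r n) \<omega>) \<longlonglongrightarrow> Z \<omega>"
  proof eventually_elim
    fix \<omega> assume lim: "(\<lambda>n. u (r n) \<omega>) \<longlonglongrightarrow> 0"
    have "eventually (\<lambda>n. u (r n) \<omega> < 1) sequentially" by (rule order_tendstoD(2)[OF lim]) simp
    then have "eventually (\<lambda>n. u (r n) \<omega> = \<bar>Y (r n) \<omega> - Z \<omega>\<bar>) sequentially"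
      by eventually_elim (auto simp: u_def min_def split: if_splits)
    from Lim_transform_eventually[OF lim this] have "(\<lambda>n. Y (r n) \<omega> - Z \<omega>) \<longlonglongrightarrow> 0"
      by (simp add: tendsto_rabs_zero_iff)
    then show "(\<lambda>n. Y (r n) \<omega>) \<longlonglongrightarrow> Z \<omega>" by (simp add: LIM_zero_iff)
  qed
  with r show ?thesis by blast
qed

lemma
  assumes F: "filtration_on M F"
  shows sigma_algebra_filtration_limit: "sigma_algebra (space M) (filtration_limit M F)"
    and filtration_limit_subset: "filtration_limit M F \<subseteq> sets M"
    and measurable_filtration_limit: "0 \<le> t \<Longrightarrow> f \<in> borel_measurable (F t) \<Longrightarrow>
      f \<in> borel_measurable (sigma (space M) (filtration_limit M F))"
proof -
  have sub: "0 \<le> t \<Longrightarrow> sets (F t) \<subseteq> sets M" "0 \<le> t \<Longrightarrow> space (F t) = space M" for t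
    using filtration_onD(1)[OF F] by (auto simp: subalgebra_def)
  show sa: "sigma_algebra (space M) (filtration_limit M F)"
    unfolding filtration_limit_def using sub sets.sets_into_space
    by (intro sigma_algebra_sigma_sets) fastforce
  show "filtration_limit M F \<subseteq> sets M"
    unfolding filtration_limit_def using sub by (intro sets.sigma_sets_subset) auto
  assume t: "0 \<le> t" and f: "f \<in> borel_measurable (F t)"
  have "subalgebra (sigma (space M) (filtration_limit M F)) (F t)"
    using sub t sigma_algebra.space_sets_sigma[OF sa]
    by (auto simp: subalgebra_def filtration_limit_def)
  then show "f \<in> borel_measurable (sigma (space M) (filtration_limit M F))"
    using f by (rule measurable_from_subalg)
qed

text \<open>
  Independence of the subordinator is assumed only of the limit \<open>\<sigma>\<close>-field of the filtration,
  whereas the Ito integral is a limit in probability and is determined only up to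
  null events. It is measurable for the augmented limit \<open>\<sigma>\<close>-field, and augmentation preserves
  independence.
\<close>

lemma (in prob_space) ito_integral_augmented_measurable:
  assumes F: "filtration_on M F" and B: "brownian_motion_in M F B"
    and I: "ito_integral_process M F B X I" and u: "0 \<le> u"
  shows "I u \<in> borel_measurable (sigma (space M) (augmented M (filtration_limit M F)))"
proof -
  obtain k t \<xi> where sp: "\<And>n. simple_process F (k n) (t n) (\<xi> n)"
    and J: "converges_in_prob M (\<lambda>n. simple_integral_wrt B (k n) (t n) (\<xi> n) u) (I u)"
    using I u unfolding ito_integral_process_def by blast
  obtain r where ae: "AE \<omega> in M. (\<lambda>n. simple_integral_wrt B (k (r n)) (t (r n)) (\<xi> (r n)) u \<omega>) \<longlonglongrightarrow> I u \<omega>"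
    using converges_in_prob_AE_subseq[OF J] by auto
  let ?L = "sigma (space M) (filtration_limit M F)"
  have BL: "B v \<in> borel_measurable ?L" if "0 \<le> v" for v
    using B that by (intro measurable_filtration_limit[OF F that]) (simp add: brownian_motion_in_def adapted_def)
  have JL: "simple_integral_wrt B (k n) (t n) (\<xi> n) u \<in> borel_measurable ?L" for n
    unfolding simple_integral_wrt_def[abs_def]
  proof (intro borel_measurable_sum borel_measurable_times borel_measurable_diff)
    fix i assume "i \<in> {..<k n}"
    then have i: "i < k n" by simp
    have tm: "\<forall>i<k n. t n i \<le> t n (Suc i)" and t0: "0 \<le> t n 0" using sp[of n] by (auto simp: simple_process_def)
    have nn: "0 \<le> t n i" "0 \<le> t n (Suc i)"
      using partition_mono[OF tm, of 0 i] partition_mono[OF tm, of 0 "Suc i"] t0 i by auto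
    then show "B (min (t n i) u) \<in> borel_measurable ?L" "B (min (t n (Suc i)) u) \<in> borel_measurable ?L"
      using BL u by auto
    show "\<xi> n i \<in> borel_measurable ?L"
      using sp[of n] i nn by (intro measurable_filtration_limit[OF F nn(1)]) (simp add: simple_process_def)
  qed
  show ?thesis
  proof (rule measurable_augmentedI)
    show "(\<lambda>\<omega>. lim (\<lambda>n. simple_integral_wrt B (k (r n)) (t (r n)) (\<xi> (r n)) u \<omega>)) \<in> borel_measurable ?L"
      by (rule borel_measurable_lim_metric[OF JL])
    show "AE \<omega> in M. I u \<omega> = lim (\<lambda>n. simple_integral_wrt B (k (r n)) (t (r n)) (\<xi> (r n)) u \<omega>)"
      using ae by eventually_elim (simp add: limI)
    show "I u \<in> borel_measurable M" using J by (simp add: converges_in_prob_def)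
  qed (use F in \<open>auto intro: sigma_algebra_filtration_limit filtration_limit_subset dest: filtration_limit_subset\<close>)
qed

section \<open>Increments of a stable subordinator\<close>

lemma stable_incr_nonneg:
  assumes "stable_subordinator M \<alpha> \<tau>" "\<omega> \<in> space M" "0 \<le> s" "s \<le> t"
  shows "0 \<le> \<tau> s \<omega>" "\<tau> s \<omega> \<le> \<tau> t \<omega>"
proof -
  have m: "mono_on {0..} (\<lambda>l. \<tau> l \<omega>)" and z: "\<tau> 0 \<omega> = 0"
    using assms(1,2) by (auto simp: stable_subordinator_def)
  show "0 \<le> \<tau> s \<omega>" using mono_onD[OF m, of 0 s] assms z by simp
  show "\<tau> s \<omega> \<le> \<tau> t \<omega>" using mono_onD[OF m, of s t] assms by simp
qed

lemma stable_incr_laplace: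
  assumes \<tau>: "stable_subordinator M \<alpha> \<tau>"
    and c: "\<And>q l. 0 \<le> q \<Longrightarrow> 0 \<le> l \<Longrightarrow> (\<integral>\<omega>. exp (- q * \<tau> l \<omega>) \<partial>M) = exp (- c * l * q powr \<alpha>)"
    and "0 \<le> q" "0 \<le> t" "0 \<le> h"
  shows "(\<integral>\<omega>. exp (- q * (\<tau> (t + h) \<omega> - \<tau> t \<omega>)) \<partial>M) = exp (- c * h * q powr \<alpha>)"
proof -
  have m[measurable]: "\<tau> l \<in> borel_measurable M" if "0 \<le> l" for l using \<tau> that by (simp add: stable_subordinator_def)
  have [measurable]: "\<tau> (t + h) \<in> borel_measurable M" "\<tau> t \<in> borel_measurable M" "\<tau> h \<in> borel_measurable M" "\<tau> 0 \<in> borel_measurable M"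
    using assms by (auto intro: m)
  have eq: "distr M borel (\<lambda>\<omega>. \<tau> (t + h) \<omega> - \<tau> t \<omega>) = distr M borel (\<lambda>\<omega>. \<tau> h \<omega> - \<tau> 0 \<omega>)"
    using assms by (simp add: stable_subordinator_def stationary_increments_def)
  have "(\<integral>\<omega>. exp (- q * (\<tau> (t + h) \<omega> - \<tau> t \<omega>)) \<partial>M) = (\<integral>x. exp (- q * x) \<partial>distr M borel (\<lambda>\<omega>. \<tau> (t + h) \<omega> - \<tau> t \<omega>))"
    by (subst integral_distr) auto
  also have "\<dots> = (\<integral>\<omega>. exp (- q * (\<tau> h \<omega> - \<tau> 0 \<omega>)) \<partial>M)"
    unfolding eq by (subst integral_distr) auto
  also have "\<dots> = (\<integral>\<omega>. exp (- q * \<tau> h \<omega>) \<partial>M)"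
    using \<tau> by (intro Bochner_Integration.integral_cong) (auto simp: stable_subordinator_def)
  finally show ?thesis using c assms by simp
qed

lemma (in prob_space) indep_var_vimage:
  assumes "indep_var S X T Y"
  shows "indep_set {X -` A \<inter> space M | A. A \<in> sets S} {Y -` A \<inter> space M | A. A \<in> sets T}"
proof (rule indep_setI)
  have *: "indep_set (sigma_sets (space M) {X -` A \<inter> space M | A. A \<in> sets S})
      (sigma_sets (space M) {Y -` A \<inter> space M | A. A \<in> sets T})"
    using assms by (simp add: indep_var_eq)
  show "{X -` A \<inter> space M | A. A \<in> sets S} \<subseteq> events" "{Y -` A \<inter> space M | A. A \<in> sets T} \<subseteq> events"
    using indep_var_rv1[OF assms] indep_var_rv2[OF assms] by (auto intro: measurable_sets)
  show "prob (a \<inter> b) = prob a * prob b"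
    if "a \<in> {X -` A \<inter> space M | A. A \<in> sets S}" "b \<in> {Y -` A \<inter> space M | A. A \<in> sets T}" for a b
    using that by (intro indep_setD[OF *] sigma_sets.Basic)
qed

text \<open>
  The counterpart of \<open>brownian_cos_average_L1_le\<close> for the randomness of the subordinator. The rate \<open>q\<close> may depend on \<open>\<tau> l\<close>, of which the increments after \<open>l\<close> are
  independent; this is needed because the value of the integrand at time \<open>\<tau> l\<close> enters
  through \<open>q\<close>.
\<close>

lemma (in prob_space) subordinator_exp_average_L1_le:
  assumes \<tau>: "stable_subordinator M \<alpha> \<tau>"
    and c: "c > 0" "\<And>q l. 0 \<le> q \<Longrightarrow> 0 \<le> l \<Longrightarrow> (\<integral>\<omega>. exp (- q * \<tau> l \<omega>) \<partial>M) = exp (- c * l * q powr \<alpha>)"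
    and l: "0 \<le> l" and h: "0 \<le> h" and q[measurable]: "q \<in> borel_measurable borel" and q0: "\<And>u. 0 \<le> q u"
    and K: "K > 0"
  shows "expectation (\<lambda>\<omega>. \<bar>(\<Sum>k<K. exp (- q (\<tau> l \<omega>) * (\<tau> (l + real (Suc k) * h) \<omega> - \<tau> (l + real k * h) \<omega>))
      - exp (- c * h * q (\<tau> l \<omega>) powr \<alpha>)) / K\<bar>) \<le> 2 / sqrt K"
proof -
  \<comment> \<open>with \<open>0\<close> as an additional point, \<open>\<tau> l\<close> is itself the first of the independent increments\<close>
  define t where "t i = (case i of 0 \<Rightarrow> 0 | Suc j \<Rightarrow> l + real j * h)" for i
  have t: "0 \<le> t 0" "\<And>i. t i \<le> t (Suc i)"
    using l h by (auto simp: t_def algebra_simps split: nat.splits)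
  have tpos: "0 \<le> t i" for i using l h by (auto simp: t_def split: nat.splits)
  have tau_m: "\<tau> s \<in> borel_measurable M" if "0 \<le> s" for s using \<tau> that by (simp add: stable_subordinator_def)
  define D where "D i \<omega> = \<tau> (t (Suc i)) \<omega> - \<tau> (t i) \<omega>" for i \<omega>
  have D[measurable]: "D i \<in> borel_measurable M" for i
    unfolding D_def[abs_def] by (intro borel_measurable_diff tau_m tpos)
  have D0: "0 \<le> D i \<omega>" if "\<omega> \<in> space M" for i \<omega>
    using stable_incr_nonneg(2)[OF \<tau> that tpos t(2), of i] by (simp add: D_def)
  have D_0: "D 0 \<omega> = \<tau> l \<omega>" if "\<omega> \<in> space M" for \<omega>
    using \<tau> that by (simp add: D_def t_def stable_subordinator_def)
  have D_Suc: "D (Suc k) \<omega> = \<tau> (l + real (Suc k) * h) \<omega> - \<tau> (l + real k * h) \<omega>" for k \<omega>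
    by (simp add: D_def t_def)
  \<comment> \<open>the truncation at \<open>0\<close> does not affect increments of \<open>\<tau>\<close>, and makes \<open>g\<close> bounded everywhere\<close>
  define g where "g u v = exp (- q u * max 0 v) - exp (- c * h * q u powr \<alpha>)" for u v
  have [measurable]: "(\<lambda>z. g (f1 z) (f2 z)) \<in> borel_measurable N"
    if [measurable]: "f1 \<in> borel_measurable N" "f2 \<in> borel_measurable N" for f1 f2 and N :: "'z measure"
    unfolding g_def by measurable
  have gb: "\<bar>g u v\<bar> \<le> 2" for u v
  proof -
    have "exp (- q u * max 0 v) \<le> 1" "exp (- c * h * q u powr \<alpha>) \<le> 1"
      using q0[of u] c(1) h by (auto simp: mult_nonneg_nonneg)
    moreover have "exp (- q u * max 0 v) > 0" "exp (- c * h * q u powr \<alpha>) > 0" by simp_all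
    ultimately show ?thesis unfolding g_def by linarith
  qed
  have ind: "indep_vars (\<lambda>_. borel) D {..<Suc K}"
    using \<tau> t unfolding stable_subordinator_def independent_increments_def D_def[abs_def] by auto
  define Z where "Z k \<omega> = g (D 0 \<omega>) (D (Suc k) \<omega>)" for k \<omega>
  have "expectation (\<lambda>\<omega>. \<bar>(\<Sum>k<K. Z k \<omega>) / K\<bar>) \<le> 2 / sqrt K"
  proof (rule L1_average_orthogonal_le[OF K])
    show "Z k \<in> borel_measurable M" for k unfolding Z_def[abs_def] by measurable
    show "\<bar>Z k \<omega>\<bar> \<le> 2" for k \<omega> unfolding Z_def by (rule gb)
    fix j k assume jk: "j < k" "k < K"
    define f where "f z = g (fst z 0) (fst z (Suc j)) * g (fst z 0) (snd z (Suc k))" for z :: "(nat \<Rightarrow> real) \<times> (nat \<Rightarrow> real)"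
    let ?S = "PiM {0, Suc j} (\<lambda>_. borel :: real measure)" and ?T = "PiM {Suc k} (\<lambda>_. borel :: real measure)"
    let ?X = "\<lambda>\<omega>. restrict (\<lambda>i. D i \<omega>) {0, Suc j}" and ?Y = "\<lambda>\<omega>. restrict (\<lambda>i. D i \<omega>) {Suc k}"
    have iv: "indep_var ?S ?X ?T ?Y"
      by (rule indep_var_restrict[OF ind]) (use jk in auto)
    have "expectation (\<lambda>\<omega>. Z j \<omega> * Z k \<omega>) = (\<integral>\<omega>. f (?X \<omega>, ?Y \<omega>) \<partial>M)"
      by (simp add: f_def Z_def)
    also have "\<dots> = (\<integral>\<omega>1. (\<integral>\<omega>2. f (?X \<omega>1, ?Y \<omega>2) \<partial>M) \<partial>M)"
    proof (rule integral_decouple[OF indep_var_rv1[OF iv] indep_var_rv2[OF iv] indep_var_vimage[OF iv]])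
      have [measurable]: "(\<lambda>z. fst z 0) \<in> borel_measurable (?S \<Otimes>\<^sub>M ?T)" "(\<lambda>z. fst z (Suc j)) \<in> borel_measurable (?S \<Otimes>\<^sub>M ?T)"
        "(\<lambda>z. snd z (Suc k)) \<in> borel_measurable (?S \<Otimes>\<^sub>M ?T)"
        by (rule measurable_compose[OF measurable_fst measurable_component_singleton]
              measurable_compose[OF measurable_snd measurable_component_singleton]; simp)+
      show "f \<in> borel_measurable (?S \<Otimes>\<^sub>M ?T)" unfolding f_def[abs_def] by measurable
      show "\<bar>f (v, w)\<bar> \<le> 4" for v w
        unfolding f_def abs_mult
        using mult_mono[OF gb[of "v 0" "v (Suc j)"] gb[of "v 0" "w (Suc k)"]] by simp
    qed
    also have "\<dots> = (\<integral>\<omega>1. 0 \<partial>M)"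
    proof (intro Bochner_Integration.integral_cong refl)
      fix \<omega>1
      define u where "u = D 0 \<omega>1"
      have "(\<integral>\<omega>2. exp (- q u * max 0 (D (Suc k) \<omega>2)) \<partial>M) = (\<integral>\<omega>2. exp (- q u * (\<tau> ((l + real k * h) + h) \<omega>2 - \<tau> (l + real k * h) \<omega>2)) \<partial>M)"
        using D0[of _ "Suc k"] by (intro Bochner_Integration.integral_cong refl)
          (auto simp: D_Suc algebra_simps max_def)
      also have "\<dots> = exp (- c * h * q u powr \<alpha>)"
        using l h by (intro stable_incr_laplace[OF \<tau> c(2)] q0) auto
      finally have e: "(\<integral>\<omega>2. exp (- q u * max 0 (D (Suc k) \<omega>2)) \<partial>M) = exp (- c * h * q u powr \<alpha>)" .
      have "integrable M (\<lambda>\<omega>2. exp (- q u * max 0 (D (Suc k) \<omega>2)))"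
        using q0[of u] by (intro integrable_const_bound[of _ 1]) (auto simp: mult_nonneg_nonneg)
      then have "(\<integral>\<omega>2. g u (D (Suc k) \<omega>2) \<partial>M) = 0"
        unfolding g_def using e by (simp add: prob_space)
      then show "(\<integral>\<omega>2. f (?X \<omega>1, ?Y \<omega>2) \<partial>M) = 0"
        by (simp add: f_def u_def)
    qed
    finally show "expectation (\<lambda>\<omega>. Z j \<omega> * Z k \<omega>) = 0" by simp
  qed
  also have "expectation (\<lambda>\<omega>. \<bar>(\<Sum>k<K. Z k \<omega>) / K\<bar>) = expectation (\<lambda>\<omega>. \<bar>(\<Sum>k<K. exp (- q (\<tau> l \<omega>) * (\<tau> (l + real (Suc k) * h) \<omega> - \<tau> (l + real k * h) \<omega>))
      - exp (- c * h * q (\<tau> l \<omega>) powr \<alpha>)) / K\<bar>)"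
  proof (intro Bochner_Integration.integral_cong refl)
    fix \<omega> assume \<omega>: "\<omega> \<in> space M"
    have "Z k \<omega> = exp (- q (\<tau> l \<omega>) * (\<tau> (l + real (Suc k) * h) \<omega> - \<tau> (l + real k * h) \<omega>))
      - exp (- c * h * q (\<tau> l \<omega>) powr \<alpha>)" for k
      unfolding Z_def g_def D_0[OF \<omega>] using D0[OF \<omega>, of "Suc k"] by (simp add: D_Suc max_def)
    then show "\<bar>(\<Sum>k<K. Z k \<omega>) / K\<bar> = \<bar>(\<Sum>k<K. exp (- q (\<tau> l \<omega>) * (\<tau> (l + real (Suc k) * h) \<omega> - \<tau> (l + real k * h) \<omega>))
      - exp (- c * h * q (\<tau> l \<omega>) powr \<alpha>)) / K\<bar>" by simp
  qed
  finally show ?thesis .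
qed

section \<open>The law of large numbers for the subordinate integral\<close>

text \<open>
  The oscillation of a path over a random interval is an event only through countably
  many times. Relative positions in \<open>\<rat> \<inter> [0, 1]\<close> suffice and do not depend on the interval.
\<close>

lemma abs_diff_le_of_rational_points:
  fixes f :: "real \<Rightarrow> real"
  assumes f: "continuous_on {a..b} f" and ab: "a \<le> b"
    and r: "\<And>r. r \<in> \<rat> \<Longrightarrow> r \<in> {0..1} \<Longrightarrow> \<bar>f (a + r * (b - a)) - f a\<bar> \<le> \<eta>"
    and u: "u \<in> {a..b}"
  shows "\<bar>f u - f a\<bar> \<le> \<eta>"
proof -
  have in_ab: "a + r * (b - a) \<in> {a..b}" if "r \<in> {0..1}" for r
    using mult_right_mono[of r 1 "b - a"] that ab by auto
  define S where "S = {0..1} \<inter> (\<lambda>r. \<bar>f (a + r * (b - a)) - f a\<bar>) -` {..\<eta>}"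
  have "continuous_on {0..1} (\<lambda>r. \<bar>f (a + r * (b - a)) - f a\<bar>)"
    using in_ab by (intro continuous_intros continuous_on_compose2[OF f]) auto
  then have "closed S"
    using continuous_closed_preimage[of "{0..1}" "\<lambda>r. \<bar>f (a + r * (b - a)) - f a\<bar>" "{..\<eta>}"]
    by (simp add: S_def)
  moreover have "{0<..<1} \<inter> \<rat> \<subseteq> S" using r by (auto simp: S_def)
  ultimately have "closure ({0<..<1} \<inter> \<rat>) \<subseteq> S" by (rule closure_minimal[rotated])
  moreover have "{0<..<1::real} \<subseteq> closure ({0<..<1} \<inter> \<rat>)"
    using open_Int_closure_subset[of "{0<..<1::real}" \<rat>] by (simp add: Rats_closure_real)
  ultimately have "{0<..<1} \<subseteq> S" by simp
  then have "closure {0<..<1::real} \<subseteq> S" using \<open>closed S\<close> by (rule closure_minimal)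
  then have S: "{0..1} \<subseteq> S" by simp
  show ?thesis
  proof (cases "a = b")
    case True
    then show ?thesis using u r[of 0] by simp
  next
    case False
    then have "(u - a) / (b - a) \<in> {0..1}" using u by (auto simp: field_simps)
    with S have "(u - a) / (b - a) \<in> S" by blast
    then show ?thesis using False by (simp add: S_def)
  qed
qed

lemma abs_cos_diff_le_2: "\<bar>cos u - cos v\<bar> \<le> 2" for u v :: real
  using cos_le_one[of u] cos_le_one[of v] cos_ge_minus_one[of u] cos_ge_minus_one[of v] by linarith

lemma (in prob_space) expectation_cos_diff_le:
  assumes [measurable]: "U \<in> borel_measurable M" "V \<in> borel_measurable M" and \<epsilon>: "\<epsilon> > 0"
  shows "expectation (\<lambda>\<omega>. \<bar>cos (U \<omega>) - cos (V \<omega>)\<bar>) \<le> \<epsilon> + 2 * prob {\<omega>\<in>space M. \<bar>U \<omega> - V \<omega>\<bar> > \<epsilon>}"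
    and "expectation (\<lambda>\<omega>. \<bar>cos (U \<omega>) - cos (V \<omega>)\<bar>) \<le> 2"
proof -
  note le2 = abs_cos_diff_le_2
  have lip: "\<bar>cos u - cos v\<bar> \<le> \<bar>u - v\<bar>" for u v :: real
  proof -
    have "\<bar>cos u - cos v\<bar> = 2 * (\<bar>sin ((u + v) / 2)\<bar> * \<bar>sin ((v - u) / 2)\<bar>)"
      by (simp add: cos_diff_cos abs_mult)
    also have "\<dots> \<le> 2 * (1 * \<bar>(v - u) / 2\<bar>)"
      by (intro mult_left_mono mult_mono abs_sin_x_le_abs_x abs_sin_le_one) auto
    finally show ?thesis by (simp add: abs_minus_commute)
  qed
  define A where "A = {\<omega>\<in>space M. \<bar>U \<omega> - V \<omega>\<bar> > \<epsilon>}"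
  have A: "A \<in> events" unfolding A_def by measurable
  have iA: "integrable M (indicat_real A)"
    by (intro integrable_real_indicator A) (simp add: emeasure_eq_measure)
  have i: "integrable M (\<lambda>\<omega>. \<bar>cos (U \<omega>) - cos (V \<omega>)\<bar>)"
    using le2 by (intro integrable_const_bound[of _ 2]) auto
  have "expectation (\<lambda>\<omega>. \<bar>cos (U \<omega>) - cos (V \<omega>)\<bar>) \<le> expectation (\<lambda>\<omega>. \<epsilon> + 2 * indicat_real A \<omega>)"
  proof (rule integral_mono[OF i])
    show "integrable M (\<lambda>\<omega>. \<epsilon> + 2 * indicat_real A \<omega>)" using iA by simp
    fix \<omega> assume "\<omega> \<in> space M"
    then show "\<bar>cos (U \<omega>) - cos (V \<omega>)\<bar> \<le> \<epsilon> + 2 * indicat_real A \<omega>"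
      using \<epsilon> le2[of "U \<omega>" "V \<omega>"] lip[of "U \<omega>" "V \<omega>"] by (cases "\<omega> \<in> A") (auto simp: A_def)
  qed
  also have "\<dots> = \<epsilon> + 2 * prob A"
    using iA sets.sets_into_space[OF A] by (simp add: prob_space Int_absorb2)
  finally show "expectation (\<lambda>\<omega>. \<bar>cos (U \<omega>) - cos (V \<omega>)\<bar>) \<le> \<epsilon> + 2 * prob {\<omega>\<in>space M. \<bar>U \<omega> - V \<omega>\<bar> > \<epsilon>}"
    unfolding A_def .
  have "expectation (\<lambda>\<omega>. \<bar>cos (U \<omega>) - cos (V \<omega>)\<bar>) \<le> expectation (\<lambda>\<omega>. 2)"
    using i le2 by (intro integral_mono) auto
  then show "expectation (\<lambda>\<omega>. \<bar>cos (U \<omega>) - cos (V \<omega>)\<bar>) \<le> 2" by (simp add: prob_space)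
qed

text \<open>
  At deterministic times: replacing the integral by \<open>X (t 0)\<close> times the Brownian increment, and
  then averaging the Brownian motion out, each costs little. The steps of a subordinator are
  occasionally long. A step of length \<open>d m s\<^sup>2\<close> with \<open>d > 1\<close> is charged the trivial error \<open>2\<close>, which is at
  most \<open>4 (1 - exp (- d))\<close>; in this form the charge can later be integrated with respect
  to the subordinator by means of its Laplace transform.
\<close>

lemma (in prob_space) ito_cos_average_le:
  assumes F: "filtration_on M F" and B: "brownian_motion_in M F B" and X: "adapted F X"
    and cont: "\<And>\<omega>. \<omega> \<in> space M \<Longrightarrow> continuous_on {0..} (\<lambda>t. X t \<omega>)"
    and I: "ito_integral_process M F B X I"
    and t: "0 \<le> t 0" "\<And>k. t k \<le> t (Suc k)" and E: "E \<in> events"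
    and \<eta>: "\<And>\<omega> u. \<omega> \<in> space M - E \<Longrightarrow> u \<in> {t 0..t K} \<Longrightarrow> \<bar>X u \<omega> - X (t 0) \<omega>\<bar> \<le> \<eta>"
    and pos: "K > 0" "s > 0" "m > 0" "\<epsilon> > 0"
  shows "expectation (\<lambda>\<omega>. \<bar>(\<Sum>k<K. cos ((I (t (Suc k)) \<omega> - I (t k) \<omega>) / s)
       - exp (- ((X (t 0) \<omega> / s)\<^sup>2 / 2) * (t (Suc k) - t k))) / K\<bar>)
    \<le> \<epsilon> + 2 * prob E + 16 * \<eta>\<^sup>2 * m / \<epsilon>\<^sup>2
       + (\<Sum>k<K. 4 * (1 - exp (- (1 / (m * s\<^sup>2)) * (t (Suc k) - t k)))) / K + 2 / sqrt K"
proof -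
  have mono: "i \<le> j \<Longrightarrow> t i \<le> t j" for i j by (rule lift_Suc_mono_le[of t]) (rule t(2))
  have t0: "0 \<le> t k" for k using t(1) mono[of 0 k] by simp
  have XF: "X (t 0) \<in> borel_measurable (F (t 0))" using X t by (simp add: adapted_def)
  have [measurable]: "X (t 0) \<in> borel_measurable M" by (rule measurable_filtration_imp[OF F t(1) XF])
  have [measurable]: "I (t k) \<in> borel_measurable M" for k
    using I t0[of k] by (auto simp: ito_integral_process_def converges_in_prob_def)
  have [measurable]: "B (t k) \<in> borel_measurable M" for k
    using B t0[of k] by (simp add: brownian_motion_in_def brownian_motion_def)
  define U V W where "U k \<omega> = (I (t (Suc k)) \<omega> - I (t k) \<omega>) / s"
    and "V k \<omega> = X (t 0) \<omega> / s * (B (t (Suc k)) \<omega> - B (t k) \<omega>)"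
    and "W k \<omega> = exp (- (X (t 0) \<omega> / s)\<^sup>2 * (t (Suc k) - t k) / 2)" for k \<omega>
  have [measurable]: "U k \<in> borel_measurable M" "V k \<in> borel_measurable M" "W k \<in> borel_measurable M" for k
    unfolding U_def[abs_def] V_def[abs_def] W_def[abs_def] by measurable
  have W01: "0 < W k \<omega>" "W k \<omega> \<le> 1" for k \<omega> using t(2)[of k] by (auto simp: W_def)
  define d where "d k = (t (Suc k) - t k) / (m * s\<^sup>2)" for k
  have d0: "0 \<le> d k" for k using t(2)[of k] pos by (simp add: d_def)
  have each: "expectation (\<lambda>\<omega>. \<bar>cos (U k \<omega>) - cos (V k \<omega>)\<bar>) \<le> \<epsilon> + 2 * prob E + 16 * \<eta>\<^sup>2 * m / \<epsilon>\<^sup>2 + 4 * (1 - exp (- d k))"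
    if k: "k < K" for k
  proof (cases "d k \<le> 1")
    case True
    have eq: "{\<omega>\<in>space M. \<bar>U k \<omega> - V k \<omega>\<bar> > \<epsilon>} =
        {\<omega>\<in>space M. \<bar>I (t (Suc k)) \<omega> - I (t k) \<omega> - X (t 0) \<omega> * (B (t (Suc k)) \<omega> - B (t k) \<omega>)\<bar> > \<epsilon> * s}"
    proof -
      have "U k \<omega> - V k \<omega> = (I (t (Suc k)) \<omega> - I (t k) \<omega> - X (t 0) \<omega> * (B (t (Suc k)) \<omega> - B (t k) \<omega>)) / s" for \<omega>
        by (simp add: U_def V_def diff_divide_distrib)
      then show ?thesis using pos by (simp add: pos_less_divide_eq)
    qed
    have "prob {\<omega>\<in>space M. \<bar>U k \<omega> - V k \<omega>\<bar> > \<epsilon>}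
       \<le> prob E + 8 * \<eta>\<^sup>2 * (t (Suc k) - t k) / (\<epsilon> * s)\<^sup>2"
      unfolding eq
    proof (rule ito_integral_local_error[OF F B X cont I t(1) mono[of 0 k] t(2) E])
      fix \<omega> u assume "\<omega> \<in> space M - E" "u \<in> {t k..t (Suc k)}"
      then show "\<bar>X u \<omega> - X (t 0) \<omega>\<bar> \<le> \<eta>"
        using mono[of 0 k] mono[of "Suc k" K] k by (intro \<eta>) auto
    qed (use pos in auto)
    moreover have "8 * \<eta>\<^sup>2 * (t (Suc k) - t k) / (\<epsilon> * s)\<^sup>2 \<le> 8 * \<eta>\<^sup>2 * m / \<epsilon>\<^sup>2"
    proof -
      have "8 * \<eta>\<^sup>2 * (t (Suc k) - t k) / (\<epsilon> * s)\<^sup>2 = 8 * \<eta>\<^sup>2 * m / \<epsilon>\<^sup>2 * d k"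
        using pos by (simp add: d_def field_simps power_mult_distrib)
      also have "\<dots> \<le> 8 * \<eta>\<^sup>2 * m / \<epsilon>\<^sup>2 * 1" using True pos by (intro mult_left_mono) auto
      finally show ?thesis by simp
    qed
    moreover have "0 \<le> 4 * (1 - exp (- d k))" using d0[of k] by simp
    moreover have "expectation (\<lambda>\<omega>. \<bar>cos (U k \<omega>) - cos (V k \<omega>)\<bar>) \<le> \<epsilon> + 2 * prob {\<omega>\<in>space M. \<bar>U k \<omega> - V k \<omega>\<bar> > \<epsilon>}"
      using pos by (intro expectation_cos_diff_le) auto
    moreover have "16 * \<eta>\<^sup>2 * m / \<epsilon>\<^sup>2 = 2 * (8 * \<eta>\<^sup>2 * m / \<epsilon>\<^sup>2)" by simp
    ultimately show ?thesis by linarith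
  next
    case False
    have "2 \<le> exp (d k)"
      using False exp_ge_add_one_self[of "d k"] by linarith
    then have "2 * exp (- d k) \<le> 1" by (simp add: exp_minus field_simps)
    then have "2 \<le> 4 * (1 - exp (- d k))" by simp
    moreover have "expectation (\<lambda>\<omega>. \<bar>cos (U k \<omega>) - cos (V k \<omega>)\<bar>) \<le> 2"
      using expectation_cos_diff_le(2)[of "U k" "V k" 1] by simp
    moreover have "0 \<le> 2 * prob E" "0 \<le> 16 * \<eta>\<^sup>2 * m / \<epsilon>\<^sup>2" using pos by simp_all
    ultimately show ?thesis using pos(4) by linarith
  qed
  have iUV: "integrable M (\<lambda>\<omega>. \<bar>cos (U k \<omega>) - cos (V k \<omega>)\<bar>)" for k
  proof (rule integrable_const_bound[of _ 2])
    show "AE \<omega> in M. norm \<bar>cos (U k \<omega>) - cos (V k \<omega>)\<bar> \<le> 2"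
    proof (rule AE_I2)
      fix \<omega> show "norm \<bar>cos (U k \<omega>) - cos (V k \<omega>)\<bar> \<le> 2"
        using abs_cos_diff_le_2[of "U k \<omega>" "V k \<omega>"] by simp
    qed
  qed measurable
  have iVW: "integrable M (\<lambda>\<omega>. \<bar>(\<Sum>k<K. cos (V k \<omega>) - W k \<omega>) / K\<bar>)"
  proof -
    have "integrable M (\<lambda>\<omega>. cos (V k \<omega>))" "integrable M (W k)" for k
      using W01[of k] by (intro integrable_const_bound[of _ 1]; simp add: less_imp_le)+
    then show ?thesis by (intro integrable_abs integrable_divide_zero Bochner_Integration.integrable_sum Bochner_Integration.integrable_diff) auto
  qed
  have iUVs: "integrable M (\<lambda>\<omega>. (\<Sum>k<K. \<bar>cos (U k \<omega>) - cos (V k \<omega>)\<bar>) / K)"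
    using iUV by auto
  have "expectation (\<lambda>\<omega>. \<bar>(\<Sum>k<K. cos (U k \<omega>) - W k \<omega>) / K\<bar>)
     \<le> expectation (\<lambda>\<omega>. (\<Sum>k<K. \<bar>cos (U k \<omega>) - cos (V k \<omega>)\<bar>) / K + \<bar>(\<Sum>k<K. cos (V k \<omega>) - W k \<omega>) / K\<bar>)"
  proof (rule integral_mono')
    show "integrable M (\<lambda>\<omega>. (\<Sum>k<K. \<bar>cos (U k \<omega>) - cos (V k \<omega>)\<bar>) / K + \<bar>(\<Sum>k<K. cos (V k \<omega>) - W k \<omega>) / K\<bar>)"
      using iUVs iVW by (rule Bochner_Integration.integrable_add)
    fix \<omega>
    have "(\<Sum>k<K. cos (U k \<omega>) - W k \<omega>) = (\<Sum>k<K. cos (U k \<omega>) - cos (V k \<omega>)) + (\<Sum>k<K. cos (V k \<omega>) - W k \<omega>)"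
      by (simp add: sum.distrib[symmetric])
    then have "\<bar>\<Sum>k<K. cos (U k \<omega>) - W k \<omega>\<bar> \<le> (\<Sum>k<K. \<bar>cos (U k \<omega>) - cos (V k \<omega>)\<bar>) + \<bar>\<Sum>k<K. cos (V k \<omega>) - W k \<omega>\<bar>"
      using sum_abs[of "\<lambda>k. cos (U k \<omega>) - cos (V k \<omega>)" "{..<K}"] by linarith
    from divide_right_mono[OF this, of "real K"]
    show "\<bar>(\<Sum>k<K. cos (U k \<omega>) - W k \<omega>) / K\<bar> \<le> (\<Sum>k<K. \<bar>cos (U k \<omega>) - cos (V k \<omega>)\<bar>) / K + \<bar>(\<Sum>k<K. cos (V k \<omega>) - W k \<omega>) / K\<bar>"
      by (simp add: add_divide_distrib)
    then show "0 \<le> (\<Sum>k<K. \<bar>cos (U k \<omega>) - cos (V k \<omega>)\<bar>) / K + \<bar>(\<Sum>k<K. cos (V k \<omega>) - W k \<omega>) / K\<bar>"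
      using abs_ge_zero order_trans by blast
  qed
  also have "\<dots> = (\<Sum>k<K. expectation (\<lambda>\<omega>. \<bar>cos (U k \<omega>) - cos (V k \<omega>)\<bar>)) / K + expectation (\<lambda>\<omega>. \<bar>(\<Sum>k<K. cos (V k \<omega>) - W k \<omega>) / K\<bar>)"
    by (subst Bochner_Integration.integral_add[OF iUVs iVW], subst integral_divide_zero,
        subst Bochner_Integration.integral_sum[OF iUV]) simp
  also have "\<dots> \<le> (\<Sum>k<K. (\<epsilon> + 2 * prob E + 16 * \<eta>\<^sup>2 * m / \<epsilon>\<^sup>2) + 4 * (1 - exp (- d k))) / K + 2 / sqrt K"
  proof (intro add_mono divide_right_mono sum_mono)
    show "expectation (\<lambda>\<omega>. \<bar>(\<Sum>k<K. cos (V k \<omega>) - W k \<omega>) / K\<bar>) \<le> 2 / sqrt K"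
      unfolding V_def W_def
      by (rule brownian_cos_average_L1_le[OF F B t _ pos(1)]) (use XF in measurable)
  qed (use each in auto)
  also have "(\<Sum>k<K. (\<epsilon> + 2 * prob E + 16 * \<eta>\<^sup>2 * m / \<epsilon>\<^sup>2) + 4 * (1 - exp (- d k))) / K
     = \<epsilon> + 2 * prob E + 16 * \<eta>\<^sup>2 * m / \<epsilon>\<^sup>2 + (\<Sum>k<K. 4 * (1 - exp (- d k))) / K"
    using pos(1) by (simp add: sum.distrib add_divide_distrib del: sum_constant_scale)
  finally show ?thesis by (simp add: U_def W_def d_def mult.commute)
qed

text \<open>
  A random variable depending on both independent \<open>\<sigma>\<close>-fields is the restriction to the diagonal of
  a function of two outcomes, the first governing \<open>S\<close> and the second \<open>T\<close>.
\<close>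

lemma (in prob_space) decouple_subalgebras:
  fixes f :: "'a \<times> 'a \<Rightarrow> real"
  assumes S: "subalgebra M S" "subalgebra M T" and ind: "indep_set (sets S) (sets T)"
    and f: "f \<in> borel_measurable (S \<Otimes>\<^sub>M T)"
    and C: "\<And>x y. x \<in> space M \<Longrightarrow> y \<in> space M \<Longrightarrow> \<bar>f (x, y)\<bar> \<le> C"
  shows "integrable M (\<lambda>\<omega>. f (\<omega>, \<omega>))"
    and "integrable M (\<lambda>\<omega>1. \<integral>\<omega>2. f (\<omega>1, \<omega>2) \<partial>M)"
    and "\<omega> \<in> space M \<Longrightarrow> integrable M (\<lambda>\<omega>2. f (\<omega>, \<omega>2))"
    and "(\<integral>\<omega>. f (\<omega>, \<omega>) \<partial>M) = (\<integral>\<omega>1. (\<integral>\<omega>2. f (\<omega>1, \<omega>2) \<partial>M) \<partial>M)"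
proof -
  have sp: "space S = space M" "space T = space M" using S by (auto simp: subalgebra_def)
  note id = subalgebra_measurable_id[OF S(1)] subalgebra_measurable_id[OF S(2)]
  have fM: "f \<in> borel_measurable (M \<Otimes>\<^sub>M M)"
  proof -
    have "(\<lambda>z. (fst z, snd z)) \<in> measurable (M \<Otimes>\<^sub>M M) (S \<Otimes>\<^sub>M T)"
      by (intro measurable_Pair measurable_compose[OF measurable_fst id(1)] measurable_compose[OF measurable_snd id(2)])
    from measurable_compose[OF this f] show ?thesis by simp
  qed
  have "(\<lambda>\<omega>. (\<omega>, \<omega>)) \<in> measurable M (S \<Otimes>\<^sub>M T)" by (intro measurable_Pair id)
  from measurable_compose[OF this f] show "integrable M (\<lambda>\<omega>. f (\<omega>, \<omega>))"
    using C by (intro integrable_const_bound[of _ C]) auto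
  have f2: "(\<lambda>\<omega>2. f (\<omega>, \<omega>2)) \<in> borel_measurable M" if "\<omega> \<in> space M" for \<omega>
    using fM that by measurable
  have i2: "integrable M (\<lambda>\<omega>2. f (\<omega>, \<omega>2))" if "\<omega> \<in> space M" for \<omega>
    using f2[OF that] C that by (intro integrable_const_bound[of _ C]) auto
  then show "\<omega> \<in> space M \<Longrightarrow> integrable M (\<lambda>\<omega>2. f (\<omega>, \<omega>2))" by simp
  have "case_prod (\<lambda>x y. f (x, y)) \<in> borel_measurable (M \<Otimes>\<^sub>M M)" using fM by (simp add: case_prod_eta)
  from borel_measurable_lebesgue_integral[OF this]
  have m: "(\<lambda>\<omega>1. \<integral>\<omega>2. f (\<omega>1, \<omega>2) \<partial>M) \<in> borel_measurable M" .
  have "\<bar>\<integral>\<omega>2. f (\<omega>1, \<omega>2) \<partial>M\<bar> \<le> C" if "\<omega>1 \<in> space M" for \<omega>1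
  proof -
    have "\<bar>\<integral>\<omega>2. f (\<omega>1, \<omega>2) \<partial>M\<bar> \<le> (\<integral>\<omega>2. \<bar>f (\<omega>1, \<omega>2)\<bar> \<partial>M)" by (rule integral_abs_bound)
    also have "\<dots> \<le> (\<integral>\<omega>2. C \<partial>M)"
      using i2[OF that] C that by (intro integral_mono) auto
    finally show ?thesis by (simp add: prob_space)
  qed
  then show "integrable M (\<lambda>\<omega>1. \<integral>\<omega>2. f (\<omega>1, \<omega>2) \<partial>M)"
    using m by (intro integrable_const_bound[of _ C]) auto
  show "(\<integral>\<omega>. f (\<omega>, \<omega>) \<partial>M) = (\<integral>\<omega>1. (\<integral>\<omega>2. f (\<omega>1, \<omega>2) \<partial>M) \<partial>M)"
  proof (rule integral_decouple[OF id _ f])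
    show "indep_set {(\<lambda>\<omega>. \<omega>) -` A \<inter> space M | A. A \<in> sets S} {(\<lambda>\<omega>. \<omega>) -` A \<inter> space M | A. A \<in> sets T}"
      unfolding subalgebra_vimage_id[OF S(1)] subalgebra_vimage_id[OF S(2)] by (rule ind)
  qed (use C sp in auto)
qed

text \<open>
  With \<open>\<omega>\<^sub>1\<close> governing the subordinator and \<open>\<omega>\<^sub>2\<close> everything else, let \<open>Y\<close> be the average of
  cosines, \<open>P\<close> the proposed limit, and \<open>W\<close> the average of \<open>exp (- (x / s)\<^sup>2 \<Delta> / 2)\<close> over
  the increments \<open>\<Delta>\<close> of the subordinator, where \<open>x\<close> is the value of \<open>X\<close> at time \<open>\<tau> l\<close>. For frozen \<open>\<omega>\<^sub>1\<close> the times
  are deterministic and \<open>Y - W\<close> is controlled by the Brownian motion; for frozen \<open>\<omega>\<^sub>2\<close>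
  the difference \<open>W - P\<close> is controlled by the subordinator. The scale \<open>s\<close> is the
  one for which the law of the increments divided by \<open>s\<^sup>2\<close> does not depend on \<open>h\<close>.
\<close>

lemma (in prob_space) subordinated_average_L1_le:
  assumes F: "filtration_on M F" and B: "brownian_motion_in M F B" and X: "adapted F X"
    and cont: "\<And>\<omega>. \<omega> \<in> space M \<Longrightarrow> continuous_on {0..} (\<lambda>t. X t \<omega>)"
    and I: "ito_integral_process M F B X I"
    and \<alpha>: "0 < \<alpha>" and \<tau>: "stable_subordinator M \<alpha> \<tau>"
    and ind: "indep_set (generated_sigma M \<tau> {0..}) (filtration_limit M F)"
    and c: "c > 0" "\<And>q l. 0 \<le> q \<Longrightarrow> 0 \<le> l \<Longrightarrow> (\<integral>\<omega>. exp (- q * \<tau> l \<omega>) \<partial>M) = exp (- c * l * q powr \<alpha>)"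
    and pos: "0 \<le> l" "0 < h" "K > 0" "m > 0" "\<epsilon> > 0" "0 \<le> \<eta>"
    and s: "s = h powr (1 / (2 * \<alpha>))"
  shows "expectation (\<lambda>\<omega>. \<bar>(\<Sum>k<K. cos ((I (\<tau> (l + real (Suc k) * h) \<omega>) \<omega> - I (\<tau> (l + real k * h) \<omega>) \<omega>) / s)) / K
       - exp (- c * ((X (\<tau> l \<omega>) \<omega>)\<^sup>2 / 2) powr \<alpha>)\<bar>)
    \<le> \<epsilon> + 2 * prob {\<omega>\<in>space M. \<exists>r\<in>\<rat> \<inter> {0..1}. \<bar>X (\<tau> l \<omega> + r * (\<tau> (l + real K * h) \<omega> - \<tau> l \<omega>)) \<omega> - X (\<tau> l \<omega>) \<omega>\<bar> > \<eta>}
       + 16 * \<eta>\<^sup>2 * m / \<epsilon>\<^sup>2 + 4 * (1 - exp (- c * m powr (- \<alpha>))) + 4 / sqrt K"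
proof -
  define t where "t k = l + real k * h" for k
  have t0: "0 \<le> t k" "t k \<le> t (Suc k)" "t 0 = l" for k using pos by (auto simp: t_def algebra_simps)
  have spos: "s > 0" using pos(2) by (simp add: s)
  have s2: "s\<^sup>2 = h powr (1 / \<alpha>)"
    using \<alpha> by (simp add: s powr_powr[symmetric] power2_eq_square powr_add[symmetric])
  have s2\<alpha>: "(s\<^sup>2) powr \<alpha> = h" using \<alpha> pos(2) by (simp add: s2 powr_powr)
  have scale: "c * h * (q / s\<^sup>2) powr \<alpha> = c * q powr \<alpha>" if "0 \<le> q" for q
    using that pos(2) spos by (simp add: powr_divide s2\<alpha>)
  define S1 where "S1 = sigma (space M) (generated_sigma M \<tau> {0..})"
  define S2 where "S2 = sigma (space M) (augmented M (filtration_limit M F))"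
  have \<tau>M: "\<tau> u \<in> borel_measurable M" if "0 \<le> u" for u using \<tau> that by (simp add: stable_subordinator_def)
  have gs: "generated_sigma M \<tau> {0..} \<subseteq> events" by (rule generated_sigma_subset) (use \<tau>M in auto)
  note fl = sigma_algebra_filtration_limit[OF F] filtration_limit_subset[OF F]
  have sub1: "subalgebra M S1" unfolding S1_def by (rule subalgebra_sigma[OF sigma_algebra_generated gs])
  have sub2: "subalgebra M S2" unfolding S2_def
    by (rule subalgebra_sigma[OF sigma_algebra_augmented[OF fl(2)] augmented_subset_sets[OF fl(2)]])
  have sets12: "sets S1 = generated_sigma M \<tau> {0..}" "sets S2 = augmented M (filtration_limit M F)"
    unfolding S1_def S2_def
    using sigma_algebra.space_sets_sigma(2)[OF sigma_algebra_generated]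
      sigma_algebra.space_sets_sigma(2)[OF sigma_algebra_augmented[OF fl(2)]] by auto
  have sp: "space S1 = space M" "space S2 = space M" using sub1 sub2 by (auto simp: subalgebra_def)
  have ind12: "indep_set (sets S1) (sets S2)" unfolding sets12 by (rule indep_set_augmented[OF fl(1) ind])
  have ind21: "indep_set (sets S2) (sets S1)"
  proof (rule indep_setI)
    show "prob (a \<inter> b) = prob a * prob b" if "a \<in> sets S2" "b \<in> sets S1" for a b
      using indep_setD[OF ind12 that(2,1)] by (simp add: Int_commute mult.commute)
  qed (use indep_setD_ev1[OF ind12] indep_setD_ev2[OF ind12] in auto)
  define T where "T k = \<tau> (t k)" for k
  have T1: "T k \<in> borel_measurable S1" for k
    unfolding T_def S1_def by (rule measurable_generated_sigma) (use t0 in auto)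
  have TM[measurable]: "T k \<in> borel_measurable M" for k unfolding T_def by (rule \<tau>M[OF t0(1)])
  have T0: "0 \<le> T k \<omega>" "T k \<omega> \<le> T (Suc k) \<omega>" if "\<omega> \<in> space M" for k \<omega>
    using stable_incr_nonneg[OF \<tau> that t0(1,2)] by (auto simp: T_def)
  have Tmono: "T i \<omega> \<le> T j \<omega>" if "\<omega> \<in> space M" "i \<le> j" for i j \<omega>
    by (rule lift_Suc_mono_le[of "\<lambda>k. T k \<omega>", OF T0(2)[OF that(1)] that(2)])
  have X2: "X u \<in> borel_measurable S2" if "0 \<le> u" for u
  proof -
    have "X u \<in> borel_measurable (sigma (space M) (filtration_limit M F))"
      using X that by (intro measurable_filtration_limit[OF F that]) (simp add: adapted_def)
    moreover have "X u \<in> borel_measurable M"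
      using X that by (intro measurable_filtration_imp[OF F that]) (simp add: adapted_def)
    ultimately show ?thesis unfolding S2_def by (intro measurable_augmentedI[OF fl]) auto
  qed
  have I2: "I u \<in> borel_measurable S2" if "0 \<le> u" for u
    unfolding S2_def by (rule ito_integral_augmented_measurable[OF F B I that])
  have Icont: "continuous_on {0..} (\<lambda>u. I u \<omega>)" if "\<omega> \<in> space M" for \<omega>
    using I that by (simp add: ito_integral_process_def)
  let ?P = "S1 \<Otimes>\<^sub>M S2"
  have TP[measurable]: "(\<lambda>z. T k (fst z)) \<in> borel_measurable ?P" for k
    by (rule measurable_compose[OF measurable_fst T1])
  have fstP: "fst z \<in> space M" "snd z \<in> space M" if "z \<in> space ?P" for z
    using that sp by (auto simp: space_pair_measure)
  have IP[measurable]: "(\<lambda>z. I (T k (fst z)) (snd z)) \<in> borel_measurable ?P" for k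
    by (rule measurable_continuous_process_at[OF I2 _ TP _ measurable_snd]) (use Icont sp T0 fstP in auto)
  have XP[measurable]: "(\<lambda>z. X (T 0 (fst z)) (snd z)) \<in> borel_measurable ?P"
    by (rule measurable_continuous_process_at[OF X2 _ TP _ measurable_snd]) (use cont sp T0 fstP in auto)
  have XrP: "(\<lambda>z. X (T 0 (fst z) + r * (T K (fst z) - T 0 (fst z))) (snd z)) \<in> borel_measurable ?P" if "0 \<le> r" for r
  proof (rule measurable_continuous_process_at[OF X2 _ _ _ measurable_snd])
    fix z assume "z \<in> space ?P"
    then show "0 \<le> T 0 (fst z) + r * (T K (fst z) - T 0 (fst z))"
      using that T0(1)[of "fst z" 0] Tmono[of "fst z" 0 K] fstP[of z] by auto
  qed (use cont sp in auto)
  define \<phi> where "\<phi> x = exp (- c * (x\<^sup>2 / 2) powr \<alpha>)" for x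
  define Y where "Y z = (\<Sum>k<K. cos ((I (T (Suc k) (fst z)) (snd z) - I (T k (fst z)) (snd z)) / s)) / K" for z
  define W where "W z = (\<Sum>k<K. exp (- ((X (T 0 (fst z)) (snd z) / s)\<^sup>2 / 2) * (T (Suc k) (fst z) - T k (fst z)))) / K" for z
  define P where "P z = \<phi> (X (T 0 (fst z)) (snd z))" for z
  define G where "G = {z\<in>space ?P. \<exists>r\<in>\<rat> \<inter> {0..1}. \<bar>X (T 0 (fst z) + r * (T K (fst z) - T 0 (fst z))) (snd z) - X (T 0 (fst z)) (snd z)\<bar> > \<eta>}"
  have [measurable]: "Y \<in> borel_measurable ?P" unfolding Y_def[abs_def] by measurable
  have [measurable]: "W \<in> borel_measurable ?P" unfolding W_def[abs_def] by measurable
  have [measurable]: "P \<in> borel_measurable ?P" unfolding P_def[abs_def] \<phi>_def by measurable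
  have G: "G \<in> sets ?P"
  proof -
    have "G = (\<Union>r\<in>\<rat> \<inter> {0..1}. {z\<in>space ?P. \<bar>X (T 0 (fst z) + r * (T K (fst z) - T 0 (fst z))) (snd z) - X (T 0 (fst z)) (snd z)\<bar> > \<eta>})"
      by (auto simp: G_def)
    also have "\<dots> \<in> sets ?P"
    proof (rule sets.countable_UN'')
      show "countable (\<rat> \<inter> {0..1::real})" using countable_rat by (rule countable_subset[rotated]) auto
      fix r :: real assume "r \<in> \<rat> \<inter> {0..1}"
      then have [measurable]: "(\<lambda>z. X (T 0 (fst z) + r * (T K (fst z) - T 0 (fst z))) (snd z)) \<in> borel_measurable ?P"
        by (intro XrP) auto
      show "{z\<in>space ?P. \<bar>X (T 0 (fst z) + r * (T K (fst z) - T 0 (fst z))) (snd z) - X (T 0 (fst z)) (snd z)\<bar> > \<eta>} \<in> sets ?P"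
        by measurable
    qed
    finally show ?thesis .
  qed
  have Yb: "\<bar>Y z\<bar> \<le> 1" for z
  proof -
    have "\<bar>\<Sum>k<K. cos ((I (T (Suc k) (fst z)) (snd z) - I (T k (fst z)) (snd z)) / s)\<bar> \<le> (\<Sum>k<K. 1)"
      by (intro order_trans[OF sum_abs] sum_mono) auto
    then show ?thesis using pos(3) by (simp add: Y_def)
  qed
  have Pb: "\<bar>P z\<bar> \<le> 1" for z using c(1) by (simp add: P_def \<phi>_def)
  have Wb: "\<bar>W (\<omega>1, \<omega>2)\<bar> \<le> 1" if "\<omega>1 \<in> space M" for \<omega>1 \<omega>2
  proof -
    have "\<bar>exp (- ((X (T 0 \<omega>1) \<omega>2 / s)\<^sup>2 / 2) * (T (Suc k) \<omega>1 - T k \<omega>1))\<bar> \<le> 1" for k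
      using T0(2)[OF that, of k] by (simp add: mult_nonneg_nonneg)
    then have "\<bar>\<Sum>k<K. exp (- ((X (T 0 \<omega>1) \<omega>2 / s)\<^sup>2 / 2) * (T (Suc k) \<omega>1 - T k \<omega>1))\<bar> \<le> (\<Sum>k<K. 1)"
      by (intro order_trans[OF sum_abs] sum_mono)
    then show ?thesis using pos(3) by (simp add: W_def)
  qed
  have YWb: "\<bar>\<bar>Y (\<omega>1, \<omega>2) - W (\<omega>1, \<omega>2)\<bar>\<bar> \<le> 2" if "\<omega>1 \<in> space M" for \<omega>1 \<omega>2
    using Yb[of "(\<omega>1, \<omega>2)"] Wb[OF that, of \<omega>2] by linarith
  have WPb: "\<bar>\<bar>W (\<omega>1, \<omega>2) - P (\<omega>1, \<omega>2)\<bar>\<bar> \<le> 2" if "\<omega>1 \<in> space M" for \<omega>1 \<omega>2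
    using Pb[of "(\<omega>1, \<omega>2)"] Wb[OF that, of \<omega>2] by linarith
  have mYW: "(\<lambda>z. \<bar>Y z - W z\<bar>) \<in> borel_measurable ?P" and mWP: "(\<lambda>z. \<bar>W z - P z\<bar>) \<in> borel_measurable ?P" by measurable
  note dYW = decouple_subalgebras[OF sub1 sub2 ind12 mYW YWb]
  have mG: "indicat_real G \<in> borel_measurable ?P" using G by measurable
  note dG = decouple_subalgebras[OF sub1 sub2 ind12 mG, of 1]
  have mWP': "(\<lambda>z. \<bar>W (snd z, fst z) - P (snd z, fst z)\<bar>) \<in> borel_measurable (S2 \<Otimes>\<^sub>M S1)"
  proof -
    have "(\<lambda>z. (snd z, fst z)) \<in> measurable (S2 \<Otimes>\<^sub>M S1) ?P" by measurable
    from measurable_compose[OF this mWP] show ?thesis by simp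
  qed
  note dWP = decouple_subalgebras[OF sub2 sub1 ind21 mWP', of 2, unfolded fst_conv snd_conv]

  have W_P: "(\<integral>\<omega>. \<bar>W (\<omega>, \<omega>) - P (\<omega>, \<omega>)\<bar> \<partial>M) \<le> 2 / sqrt K"
  proof -
    have each: "(\<integral>\<omega>1. \<bar>W (\<omega>1, \<omega>2) - P (\<omega>1, \<omega>2)\<bar> \<partial>M) \<le> 2 / sqrt K" if w2: "\<omega>2 \<in> space M" for \<omega>2
    proof -
      \<comment> \<open>paths of \<open>X\<close> are continuous on \<open>[0, \<infinity>)\<close> only; the maximum makes \<open>q\<close> Borel on the line\<close>
      define q where "q u = (X (max 0 u) \<omega>2 / s)\<^sup>2 / 2" for u
      have "continuous_on UNIV (\<lambda>u. X (max 0 u) \<omega>2)"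
        by (rule continuous_on_compose2[OF cont[OF w2]]) (auto intro!: continuous_intros)
      then have "(\<lambda>u. X (max 0 u) \<omega>2) \<in> borel_measurable borel" by (rule borel_measurable_continuous_onI)
      then have qm: "q \<in> borel_measurable borel" unfolding q_def[abs_def] by measurable
      have "(\<integral>\<omega>1. \<bar>W (\<omega>1, \<omega>2) - P (\<omega>1, \<omega>2)\<bar> \<partial>M) =
        expectation (\<lambda>\<omega>. \<bar>(\<Sum>k<K. exp (- q (\<tau> l \<omega>) * (\<tau> (l + real (Suc k) * h) \<omega> - \<tau> (l + real k * h) \<omega>))
          - exp (- c * h * q (\<tau> l \<omega>) powr \<alpha>)) / K\<bar>)"
      proof (intro Bochner_Integration.integral_cong refl)
        fix \<omega> assume w: "\<omega> \<in> space M"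
        have q1: "q (\<tau> l \<omega>) = (X (T 0 \<omega>) \<omega>2 / s)\<^sup>2 / 2"
          using T0(1)[OF w, of 0] by (simp add: q_def T_def t0 max_def)
        have "(X (T 0 \<omega>) \<omega>2 / s)\<^sup>2 / 2 = (X (T 0 \<omega>) \<omega>2)\<^sup>2 / 2 / s\<^sup>2" by (simp add: power_divide)
        then have "c * h * q (\<tau> l \<omega>) powr \<alpha> = c * ((X (T 0 \<omega>) \<omega>2)\<^sup>2 / 2) powr \<alpha>"
          unfolding q1 by (simp only: scale zero_le_power2 zero_le_divide_iff) (rule scale, simp)
        then have "exp (- c * h * q (\<tau> l \<omega>) powr \<alpha>) = P (\<omega>, \<omega>2)"
          by (simp add: P_def \<phi>_def)
        moreover have "(\<Sum>k<K. exp (- q (\<tau> l \<omega>) * (\<tau> (l + real (Suc k) * h) \<omega> - \<tau> (l + real k * h) \<omega>))) = K * W (\<omega>, \<omega>2)"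
          using pos(3) unfolding q1 by (simp add: W_def T_def t_def)
        ultimately show "\<bar>W (\<omega>, \<omega>2) - P (\<omega>, \<omega>2)\<bar> = \<bar>(\<Sum>k<K. exp (- q (\<tau> l \<omega>) * (\<tau> (l + real (Suc k) * h) \<omega> - \<tau> (l + real k * h) \<omega>))
          - exp (- c * h * q (\<tau> l \<omega>) powr \<alpha>)) / K\<bar>"
          using pos(3) by (simp add: sum_subtractf diff_divide_distrib)
      qed
      also have "\<dots> \<le> 2 / sqrt K"
        using pos by (intro subordinator_exp_average_L1_le[OF \<tau> c] qm) (auto simp: q_def)
      finally show ?thesis .
    qed
    have "(\<integral>\<omega>. \<bar>W (\<omega>, \<omega>) - P (\<omega>, \<omega>)\<bar> \<partial>M) = (\<integral>\<omega>2. (\<integral>\<omega>1. \<bar>W (\<omega>1, \<omega>2) - P (\<omega>1, \<omega>2)\<bar> \<partial>M) \<partial>M)"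
      by (rule dWP(4)) (rule WPb)
    also have "\<dots> \<le> (\<integral>\<omega>2. 2 / sqrt K \<partial>M)"
      by (rule integral_mono[OF dWP(2)]) (use WPb each in auto)
    finally show ?thesis by (simp add: prob_space)
  qed

  define \<theta> where "\<theta> = 1 / (m * s\<^sup>2)"
  have \<theta>: "\<theta> > 0" using pos spos by (simp add: \<theta>_def)
  define H where "H k \<omega> = exp (- \<theta> * (T (Suc k) \<omega> - T k \<omega>))" for k \<omega>
  have H: "integrable M (H k)" "(\<integral>\<omega>. H k \<omega> \<partial>M) = exp (- c * m powr (- \<alpha>))" for k
  proof -
    have "H k \<in> borel_measurable M" unfolding H_def[abs_def] by measurable
    moreover have "\<bar>H k \<omega>\<bar> \<le> 1" if "\<omega> \<in> space M" for \<omega>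
      using T0(2)[OF that, of k] \<theta> by (simp add: H_def mult_nonneg_nonneg)
    ultimately show "integrable M (H k)" by (intro integrable_const_bound[of _ 1]) auto
    have "(\<integral>\<omega>. H k \<omega> \<partial>M) = (\<integral>\<omega>. exp (- \<theta> * (\<tau> (t k + h) \<omega> - \<tau> (t k) \<omega>)) \<partial>M)"
      by (simp add: H_def T_def t_def algebra_simps)
    also have "\<dots> = exp (- c * h * \<theta> powr \<alpha>)"
      using \<theta> t0(1)[of k] pos(2) by (intro stable_incr_laplace[OF \<tau> c(2)]) auto
    also have "c * h * \<theta> powr \<alpha> = c * (1 / m) powr \<alpha>"
      using scale[of "1 / m"] pos(4) by (simp add: \<theta>_def)
    then have "exp (- c * h * \<theta> powr \<alpha>) = exp (- c * m powr (- \<alpha>))"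
      using pos(4) by (simp add: powr_divide powr_minus_divide)
    finally show "(\<integral>\<omega>. H k \<omega> \<partial>M) = exp (- c * m powr (- \<alpha>))" .
  qed
  have Y_W: "(\<integral>\<omega>. \<bar>Y (\<omega>, \<omega>) - W (\<omega>, \<omega>)\<bar> \<partial>M) \<le>
     \<epsilon> + 2 * (\<integral>\<omega>. indicat_real G (\<omega>, \<omega>) \<partial>M) + 16 * \<eta>\<^sup>2 * m / \<epsilon>\<^sup>2 + 4 * (1 - exp (- c * m powr (- \<alpha>))) + 2 / sqrt K"
  proof -
    define R where "R \<omega> = (\<Sum>k<K. 4 * (1 - H k \<omega>)) / K" for \<omega>
    have R: "integrable M R" "(\<integral>\<omega>. R \<omega> \<partial>M) = 4 * (1 - exp (- c * m powr (- \<alpha>)))"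
    proof -
      have i: "integrable M (\<lambda>\<omega>. 4 * (1 - H k \<omega>))" for k using H(1) by simp
      show "integrable M R" unfolding R_def[abs_def] using i by auto
      have "(\<integral>\<omega>. R \<omega> \<partial>M) = (\<Sum>k<K. \<integral>\<omega>. 4 * (1 - H k \<omega>) \<partial>M) / K"
        unfolding R_def by (subst integral_divide_zero, subst Bochner_Integration.integral_sum[OF i]) simp
      then show "(\<integral>\<omega>. R \<omega> \<partial>M) = 4 * (1 - exp (- c * m powr (- \<alpha>)))"
        using pos(3) H by (simp add: prob_space)
    qed
    have each: "(\<integral>\<omega>2. \<bar>Y (\<omega>1, \<omega>2) - W (\<omega>1, \<omega>2)\<bar> \<partial>M) \<le>
       \<epsilon> + 2 * (\<integral>\<omega>2. indicat_real G (\<omega>1, \<omega>2) \<partial>M) + 16 * \<eta>\<^sup>2 * m / \<epsilon>\<^sup>2 + R \<omega>1 + 2 / sqrt K" if w1: "\<omega>1 \<in> space M" for \<omega>1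
    proof -
      define E where "E = {\<omega>2\<in>space M. (\<omega>1, \<omega>2) \<in> G}"
      have E: "E \<in> events"
      proof -
        have "(\<lambda>\<omega>2. (\<omega>1, \<omega>2)) \<in> measurable S2 ?P"
          by (rule measurable_Pair1') (simp add: w1 sp)
        from measurable_sets[OF this G] have "(\<lambda>\<omega>2. (\<omega>1, \<omega>2)) -` G \<inter> space M \<in> sets S2" by (simp add: sp)
        then show ?thesis using sub2 by (auto simp: E_def subalgebra_def vimage_def Int_def conj_commute)
      qed
      have pE: "(\<integral>\<omega>2. indicat_real G (\<omega>1, \<omega>2) \<partial>M) = prob E"
      proof -
        have "(\<integral>\<omega>2. indicat_real G (\<omega>1, \<omega>2) \<partial>M) = (\<integral>\<omega>2. indicat_real E \<omega>2 \<partial>M)"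
          by (intro Bochner_Integration.integral_cong) (auto simp: E_def indicator_def)
        then show ?thesis using sets.sets_into_space[OF E] by (simp add: Int_absorb2)
      qed
      have off: "\<bar>X u \<omega>2 - X (T 0 \<omega>1) \<omega>2\<bar> \<le> \<eta>" if w2: "\<omega>2 \<in> space M - E" and u: "u \<in> {T 0 \<omega>1..T K \<omega>1}" for \<omega>2 u
      proof (rule abs_diff_le_of_rational_points[OF _ _ _ u])
        show "continuous_on {T 0 \<omega>1..T K \<omega>1} (\<lambda>u. X u \<omega>2)"
          using cont[of \<omega>2] w2 T0(1)[OF w1, of 0] by (auto intro: continuous_on_subset)
        show "T 0 \<omega>1 \<le> T K \<omega>1" by (rule Tmono[OF w1]) simp
        fix r :: real assume "r \<in> \<rat>" "r \<in> {0..1}"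
        moreover have "(\<omega>1, \<omega>2) \<notin> G" using w2 by (simp add: E_def)
        ultimately show "\<bar>X (T 0 \<omega>1 + r * (T K \<omega>1 - T 0 \<omega>1)) \<omega>2 - X (T 0 \<omega>1) \<omega>2\<bar> \<le> \<eta>"
          using w1 w2 sp by (auto simp: G_def space_pair_measure not_less)
      qed
      have "(\<integral>\<omega>2. \<bar>Y (\<omega>1, \<omega>2) - W (\<omega>1, \<omega>2)\<bar> \<partial>M) =
         expectation (\<lambda>\<omega>. \<bar>(\<Sum>k<K. cos ((I (T (Suc k) \<omega>1) \<omega> - I (T k \<omega>1) \<omega>) / s)
       - exp (- ((X (T 0 \<omega>1) \<omega> / s)\<^sup>2 / 2) * (T (Suc k) \<omega>1 - T k \<omega>1))) / K\<bar>)"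
        by (simp add: Y_def W_def sum_subtractf diff_divide_distrib)
      also have "\<dots> \<le> \<epsilon> + 2 * prob E + 16 * \<eta>\<^sup>2 * m / \<epsilon>\<^sup>2
       + (\<Sum>k<K. 4 * (1 - exp (- (1 / (m * s\<^sup>2)) * (T (Suc k) \<omega>1 - T k \<omega>1)))) / K + 2 / sqrt K"
        by (rule ito_cos_average_le[OF F B X cont I _ _ E, where t="\<lambda>k. T k \<omega>1"])
          (use T0[OF w1] off pos spos in auto)
      finally show ?thesis by (simp only: pE R_def H_def \<theta>_def)
    qed
    have iG: "integrable M (\<lambda>\<omega>1. \<integral>\<omega>2. indicat_real G (\<omega>1, \<omega>2) \<partial>M)" by (rule dG(2)) auto
    have "(\<integral>\<omega>. \<bar>Y (\<omega>, \<omega>) - W (\<omega>, \<omega>)\<bar> \<partial>M) = (\<integral>\<omega>1. (\<integral>\<omega>2. \<bar>Y (\<omega>1, \<omega>2) - W (\<omega>1, \<omega>2)\<bar> \<partial>M) \<partial>M)"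
      by (rule dYW(4))
    also have "\<dots> \<le> (\<integral>\<omega>1. \<epsilon> + 2 * (\<integral>\<omega>2. indicat_real G (\<omega>1, \<omega>2) \<partial>M) + 16 * \<eta>\<^sup>2 * m / \<epsilon>\<^sup>2 + R \<omega>1 + 2 / sqrt K \<partial>M)"
      by (rule integral_mono[OF dYW(2)]) (use iG R(1) each in auto)
    also have "\<dots> = \<epsilon> + 2 * (\<integral>\<omega>1. (\<integral>\<omega>2. indicat_real G (\<omega>1, \<omega>2) \<partial>M) \<partial>M) + 16 * \<eta>\<^sup>2 * m / \<epsilon>\<^sup>2 + (\<integral>\<omega>. R \<omega> \<partial>M) + 2 / sqrt K"
      using iG R(1) by (simp add: prob_space)
    also have "(\<integral>\<omega>1. (\<integral>\<omega>2. indicat_real G (\<omega>1, \<omega>2) \<partial>M) \<partial>M) = (\<integral>\<omega>. indicat_real G (\<omega>, \<omega>) \<partial>M)"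
      by (rule dG(4)[symmetric]) auto
    finally show ?thesis by (simp only: R(2))
  qed
  have iYW: "integrable M (\<lambda>\<omega>. \<bar>Y (\<omega>, \<omega>) - W (\<omega>, \<omega>)\<bar>)" by (rule dYW(1))
  have iWP: "integrable M (\<lambda>\<omega>. \<bar>W (\<omega>, \<omega>) - P (\<omega>, \<omega>)\<bar>)" by (rule dWP(1)) (rule WPb)
  have "expectation (\<lambda>\<omega>. \<bar>Y (\<omega>, \<omega>) - P (\<omega>, \<omega>)\<bar>) \<le>
     expectation (\<lambda>\<omega>. \<bar>Y (\<omega>, \<omega>) - W (\<omega>, \<omega>)\<bar> + \<bar>W (\<omega>, \<omega>) - P (\<omega>, \<omega>)\<bar>)"
    by (rule integral_mono') (use iYW iWP in auto)
  also have "\<dots> = expectation (\<lambda>\<omega>. \<bar>Y (\<omega>, \<omega>) - W (\<omega>, \<omega>)\<bar>) + expectation (\<lambda>\<omega>. \<bar>W (\<omega>, \<omega>) - P (\<omega>, \<omega>)\<bar>)"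
    by (rule Bochner_Integration.integral_add[OF iYW iWP])
  finally have main: "expectation (\<lambda>\<omega>. \<bar>Y (\<omega>, \<omega>) - P (\<omega>, \<omega>)\<bar>) \<le>
     \<epsilon> + 2 * (\<integral>\<omega>. indicat_real G (\<omega>, \<omega>) \<partial>M) + 16 * \<eta>\<^sup>2 * m / \<epsilon>\<^sup>2 + 4 * (1 - exp (- c * m powr (- \<alpha>))) + 4 / sqrt K"
    using Y_W W_P by linarith
  define A where "A = {\<omega>\<in>space M. \<exists>r\<in>\<rat> \<inter> {0..1}. \<bar>X (\<tau> l \<omega> + r * (\<tau> (l + real K * h) \<omega> - \<tau> l \<omega>)) \<omega> - X (\<tau> l \<omega>) \<omega>\<bar> > \<eta>}"
  have "(\<integral>\<omega>. indicat_real G (\<omega>, \<omega>) \<partial>M) = (\<integral>\<omega>. indicat_real A \<omega> \<partial>M)"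
    using sp by (intro Bochner_Integration.integral_cong) 
      (auto simp: G_def A_def T_def t_def indicator_def space_pair_measure)
  also have "\<dots> = prob A" by (simp add: A_def Int_def conj_commute cong: conj_cong)
  finally show ?thesis using main by (simp add: Y_def P_def \<phi>_def T_def t_def A_def)
qed

section \<open>Recovering the absolute value of the integrand\<close>

text \<open>
  By right-continuity of \<open>\<tau>\<close> at \<open>l\<close>, the interval from \<open>\<tau> l\<close> to \<open>\<tau> (l + d n)\<close> shrinks to a point
  for every outcome, and the path of \<open>X\<close> is continuous there.
\<close>

lemma (in prob_space) subordinated_path_oscillation_tendsto_0:
  fixes X :: "real \<Rightarrow> 'a \<Rightarrow> real"
  assumes X: "\<And>t. 0 \<le> t \<Longrightarrow> X t \<in> borel_measurable M"
    and cont: "\<And>\<omega>. \<omega> \<in> space M \<Longrightarrow> continuous_on {0..} (\<lambda>t. X t \<omega>)"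
    and \<tau>: "stable_subordinator M \<alpha> \<tau>" and l: "0 \<le> l" and \<eta>: "\<eta> > 0"
    and d: "\<And>n. 0 \<le> d n" "d \<longlonglongrightarrow> 0"
  shows "(\<lambda>n. prob {\<omega>\<in>space M. \<exists>r\<in>\<rat> \<inter> {0..1}.
      \<bar>X (\<tau> l \<omega> + r * (\<tau> (l + d n) \<omega> - \<tau> l \<omega>)) \<omega> - X (\<tau> l \<omega>) \<omega>\<bar> > \<eta>}) \<longlonglongrightarrow> 0"
proof -
  define A where "A n = {\<omega>\<in>space M. \<exists>r\<in>\<rat> \<inter> {0..1}.
      \<bar>X (\<tau> l \<omega> + r * (\<tau> (l + d n) \<omega> - \<tau> l \<omega>)) \<omega> - X (\<tau> l \<omega>) \<omega>\<bar> > \<eta>}" for n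
  have \<tau>M[measurable]: "\<tau> l \<in> borel_measurable M" "\<tau> (l + d n) \<in> borel_measurable M" for n
    using \<tau> l d(1)[of n] by (auto simp: stable_subordinator_def)
  have nn: "0 \<le> \<tau> l \<omega>" "\<tau> l \<omega> \<le> \<tau> (l + d n) \<omega>" if "\<omega> \<in> space M" for \<omega> n
    using stable_incr_nonneg[OF \<tau> that l, of "l + d n"] d(1)[of n] by auto
  have A: "A n \<in> events" for n
  proof -
    have "A n = (\<Union>r\<in>\<rat> \<inter> {0..1}. {\<omega>\<in>space M. \<bar>X (\<tau> l \<omega> + r * (\<tau> (l + d n) \<omega> - \<tau> l \<omega>)) \<omega> - X (\<tau> l \<omega>) \<omega>\<bar> > \<eta>})"
      by (auto simp: A_def)
    also have "\<dots> \<in> events"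
    proof (rule sets.countable_UN'')
      show "countable (\<rat> \<inter> {0..1::real})" using countable_rat by (rule countable_subset[rotated]) auto
      fix r :: real assume r: "r \<in> \<rat> \<inter> {0..1}"
      have [measurable]: "(\<lambda>\<omega>. X (\<tau> l \<omega> + r * (\<tau> (l + d n) \<omega> - \<tau> l \<omega>)) \<omega>) \<in> borel_measurable M"
        by (rule measurable_continuous_process_at[where Z=X and S=M]) (use X cont nn r in auto)
      have [measurable]: "(\<lambda>\<omega>. X (\<tau> l \<omega>) \<omega>) \<in> borel_measurable M"
        by (rule measurable_continuous_process_at[where Z=X and S=M]) (use X cont nn in auto)
      show "{\<omega>\<in>space M. \<bar>X (\<tau> l \<omega> + r * (\<tau> (l + d n) \<omega> - \<tau> l \<omega>)) \<omega> - X (\<tau> l \<omega>) \<omega>\<bar> > \<eta>} \<in> events"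
        by measurable
    qed
    finally show ?thesis .
  qed
  have "(\<lambda>n. \<integral>\<omega>. indicat_real (A n) \<omega> \<partial>M) \<longlonglongrightarrow> (\<integral>\<omega>. 0 \<partial>M)"
  proof (rule integral_dominated_convergence[where w="\<lambda>_. 1"])
    show "AE \<omega> in M. (\<lambda>n. indicat_real (A n) \<omega>) \<longlonglongrightarrow> 0"
    proof (rule AE_I2)
      fix \<omega> assume w: "\<omega> \<in> space M"
      have "\<tau> l \<omega> \<in> {0..}" using nn(1)[OF w] by simp
      with cont[OF w] \<eta> obtain \<delta> where \<delta>: "\<delta> > 0"
        "\<And>u. 0 \<le> u \<Longrightarrow> \<bar>u - \<tau> l \<omega>\<bar> < \<delta> \<Longrightarrow> \<bar>X u \<omega> - X (\<tau> l \<omega>) \<omega>\<bar> < \<eta>"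
        unfolding continuous_on_iff dist_real_def by (metis atLeast_iff)
      have "((\<lambda>l. \<tau> l \<omega>) \<longlongrightarrow> \<tau> l \<omega>) (at_right l)"
        using \<tau> w l by (auto simp: stable_subordinator_def continuous_within)
      then have "eventually (\<lambda>u. \<tau> u \<omega> < \<tau> l \<omega> + \<delta>) (at_right l)"
        by (rule order_tendstoD(2)) (use \<delta> in simp)
      then obtain b where b: "b > l" "\<And>u. l < u \<Longrightarrow> u < b \<Longrightarrow> \<tau> u \<omega> < \<tau> l \<omega> + \<delta>"
        by (auto simp: eventually_at_right_field)
      have "eventually (\<lambda>n. d n < b - l) sequentially"
        by (rule order_tendstoD(2)[OF d(2)]) (use b in simp)
      then have "eventually (\<lambda>n. indicat_real (A n) \<omega> = 0) sequentially"
      proof eventually_elim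
        fix n assume n: "d n < b - l"
        have close: "\<tau> (l + d n) \<omega> < \<tau> l \<omega> + \<delta>"
          using b(2)[of "l + d n"] n d(1)[of n] \<delta>(1) by (cases "d n = 0") auto
        have "\<bar>X (\<tau> l \<omega> + r * (\<tau> (l + d n) \<omega> - \<tau> l \<omega>)) \<omega> - X (\<tau> l \<omega>) \<omega>\<bar> < \<eta>" if r: "r \<in> {0..1}" for r
        proof (rule \<delta>(2))
          have "0 \<le> r * (\<tau> (l + d n) \<omega> - \<tau> l \<omega>)" using nn(1)[OF w] nn(2)[OF w, of n] r by auto
          moreover have "r * (\<tau> (l + d n) \<omega> - \<tau> l \<omega>) \<le> 1 * (\<tau> (l + d n) \<omega> - \<tau> l \<omega>)"
            using nn(1)[OF w] nn(2)[OF w, of n] r by (intro mult_right_mono) auto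
          ultimately show "0 \<le> \<tau> l \<omega> + r * (\<tau> (l + d n) \<omega> - \<tau> l \<omega>)"
            "\<bar>\<tau> l \<omega> + r * (\<tau> (l + d n) \<omega> - \<tau> l \<omega>) - \<tau> l \<omega>\<bar> < \<delta>"
            using close nn(1)[OF w] nn(2)[OF w, of n] by auto
        qed
        then have "\<omega> \<notin> A n" by (fastforce simp: A_def)
        then show "indicat_real (A n) \<omega> = 0" by simp
      qed
      then show "(\<lambda>n. indicat_real (A n) \<omega>) \<longlonglongrightarrow> 0" by (rule tendsto_eventually)
    qed
    show "indicat_real (A n) \<in> borel_measurable M" for n using A[of n] by simp
  qed (auto simp: indicator_def)
  moreover have "(\<integral>\<omega>. indicat_real (A n) \<omega> \<partial>M) = prob (A n)" for n
    using sets.sets_into_space[OF A[of n]] by (simp add: Int_absorb2)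
  ultimately show ?thesis by (simp add: A_def)
qed

text \<open>
  The order of choice is \<open>m\<close> large (the charge for long steps), \<open>\<epsilon>\<close> small, then \<open>\<eta>\<close> small in terms of
  both.
\<close>

lemma ex_small_parameters:
  fixes \<alpha> c e :: real
  assumes "0 < \<alpha>" "0 < e"
  obtains m \<epsilon> \<eta> :: real where "m > 0" "\<epsilon> > 0" "\<eta> > 0"
    "\<epsilon> + 16 * \<eta>\<^sup>2 * m / \<epsilon>\<^sup>2 + 4 * (1 - exp (- c * m powr (- \<alpha>))) < e"
proof -
  have "((\<lambda>m. 4 * (1 - exp (- c * m powr (- \<alpha>)))) \<longlongrightarrow> 4 * (1 - exp (- c * 0))) at_top"
    using assms by (intro tendsto_intros tendsto_neg_powr filterlim_ident) auto
  then have "eventually (\<lambda>m. 4 * (1 - exp (- c * m powr (- \<alpha>))) < e / 4) at_top"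
    by (rule order_tendstoD) (use assms in simp)
  then have "eventually (\<lambda>m. m > 0 \<and> 4 * (1 - exp (- c * m powr (- \<alpha>))) < e / 4) at_top"
    using eventually_gt_at_top[of 0] by eventually_elim auto
  then obtain m :: real where m: "m > 0" "4 * (1 - exp (- c * m powr (- \<alpha>))) < e / 4"
    using eventually_happens[of _ "at_top :: real filter"] by auto
  define \<epsilon> where "\<epsilon> = e / 4"
  \<comment> \<open>the solution of \<open>16 \<eta>\<^sup>2 m / \<epsilon>\<^sup>2 = e / 4\<close>\<close>
  define \<eta> where "\<eta> = \<epsilon> * sqrt (e / (64 * m))"
  have "\<eta>\<^sup>2 = \<epsilon>\<^sup>2 * (e / (64 * m))" using assms m by (simp add: \<eta>_def power_mult_distrib)
  then have "16 * \<eta>\<^sup>2 * m / \<epsilon>\<^sup>2 = e / 4" using assms m by (simp add: \<epsilon>_def field_simps)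
  then show thesis using m assms by (intro that[of m \<epsilon> \<eta>]) (auto simp: \<epsilon>_def \<eta>_def)
qed

text \<open>
  With \<open>n + 1\<close> steps of length \<open>1 / (n + 1)\<^sup>2\<close> the number of steps tends to infinity while the
  window \<open>[l, l + 1 / (n + 1)]\<close> shrinks to \<open>l\<close>. The averages converge almost surely along a subsequence
  to a strictly decreasing function of \<open>\<bar>X\<bar>\<close> at time \<open>\<tau> l\<close>, which can be inverted.
\<close>

lemma (in prob_space) abs_subordinated_measurable:
  assumes F: "filtration_on M F" and B: "brownian_motion_in M F B" and X: "adapted F X"
    and cont: "\<And>\<omega>. \<omega> \<in> space M \<Longrightarrow> continuous_on {0..} (\<lambda>t. X t \<omega>)"
    and I: "ito_integral_process M F B X I"
    and \<alpha>: "0 < \<alpha>" and \<tau>: "stable_subordinator M \<alpha> \<tau>"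
    and ind: "indep_set (generated_sigma M \<tau> {0..}) (filtration_limit M F)"
    and l: "0 \<le> l" and \<delta>: "0 < \<delta>"
  shows "(\<lambda>\<omega>. \<bar>X (\<tau> l \<omega>) \<omega>\<bar>) \<in> borel_measurable
    (sigma (space M) (augmented M (generated_sigma M (\<lambda>l \<omega>. I (\<tau> l \<omega>) \<omega>) {0..l + \<delta>})))"
proof -
  obtain c where c: "c > 0" "\<And>q l. 0 \<le> q \<Longrightarrow> 0 \<le> l \<Longrightarrow> (\<integral>\<omega>. exp (- q * \<tau> l \<omega>) \<partial>M) = exp (- c * l * q powr \<alpha>)"
    using \<tau> unfolding stable_subordinator_def by metis
  define \<phi> where "\<phi> x = exp (- c * (x\<^sup>2 / 2) powr \<alpha>)" for x
  define h s where "h n = 1 / (real n + 1)\<^sup>2" and "s n = h n powr (1 / (2 * \<alpha>))" for n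
  have h: "h n > 0" "real (Suc n) * h n = inverse (real (Suc n))" for n
  proof -
    have "real n + 1 > 0" by simp
    then show "h n > 0" "real (Suc n) * h n = inverse (real (Suc n))"
      by (simp_all add: h_def power2_eq_square inverse_eq_divide add.commute)
  qed
  define J where "J u \<omega> = I (\<tau> u \<omega>) \<omega>" for u \<omega>
  define Y where "Y n \<omega> = (\<Sum>k<Suc n. cos ((J (l + real (Suc k) * h n) \<omega> - J (l + real k * h n) \<omega>) / s n)) / real (Suc n)" for n \<omega>
  define x where "x \<omega> = X (\<tau> l \<omega>) \<omega>" for \<omega>
  have XM: "X t \<in> borel_measurable M" if "0 \<le> t" for t
    using X that by (intro measurable_filtration_imp[OF F that]) (simp add: adapted_def)
  have IM: "I t \<in> borel_measurable M" if "0 \<le> t" for t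
    using I that by (auto simp: ito_integral_process_def converges_in_prob_def)
  have Icont: "continuous_on {0..} (\<lambda>u. I u \<omega>)" if "\<omega> \<in> space M" for \<omega>
    using I that by (simp add: ito_integral_process_def)
  have \<tau>M: "\<tau> u \<in> borel_measurable M" if "0 \<le> u" for u using \<tau> that by (simp add: stable_subordinator_def)
  have \<tau>0: "0 \<le> \<tau> u \<omega>" if "\<omega> \<in> space M" "0 \<le> u" for u \<omega>
    using stable_incr_nonneg(1)[OF \<tau> that order_refl] .
  have JM: "J u \<in> borel_measurable M" if "0 \<le> u" for u
    unfolding J_def[abs_def]
    by (rule measurable_continuous_process_at[where Z=I and S=M]) (use IM Icont \<tau>M \<tau>0 that in auto)
  have xM[measurable]: "x \<in> borel_measurable M"
    unfolding x_def[abs_def]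
    by (rule measurable_continuous_process_at[where Z=X and S=M]) (use XM cont \<tau>M \<tau>0 l in auto)
  have tn: "0 \<le> l + real k * h n" for k n using l h(1)[of n] by simp
  have YM[measurable]: "Y n \<in> borel_measurable M" for n
    unfolding Y_def[abs_def] by (intro borel_measurable_divide borel_measurable_sum borel_measurable_const
        borel_measurable_diff JM tn measurable_compose[OF _ borel_measurable_cos])
  have \<phi>M[measurable]: "\<phi> \<in> borel_measurable borel" unfolding \<phi>_def[abs_def] by measurable
  define D where "D n \<omega> = Y n \<omega> - \<phi> (x \<omega>)" for n \<omega>
  have DM[measurable]: "D n \<in> borel_measurable M" for n unfolding D_def[abs_def] by measurable
  have Db: "\<bar>D n \<omega>\<bar> \<le> 2" for n \<omega>
  proof -
    have "\<bar>\<Sum>k<Suc n. cos ((J (l + real (Suc k) * h n) \<omega> - J (l + real k * h n) \<omega>) / s n)\<bar> \<le> (\<Sum>k<Suc n. 1)"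
      by (intro order_trans[OF sum_abs] sum_mono) auto
    then have "\<bar>Y n \<omega>\<bar> \<le> 1" unfolding Y_def by (simp add: abs_divide)
    moreover have "0 < \<phi> (x \<omega>)" "\<phi> (x \<omega>) \<le> 1" using c(1) by (auto simp: \<phi>_def)
    ultimately show ?thesis unfolding D_def by linarith
  qed
  have Dint: "integrable M (D n)" for n using Db by (intro integrable_const_bound[of _ 2]) auto
  have L1: "(\<lambda>n. expectation (\<lambda>\<omega>. norm (D n \<omega>))) \<longlonglongrightarrow> 0"
  proof (rule LIMSEQ_I)
    fix e :: real assume e: "e > 0"
    obtain m \<epsilon> \<eta> where me: "m > 0" "\<epsilon> > 0" "\<eta> > 0"
      "\<epsilon> + 16 * \<eta>\<^sup>2 * m / \<epsilon>\<^sup>2 + 4 * (1 - exp (- c * m powr (- \<alpha>))) < e / 2"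
      using ex_small_parameters[OF \<alpha>, of "e / 2" c] e by auto
    define p where "p n = prob {\<omega>\<in>space M. \<exists>r\<in>\<rat> \<inter> {0..1}.
      \<bar>X (\<tau> l \<omega> + r * (\<tau> (l + real (Suc n) * h n) \<omega> - \<tau> l \<omega>)) \<omega> - X (\<tau> l \<omega>) \<omega>\<bar> > \<eta>}" for n
    have "p \<longlonglongrightarrow> 0"
      unfolding p_def
    proof (rule subordinated_path_oscillation_tendsto_0[OF XM cont \<tau> l me(3)])
      show "0 \<le> real (Suc n) * h n" for n using h(1)[of n] by simp
      show "(\<lambda>n. real (Suc n) * h n) \<longlonglongrightarrow> 0" unfolding h(2) by (rule LIMSEQ_inverse_real_of_nat)
    qed
    moreover have "(\<lambda>n. 4 / sqrt (real (Suc n))) \<longlonglongrightarrow> 0"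
      by real_asymp
    ultimately have "(\<lambda>n. 2 * p n + 4 / sqrt (real (Suc n))) \<longlonglongrightarrow> 2 * 0 + 0"
      by (intro tendsto_intros)
    then have "eventually (\<lambda>n. 2 * p n + 4 / sqrt (real (Suc n)) < e / 2) sequentially"
      by (rule order_tendstoD) (use e in simp)
    then obtain N where N: "\<And>n. n \<ge> N \<Longrightarrow> 2 * p n + 4 / sqrt (real (Suc n)) < e / 2"
      by (auto simp: eventually_sequentially)
    show "\<exists>N. \<forall>n\<ge>N. norm (expectation (\<lambda>\<omega>. norm (D n \<omega>)) - 0) < e"
    proof (intro exI[of _ N] allI impI)
      fix n assume n: "n \<ge> N"
      have "expectation (\<lambda>\<omega>. \<bar>D n \<omega>\<bar>) \<le> \<epsilon> + 2 * p n + 16 * \<eta>\<^sup>2 * m / \<epsilon>\<^sup>2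
          + 4 * (1 - exp (- c * m powr (- \<alpha>))) + 4 / sqrt (real (Suc n))"
        unfolding D_def Y_def J_def x_def \<phi>_def p_def
        by (rule subordinated_average_L1_le[OF F B X cont I \<alpha> \<tau> ind c l h(1) _ me(1,2) _ s_def])
          (use me in auto)
      then have "expectation (\<lambda>\<omega>. \<bar>D n \<omega>\<bar>) < e" using N[OF n] me(4) by linarith
      moreover have "0 \<le> expectation (\<lambda>\<omega>. \<bar>D n \<omega>\<bar>)" by (intro Bochner_Integration.integral_nonneg) auto
      ultimately show "norm (expectation (\<lambda>\<omega>. norm (D n \<omega>)) - 0) < e" by simp
    qed
  qed
  \<comment> \<open>from index \<open>N\<close> on, only times up to \<open>l + \<delta>\<close> are involved\<close>
  obtain N where N: "inverse (real (Suc N)) < \<delta>" using reals_Archimedean[OF \<delta>] by auto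
  have L1': "(\<lambda>n. expectation (\<lambda>\<omega>. norm (D (n + N) \<omega>))) \<longlonglongrightarrow> 0"
    using L1 by (rule LIMSEQ_ignore_initial_segment)
  from tendsto_L1_AE_subseq[OF Dint this] obtain r
    where ae: "AE \<omega> in M. (\<lambda>n. D (r n + N) \<omega>) \<longlonglongrightarrow> 0" by auto
  define Z where "Z \<omega> = lim (\<lambda>n. Y (r n + N) \<omega>)" for \<omega>
  have Z: "AE \<omega> in M. Z \<omega> = \<phi> (x \<omega>)"
    using ae
  proof eventually_elim
    fix \<omega> assume "(\<lambda>n. D (r n + N) \<omega>) \<longlonglongrightarrow> 0"
    then have "(\<lambda>n. Y (r n + N) \<omega>) \<longlonglongrightarrow> \<phi> (x \<omega>)" by (simp add: D_def LIM_zero_iff)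
    then show "Z \<omega> = \<phi> (x \<omega>)" unfolding Z_def by (rule limI)
  qed
  let ?G = "generated_sigma M J {0..l + \<delta>}"
  have ZG: "Z \<in> borel_measurable (sigma (space M) ?G)"
    unfolding Z_def[abs_def]
  proof (rule borel_measurable_lim_metric)
    fix n
    define i where "i = r n + N"
    have le: "l + real k * h i \<le> l + \<delta>" if "k \<le> Suc i" for k
    proof -
      have "real k * h i \<le> real (Suc i) * h i" using that h(1)[of i] by (intro mult_right_mono) auto
      also have "\<dots> = inverse (real (Suc i))" by (rule h(2))
      also have "\<dots> \<le> inverse (real (Suc N))" by (simp add: i_def)
      finally show ?thesis using N by simp
    qed
    have JG: "J (l + real k * h i) \<in> borel_measurable (sigma (space M) ?G)" if "k \<le> Suc i" for k
      using le[OF that] tn[of k i] by (intro measurable_generated_sigma) auto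
    have "Y i \<in> borel_measurable (sigma (space M) ?G)"
      unfolding Y_def[abs_def]
      by (intro borel_measurable_divide borel_measurable_sum borel_measurable_const
        borel_measurable_diff JG measurable_compose[OF _ borel_measurable_cos]) auto
    then show "Y (r n + N) \<in> borel_measurable (sigma (space M) ?G)" by (simp add: i_def)
  qed
  \<comment> \<open>the inverse of \<open>\<phi>\<close> on \<open>[0, \<infinity>)\<close>\<close>
  define \<psi> where "\<psi> y = sqrt (2 * (- ln y / c) powr (1 / \<alpha>))" for y
  have \<psi>: "\<psi> (\<phi> y) = \<bar>y\<bar>" for y
    using c(1) \<alpha> by (simp add: \<psi>_def \<phi>_def powr_powr)
  have \<psi>M: "\<psi> \<in> borel_measurable borel" unfolding \<psi>_def[abs_def] by measurable
  have "(\<lambda>\<omega>. \<bar>x \<omega>\<bar>) \<in> borel_measurable (sigma (space M) (augmented M ?G))"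
  proof (rule measurable_augmentedI[OF sigma_algebra_generated])
    show "?G \<subseteq> sets M" by (rule generated_sigma_subset) (use JM in auto)
    show "(\<lambda>\<omega>. \<psi> (Z \<omega>)) \<in> borel_measurable (sigma (space M) ?G)"
      by (rule measurable_compose[OF ZG \<psi>M])
    show "AE \<omega> in M. \<bar>x \<omega>\<bar> = \<psi> (Z \<omega>)" using Z by eventually_elim (simp add: \<psi>)
  qed measurable
  then show ?thesis by (simp add: x_def J_def[abs_def])
qed

lemma right_cont_filtration_eq_INT:
  "right_cont_filtration M Z l = (\<Inter>n::nat. generated_sigma M Z {0..l + inverse (real (Suc n))})"
proof (intro equalityI subsetI)
  fix A assume A: "A \<in> (\<Inter>n::nat. generated_sigma M Z {0..l + inverse (real (Suc n))})"
  have "A \<in> generated_sigma M Z {0..l + \<epsilon>}" if "\<epsilon> > 0" for \<epsilon>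
  proof -
    obtain n where "inverse (real (Suc n)) < \<epsilon>" using reals_Archimedean[OF \<open>\<epsilon> > 0\<close>] by auto
    then have "generated_sigma M Z {0..l + inverse (real (Suc n))} \<subseteq> generated_sigma M Z {0..l + \<epsilon>}"
      by (intro generated_sigma_mono) auto
    then show ?thesis using A by blast
  qed
  then show "A \<in> right_cont_filtration M Z l" by (simp add: right_cont_filtration_def)
qed (auto simp: right_cont_filtration_def)

text \<open>
  An event of the right-continuous filtration of \<open>Z\<close> at \<open>l\<close> depends on \<open>Z\<close> up to time \<open>l + \<delta> / 2\<close>, hence
  on \<open>W\<close> up to time \<open>l + \<delta>\<close> and a null event, for every \<open>\<delta> > 0\<close>. The intersection over \<open>\<delta>\<close> may then
  be taken before the null events are adjoined.
\<close>

lemma right_cont_filtration_subset_augmented: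
  assumes W: "\<And>t. 0 \<le> t \<Longrightarrow> W t \<in> borel_measurable M"
    and Z: "\<And>t \<delta>. 0 \<le> t \<Longrightarrow> 0 < \<delta> \<Longrightarrow>
      Z t \<in> borel_measurable (sigma (space M) (augmented M (generated_sigma M W {0..t + \<delta>})))"
  shows "right_cont_filtration M Z l \<subseteq> augmented M (right_cont_filtration M W l)"
proof
  fix A assume A: "A \<in> right_cont_filtration M Z l"
  have sub: "generated_sigma M W {0..u} \<subseteq> sets M" for u
    by (rule generated_sigma_subset) (use W in auto)
  have "A \<in> augmented M (generated_sigma M W {0..l + \<delta>})" if \<delta>: "\<delta> > 0" for \<delta>
  proof -
    let ?\<A> = "augmented M (generated_sigma M W {0..l + \<delta>})"
    interpret sigma_algebra "space M" ?\<A> by (rule sigma_algebra_augmented[OF sub])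
    have "Z t -` S \<inter> space M \<in> ?\<A>" if t: "0 \<le> t" "t \<le> l + \<delta> / 2" and S: "S \<in> sets borel" for t and S :: "real set"
    proof -
      interpret t: sigma_algebra "space M" "augmented M (generated_sigma M W {0..t + \<delta> / 2})"
        by (rule sigma_algebra_augmented[OF sub])
      have "Z t -` S \<inter> space M \<in> augmented M (generated_sigma M W {0..t + \<delta> / 2})"
        using measurable_sets[OF Z[OF t(1), of "\<delta> / 2"] S] \<delta> by (simp add: t.space_sets_sigma)
      moreover have "augmented M (generated_sigma M W {0..t + \<delta> / 2}) \<subseteq> ?\<A>"
        unfolding augmented_def using generated_sigma_mono[of "{0..t + \<delta> / 2}" "{0..l + \<delta>}" M W] t \<delta>
        by (intro sigma_sets_mono') auto
      ultimately show ?thesis by blast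
    qed
    then have "generated_sigma M Z {0..l + \<delta> / 2} \<subseteq> ?\<A>"
      unfolding generated_sigma_def[of M Z] by (intro sigma_sets_subset) auto
    moreover have "A \<in> generated_sigma M Z {0..l + \<delta> / 2}"
      using A \<delta> by (auto simp: right_cont_filtration_def)
    ultimately show ?thesis by blast
  qed
  then show "A \<in> augmented M (right_cont_filtration M W l)"
    unfolding right_cont_filtration_eq_INT
    by (intro augmented_INT sigma_algebra_generated sub generated_sigma_mono)
      (auto intro: order_trans)
qed

theorem proposition2:
  fixes M :: "'a measure" and F :: "real \<Rightarrow> 'a measure"
    and B X I \<tau> :: "real \<Rightarrow> 'a \<Rightarrow> real" and \<eta> \<alpha> :: real
  assumes "prob_space M"
    and "filtration_on M F"
    and "brownian_motion_in M F B"
    and "adapted F X"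
    and "\<And>\<omega>. \<omega> \<in> space M \<Longrightarrow> continuous_on {0..} (\<lambda>t. X t \<omega>)"
    and "ito_integral_process M F B X I"
    and "\<eta> > 0"
    and "AE \<omega> in M. holder_path \<eta> (\<lambda>t. X t \<omega>)"
    and "0 < \<alpha>" and "\<alpha> < 1"
    and "stable_subordinator M \<alpha> \<tau>"
    and "prob_space.indep_set M (generated_sigma M \<tau> {0..}) (filtration_limit M F)"
  shows "\<forall>l\<ge>0. right_cont_filtration M (\<lambda>l \<omega>. \<bar>X (\<tau> l \<omega>) \<omega>\<bar>) l
           \<subseteq> augmented M (right_cont_filtration M (\<lambda>l \<omega>. I (\<tau> l \<omega>) \<omega>) l)"
proof (intro allI impI right_cont_filtration_subset_augmented)
  interpret prob_space M by fact
  show "(\<lambda>\<omega>. I (\<tau> t \<omega>) \<omega>) \<in> borel_measurable M" if "0 \<le> t" for t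
  proof (rule measurable_continuous_process_at[where Z=I and S=M])
    show "I u \<in> borel_measurable M" if "0 \<le> u" for u
      using assms(6) that by (auto simp: ito_integral_process_def converges_in_prob_def)
    show "continuous_on {0..} (\<lambda>u. I u \<omega>)" if "\<omega> \<in> space M" for \<omega>
      using assms(6) that by (simp add: ito_integral_process_def)
    show "\<tau> t \<in> borel_measurable M" using assms(11) that by (simp add: stable_subordinator_def)
    show "0 \<le> \<tau> t \<omega>" if "\<omega> \<in> space M" for \<omega>
      using stable_incr_nonneg(1)[OF assms(11) that \<open>0 \<le> t\<close> order_refl] .
  qed simp
  show "(\<lambda>\<omega>. \<bar>X (\<tau> t \<omega>) \<omega>\<bar>) \<in> borel_measurable
      (sigma (space M) (augmented M (generated_sigma M (\<lambda>l \<omega>. I (\<tau> l \<omega>) \<omega>) {0..t + \<delta>})))"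
    if "0 \<le> t" "0 < \<delta>" for t \<delta>
    using assms that by (intro abs_subordinated_measurable[where F=F and B=B and \<alpha>=\<alpha>]) auto
qed

end
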